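(* For every separable metric structure $M$ (in a countable language, with at least two elements), the natural action of $\mathrm{Aut}(M)\wr\Omega$ on the Borel randomization $M^R$ identifies $\mathrm{Aut}(M)\wr\Omega$ with $\mathrm{Aut}(M^R)$ as topological groups; that is, $\mathrm{Aut}(M^R)=\mathrm{Aut}(M)\wr\Omega$.
   Context: Structures are in the sense of continuous first-order logic; automorphism groups carry the topology of pointwise convergence. $\Omega=[0,1]$ with Lebesgue measure $\mu$. The Borel randomization $M^R$ of $M$ (language $L$) is the two-sorted structure whose main sort is $M^\Omega=L^0(\Omega,M)$ (Borel maps modulo a.e. equality) with metric $d^\Omega(r,s)=\int d(r(\omega),s(\omega))\,d\mu$, and whose auxiliary sort is $\mathbb A=L^0(\Omega,[0,1])$ with metric $\mathbb E|R-S|$; it is equipped, for each $L$-formula $\varphi(x_1,\dots,x_n)$, with the function $[\![\varphi]\!]\colon(M^\Omega)^n\to\mathbb A$, $[\![\varphi(r)]\!](\omega)=\varphi(r(\omega))$, with the expectation predicate $\mathbb E\colon\mathbb A\to[0,1]$, $\mathbb ER=\int R\,d\mu$, and with functions for the pointwise continuous (arithmetic) operations on $\mathbb A$. $\mathrm{Aut}(\Omega)$ is the group of invertible measure-preserving transformations of $\Omega$ mod null sets; $G^\Omega$ the group of measurable maps $\Omega\to G$ mod null sets; $G\wr\Omega=G^\Omega\rtimes\mathrm{Aut}(\Omega)$ with $(t\cdot g)(\omega)=g(t^{-1}(\omega))$ and product topology (convergence in measure on $G^\Omega$). With $G=\mathrm{Aut}(M)$, $G\wr\Omega$ acts on $M^R$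 as follows: $g\in G^\Omega$ acts on $M^\Omega$ by $(gr)(\omega)=g(\omega)(r(\omega))$ and trivially on $\mathbb A$; $t\in\mathrm{Aut}(\Omega)$ acts on both sorts by $(tr)(\omega)=r(t^{-1}(\omega))$. *)

theory Defs
  imports "HOL-Probability.Probability"
begin

text \<open>A language: function symbols of type 'f and predicate symbols of type 'p
 (countable types), with arities. A metric structure has as universe the
 type 'm (a Polish, i.e. complete separable, metric space), with the type's metric.\<close>

record ('f, 'p, 'm) mstruct =
  fun_ar  :: "'f \<Rightarrow> nat"
  pred_ar :: "'p \<Rightarrow> nat"
  fun_int :: "'f \<Rightarrow> 'm list \<Rightarrow> 'm"
  pred_int :: "'p \<Rightarrow> 'm list \<Rightarrow> real"

definition ucont_list :: "nat \<Rightarrow> ('a::metric_space list \<Rightarrow> 'b::metric_space) \<Rightarrow> bool" where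
  "ucont_list n f \<longleftrightarrow> (\<forall>e>0. \<exists>d>0. \<forall>xs ys. length xs = n \<and> length ys = n \<and>
      (\<forall>i<n. dist (xs!i) (ys!i) < d) \<longrightarrow> dist (f xs) (f ys) < e)"

definition metric_structure :: "('f, 'p, 'm::metric_space) mstruct \<Rightarrow> bool" where
  "metric_structure M \<longleftrightarrow>
     (\<forall>x y::'m. dist x y \<le> 1) \<and>
     (\<forall>f. ucont_list (fun_ar M f) (fun_int M f)) \<and>
     (\<forall>p. ucont_list (pred_ar M p) (pred_int M p) \<and>
          (\<forall>xs. length xs = pred_ar M p \<longrightarrow> pred_int M p xs \<in> {0..1}))"

definition conn_ok :: "nat \<Rightarrow> (real list \<Rightarrow> real) \<Rightarrow> bool" where
  "conn_ok n c \<longleftrightarrow>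
     (\<forall>xs. length xs = n \<and> set xs \<subseteq> {0..1} \<longrightarrow> c xs \<in> {0..1}) \<and>
     (\<forall>e>0. \<exists>d>0. \<forall>xs ys. length xs = n \<and> length ys = n \<and> set xs \<subseteq> {0..1} \<and> set ys \<subseteq> {0..1} \<and>
        (\<forall>i<n. \<bar>xs!i - ys!i\<bar> < d) \<longrightarrow> \<bar>c xs - c ys\<bar> < e)"

datatype 'f trm = Var nat | Fn 'f "'f trm list"

datatype ('f, 'p) fml =
    Atom 'p "'f trm list"
  | Dst "'f trm" "'f trm"
  | Conn "real list \<Rightarrow> real" "('f, 'p) fml list"
  | Sup nat "('f, 'p) fml"
  | Inf nat "('f, 'p) fml"

fun wf_trm :: "('f, 'p, 'm) mstruct \<Rightarrow> 'f trm \<Rightarrow> bool" where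
  "wf_trm M (Var n) = True"
| "wf_trm M (Fn f ts) = (length ts = fun_ar M f \<and> (\<forall>t\<in>set ts. wf_trm M t))"

fun wf_fml :: "('f, 'p, 'm) mstruct \<Rightarrow> ('f, 'p) fml \<Rightarrow> bool" where
  "wf_fml M (Atom p ts) = (length ts = pred_ar M p \<and> (\<forall>t\<in>set ts. wf_trm M t))"
| "wf_fml M (Dst t u) = (wf_trm M t \<and> wf_trm M u)"
| "wf_fml M (Conn c fs) = (conn_ok (length fs) c \<and> (\<forall>f\<in>set fs. wf_fml M f))"
| "wf_fml M (Sup x f) = wf_fml M f"
| "wf_fml M (Inf x f) = wf_fml M f"

fun teval :: "('f, 'p, 'm) mstruct \<Rightarrow> (nat \<Rightarrow> 'm) \<Rightarrow> 'f trm \<Rightarrow> 'm" where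
  "teval M \<rho> (Var n) = \<rho> n"
| "teval M \<rho> (Fn f ts) = fun_int M f (map (teval M \<rho>) ts)"

fun feval :: "('f, 'p, 'm::metric_space) mstruct \<Rightarrow> (nat \<Rightarrow> 'm) \<Rightarrow> ('f, 'p) fml \<Rightarrow> real" where
  "feval M \<rho> (Atom p ts) = pred_int M p (map (teval M \<rho>) ts)"
| "feval M \<rho> (Dst t u) = dist (teval M \<rho> t) (teval M \<rho> u)"
| "feval M \<rho> (Conn c fs) = c (map (feval M \<rho>) fs)"
| "feval M \<rho> (Sup x f) = (SUP a. feval M (\<rho>(x := a)) f)"
| "feval M \<rho> (Inf x f) = (INF a. feval M (\<rho>(x := a)) f)"

definition autM :: "('f, 'p, 'm::metric_space) mstruct \<Rightarrow> ('m \<Rightarrow> 'm) set" where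
  "autM M = {g. bij g \<and> (\<forall>x y. dist (g x) (g y) = dist x y) \<and>
     (\<forall>f xs. length xs = fun_ar M f \<longrightarrow> g (fun_int M f xs) = fun_int M f (map g xs)) \<and>
     (\<forall>p xs. length xs = pred_ar M p \<longrightarrow> pred_int M p (map g xs) = pred_int M p xs)}"

text \<open>The topology of pointwise convergence on Aut(M) is the subspace topology of the
  product topology on 'm \<Rightarrow> 'm (Function_Topology).\<close>

definition compatible_metric :: "('a::topological_space) set \<Rightarrow> ('a \<Rightarrow> 'a \<Rightarrow> real) \<Rightarrow> bool" where
  "compatible_metric G \<rho> \<longleftrightarrow> Metric_space G \<rho> \<and> Metric_space.mtopology G \<rho> = subtopology euclidean G"

definition \<Omega> :: "real measure" where
  "\<Omega> = restrict_space lborel {0..1}"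

definition aeq :: "(real \<Rightarrow> 'a) \<Rightarrow> (real \<Rightarrow> 'a) \<Rightarrow> bool" where
  "aeq r s \<longleftrightarrow> (AE \<omega> in \<Omega>. r \<omega> = s \<omega>)"

definition aecls :: "(real \<Rightarrow> 'a) set \<Rightarrow> (real \<Rightarrow> 'a) \<Rightarrow> (real \<Rightarrow> 'a) set" where
  "aecls S r = {s \<in> S. aeq s r}"

definition rep :: "(real \<Rightarrow> 'a) set \<Rightarrow> real \<Rightarrow> 'a" where
  "rep X = (SOME r. r \<in> X)"

definition L0M :: "(real \<Rightarrow> 'm::topological_space) set" where
  "L0M = borel_measurable \<Omega>"

definition L0A :: "(real \<Rightarrow> real) set" where
  "L0A = {R \<in> borel_measurable \<Omega>. \<forall>\<omega>\<in>space \<Omega>. R \<omega> \<in> {0..1}}"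

definition MainC :: "(real \<Rightarrow> 'm::topological_space) set set" where
  "MainC = aecls L0M ` L0M"

definition AuxC :: "(real \<Rightarrow> real) set set" where
  "AuxC = aecls L0A ` L0A"

definition dMain :: "(real \<Rightarrow> 'm::metric_space) set \<Rightarrow> (real \<Rightarrow> 'm) set \<Rightarrow> real" where
  "dMain X Y = (\<integral>\<omega>. dist (rep X \<omega>) (rep Y \<omega>) \<partial>\<Omega>)"

definition dAux :: "(real \<Rightarrow> real) set \<Rightarrow> (real \<Rightarrow> real) set \<Rightarrow> real" where
  "dAux X Y = (\<integral>\<omega>. \<bar>rep X \<omega> - rep Y \<omega>\<bar> \<partial>\<Omega>)"

definition EA :: "(real \<Rightarrow> real) set \<Rightarrow> real" where
  "EA X = (\<integral>\<omega>. rep X \<omega> \<partial>\<Omega>)"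

definition semR :: "('f, 'p, 'm::metric_space) mstruct \<Rightarrow> ('f, 'p) fml \<Rightarrow>
    (nat \<Rightarrow> (real \<Rightarrow> 'm) set) \<Rightarrow> (real \<Rightarrow> real) set" where
  "semR M \<phi> \<rho> = aecls L0A (\<lambda>\<omega>. feval M (\<lambda>i. rep (\<rho> i) \<omega>) \<phi>)"

definition connA :: "(real list \<Rightarrow> real) \<Rightarrow> (real \<Rightarrow> real) set list \<Rightarrow> (real \<Rightarrow> real) set" where
  "connA c Xs = aecls L0A (\<lambda>\<omega>. c (map (\<lambda>X. rep X \<omega>) Xs))"

type_synonym ('m) autR =
  "((real \<Rightarrow> 'm) set \<Rightarrow> (real \<Rightarrow> 'm) set) \<times> ((real \<Rightarrow> real) set \<Rightarrow> (real \<Rightarrow> real) set)"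

definition autMR :: "('f, 'p, 'm::metric_space) mstruct \<Rightarrow> 'm autR set" where
  "autMR M = {(\<Phi>, \<Psi>).
     bij_betw \<Phi> MainC MainC \<and> bij_betw \<Psi> AuxC AuxC \<and>
     (\<forall>X\<in>MainC. \<forall>Y\<in>MainC. dMain (\<Phi> X) (\<Phi> Y) = dMain X Y) \<and>
     (\<forall>X\<in>AuxC. \<forall>Y\<in>AuxC. dAux (\<Psi> X) (\<Psi> Y) = dAux X Y) \<and>
     (\<forall>\<phi> \<rho>. wf_fml M \<phi> \<and> (\<forall>i. \<rho> i \<in> MainC) \<longrightarrow> \<Psi> (semR M \<phi> \<rho>) = semR M \<phi> (\<Phi> \<circ> \<rho>)) \<and>
     (\<forall>X\<in>AuxC. EA (\<Psi> X) = EA X) \<and>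
     (\<forall>c Xs. conn_ok (length Xs) c \<and> set Xs \<subseteq> AuxC \<longrightarrow> \<Psi> (connA c Xs) = connA c (map \<Psi> Xs))}"

definition autR_eq :: "'m autR \<Rightarrow> 'm::topological_space autR \<Rightarrow> bool" where
  "autR_eq a b \<longleftrightarrow> (\<forall>X\<in>MainC. fst a X = fst b X) \<and> (\<forall>X\<in>AuxC. snd a X = snd b X)"

definition autR_comp :: "'m autR \<Rightarrow> 'm autR \<Rightarrow> 'm autR" where
  "autR_comp a b = (fst a \<circ> fst b, snd a \<circ> snd b)"

text \<open>Topology of pointwise convergence on Aut(M^R), expressed by convergence along filters.\<close>

definition autR_conv :: "'i filter \<Rightarrow> ('i \<Rightarrow> 'm autR) \<Rightarrow> 'm::metric_space autR \<Rightarrow> bool" where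
  "autR_conv F as a \<longleftrightarrow>
     (\<forall>X\<in>MainC. ((\<lambda>i. dMain (fst (as i) X) (fst a X)) \<longlongrightarrow> 0) F) \<and>
     (\<forall>X\<in>AuxC. ((\<lambda>i. dAux (snd (as i) X) (snd a X)) \<longlongrightarrow> 0) F)"

definition mp :: "(real \<Rightarrow> real) \<Rightarrow> bool" where
  "mp t \<longleftrightarrow> t \<in> measurable \<Omega> \<Omega> \<and> distr \<Omega> \<Omega> t = \<Omega>"

text \<open>Representatives of elements of Aut(\<Omega>): invertible (mod null sets) measure-preserving maps.\<close>

definition autOmega :: "(real \<Rightarrow> real) set" where
  "autOmega = {t. mp t \<and> (\<exists>s. mp s \<and> (AE \<omega> in \<Omega>. s (t \<omega>) = \<omega>) \<and> (AE \<omega> in \<Omega>. t (s \<omega>) = \<omega>))}"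

definition tinv :: "(real \<Rightarrow> real) \<Rightarrow> real \<Rightarrow> real" where
  "tinv t = (SOME s. mp s \<and> (AE \<omega> in \<Omega>. s (t \<omega>) = \<omega>) \<and> (AE \<omega> in \<Omega>. t (s \<omega>) = \<omega>))"

text \<open>Representatives of elements of G^\<Omega>: Borel maps \<Omega> \<rightarrow> Aut(M).\<close>

definition L0G :: "('f, 'p, 'm::metric_space) mstruct \<Rightarrow> (real \<Rightarrow> 'm \<Rightarrow> 'm) set" where
  "L0G M = {g. g \<in> borel_measurable \<Omega> \<and> (\<forall>\<omega>\<in>space \<Omega>. g \<omega> \<in> autM M)}"

text \<open>Multiplication in G^\<Omega> \<rtimes> Aut(\<Omega>), with (t\<cdot>g)(\<omega>) = g(t^{-1}\<omega>).\<close>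

definition wr_mult :: "((real \<Rightarrow> 'm \<Rightarrow> 'm) \<times> (real \<Rightarrow> real)) \<Rightarrow> ((real \<Rightarrow> 'm \<Rightarrow> 'm) \<times> (real \<Rightarrow> real))
    \<Rightarrow> ((real \<Rightarrow> 'm \<Rightarrow> 'm) \<times> (real \<Rightarrow> real))" where
  "wr_mult a b = ((\<lambda>\<omega>. fst a \<omega> \<circ> fst b (tinv (snd a) \<omega>)), snd a \<circ> snd b)"

definition convG :: "('f, 'p, 'm::metric_space) mstruct \<Rightarrow> 'i filter \<Rightarrow> ('i \<Rightarrow> real \<Rightarrow> 'm \<Rightarrow> 'm) \<Rightarrow> (real \<Rightarrow> 'm \<Rightarrow> 'm) \<Rightarrow> bool" where
  "convG M F gs g \<longleftrightarrow> (\<forall>\<rho>. compatible_metric (autM M) \<rho> \<longrightarrow>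
     (\<forall>e>0. ((\<lambda>i. measure \<Omega> {\<omega>\<in>space \<Omega>. \<rho> (gs i \<omega>) (g \<omega>) > e}) \<longlongrightarrow> 0) F))"

definition convOmega :: "'i filter \<Rightarrow> ('i \<Rightarrow> real \<Rightarrow> real) \<Rightarrow> (real \<Rightarrow> real) \<Rightarrow> bool" where
  "convOmega F ts t \<longleftrightarrow> (\<forall>A\<in>sets \<Omega>.
     ((\<lambda>i. measure \<Omega> (((ts i -` A \<inter> space \<Omega>) - (t -` A \<inter> space \<Omega>)) \<union>
                       ((t -` A \<inter> space \<Omega>) - (ts i -` A \<inter> space \<Omega>)))) \<longlongrightarrow> 0) F)"

definition wr_conv :: "('f, 'p, 'm::metric_space) mstruct \<Rightarrow> 'i filter \<Rightarrow>
    ('i \<Rightarrow> (real \<Rightarrow> 'm \<Rightarrow> 'm) \<times> (real \<Rightarrow> real)) \<Rightarrow> (real \<Rightarrow> 'm \<Rightarrow> 'm) \<times> (real \<Rightarrow> real) \<Rightarrow> bool" where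
  "wr_conv M F as a \<longleftrightarrow> convG M F (\<lambda>i. fst (as i)) (fst a) \<and> convOmega F (\<lambda>i. snd (as i)) (snd a)"

definition wr_act :: "(real \<Rightarrow> 'm \<Rightarrow> 'm) \<times> (real \<Rightarrow> real) \<Rightarrow> 'm::topological_space autR" where
  "wr_act a = ((\<lambda>X. aecls L0M (\<lambda>\<omega>. fst a \<omega> (rep X (tinv (snd a) \<omega>)))),
               (\<lambda>X. aecls L0A (\<lambda>\<omega>. rep X (tinv (snd a) \<omega>))))"

end

theory Submission
  imports Defs
begin

text \<open>
  Let \<open>(\<Phi>, \<Psi>)\<close> be an automorphism of the randomization and \<open>T = \<Psi> [id]\<close>. Continuous connectives give
  \<open>\<Psi> [c] = [c \<circ> T]\<close> for continuous \<open>c\<close>; preservation of expectations then says that \<open>T\<close> preserves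
  Lebesgue measure, density of the continuous functions in \<open>L\<^sup>1\<close> gives \<open>\<Psi> [R] = [R \<circ> T]\<close> for all \<open>R\<close>,
  and surjectivity of \<open>\<Psi>\<close> provides the inverse \<open>t\<close> of \<open>T\<close>. On the main sort, the images under \<open>\<Phi>\<close> of the
  constants from a countable dense set satisfy almost everywhere the same atomic conditions as the
  constants themselves, hence extend at almost every \<open>\<omega>\<close> to an embedding \<open>g \<omega>\<close>. Comparing the distances
  from \<open>\<Phi> r\<close> to these constants yields \<open>(\<Phi> r) \<omega> = g \<omega> (r (T \<omega>))\<close>, and surjectivity of \<open>\<Phi>\<close> makes
  \<open>g \<omega>\<close> onto.

  For the topologies, random elements are approximated by countably valued ones. Convergence in
  measure does not depend on the compatible metric: for \<open>e > 0\<close>, the automorphisms at which a basic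
  neighbourhood of size \<open>k\<close> is not contained in the \<open>e\<close>-ball decrease to the empty set as \<open>k\<close> grows.
\<close>

subsection \<open>The probability space and measure-preserving maps\<close>

text \<open>Every pointwise claim about classes modulo null sets costs a null set; countably many
  symbols, variables and dense points keep these costs countable. The obstacle is that the wreath
  product asks for one Borel map into \<open>autM M\<close>, whereas \<open>\<Phi>\<close> only
  gives a random element for each constant. Distances to a dense sequence carry the passage: they
  determine points, express values of function symbols that miss the sequence, and detect
  surjectivity. The topology of \<open>'m \<Rightarrow> 'm\<close> is a product over a possibly
  uncountable index; restriction to the dense sequence embeds \<open>autM M\<close> into a countable
  product, which is the origin of \<open>aut_dist\<close> and of \<open>L0G_I\<close>. The filter
  \<open>F\<close> is arbitrary, so that equivalence of the two convergences means equality of the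
  two topologies. Dominated convergence, a statement on sequences, is therefore replaced along
  \<open>F\<close> by bounds of the form \<open>b i + e\<close> with \<open>b\<close> tending to 0.
  Quantified formulas are suprema and infima over possibly uncountable families; their measurability
  rests on uniform continuity in finitely many variables.\<close>

lemma space_Omega [simp]: "space \<Omega> = {0..1}"
  by (simp add: \<Omega>_def space_restrict_space)

lemma prob_space_Omega: "prob_space \<Omega>"
  by standard (simp add: \<Omega>_def space_restrict_space emeasure_restrict_space)

interpretation Om: prob_space \<Omega>
  by (rule prob_space_Omega)

lemma sets_Omega: "A \<in> sets \<Omega> \<longleftrightarrow> A \<in> sets borel \<and> A \<subseteq> {0..1}"
  by (auto simp: \<Omega>_def sets_restrict_space_iff)

lemma measurable_ident_Omega: "(\<lambda>\<omega>. \<omega>) \<in> borel_measurable \<Omega>"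
  unfolding \<Omega>_def by (intro measurable_restrict_space1) simp

lemma measurable_into_Omega:
  assumes "f \<in> borel_measurable \<Omega>" and "\<And>\<omega>. \<omega> \<in> space \<Omega> \<Longrightarrow> f \<omega> \<in> {0..1}"
  shows "f \<in> measurable \<Omega> \<Omega>"
proof (rule measurableI)
  show "f -` A \<inter> space \<Omega> \<in> sets \<Omega>" if "A \<in> sets \<Omega>" for A
    using measurable_sets[OF assms(1), of A] that by (simp add: sets_Omega[of A])
qed (use assms(2) in simp)

lemma mp_measurable: "mp t \<Longrightarrow> t \<in> measurable \<Omega> \<Omega>"
  by (simp add: mp_def)

lemma AE_mp_pullback:
  assumes "mp t" and "AE \<omega> in \<Omega>. P \<omega>"
  shows "AE \<omega> in \<Omega>. P (t \<omega>)"
proof -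
  have "distr \<Omega> \<Omega> t = \<Omega>" using assms(1) by (simp add: mp_def)
  then have "AE x in distr \<Omega> \<Omega> t. P x" using assms(2) by metis
  then show ?thesis by (rule AE_distrD[OF mp_measurable[OF assms(1)]])
qed

lemma integral_mp:
  fixes f :: "real \<Rightarrow> real"
  assumes "mp t" and "f \<in> borel_measurable \<Omega>"
  shows "(\<integral>\<omega>. f (t \<omega>) \<partial>\<Omega>) = (\<integral>\<omega>. f \<omega> \<partial>\<Omega>)"
  using integral_distr[OF mp_measurable[OF assms(1)] assms(2)] assms(1) by (simp add: mp_def)

lemma mp_comp:
  assumes "mp s" "mp t" shows "mp (s \<circ> t)"
proof -
  have "distr \<Omega> \<Omega> (s \<circ> t) = distr (distr \<Omega> \<Omega> t) \<Omega> s"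
    using assms by (subst distr_distr) (auto simp: mp_def)
  then show ?thesis
    using assms by (auto simp: mp_def intro: measurable_comp)
qed

lemma tinv_spec:
  assumes "t \<in> autOmega"
  shows "mp (tinv t)" "AE \<omega> in \<Omega>. tinv t (t \<omega>) = \<omega>" "AE \<omega> in \<Omega>. t (tinv t \<omega>) = \<omega>"
proof -
  obtain s where "mp s \<and> (AE \<omega> in \<Omega>. s (t \<omega>) = \<omega>) \<and> (AE \<omega> in \<Omega>. t (s \<omega>) = \<omega>)"
    using assms by (auto simp: autOmega_def)
  from someI[of "\<lambda>s. mp s \<and> (AE \<omega> in \<Omega>. s (t \<omega>) = \<omega>) \<and> (AE \<omega> in \<Omega>. t (s \<omega>) = \<omega>)", OF this]
  show "mp (tinv t)" "AE \<omega> in \<Omega>. tinv t (t \<omega>) = \<omega>" "AE \<omega> in \<Omega>. t (tinv t \<omega>) = \<omega>"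
    by (auto simp: tinv_def)
qed

lemma autOmega_mp: "t \<in> autOmega \<Longrightarrow> mp t"
  by (simp add: autOmega_def)

lemma autOmegaI:
  "\<lbrakk>mp t; mp s; AE \<omega> in \<Omega>. s (t \<omega>) = \<omega>; AE \<omega> in \<Omega>. t (s \<omega>) = \<omega>\<rbrakk> \<Longrightarrow> t \<in> autOmega"
  by (auto simp: autOmega_def)

text \<open>Almost everywhere s = s' t' s = s' t s = s'. Preservation of measure by \<open>s\<close>
  lets the last two hypotheses be evaluated at \<open>s \<omega>\<close>. Swapping the roles of maps
  and inverses yields the converse direction of \<open>tinv_cong_iff\<close>.\<close>

lemma AE_inverse_unique:
  assumes "mp s" "AE \<omega> in \<Omega>. t (s \<omega>) = \<omega>" "AE \<omega> in \<Omega>. s' (t' \<omega>) = \<omega>" "aeq t t'"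
  shows "aeq s s'"
  using assms(2) AE_mp_pullback[OF assms(1,3)] AE_mp_pullback[OF assms(1) assms(4)[unfolded aeq_def]]
  unfolding aeq_def by eventually_elim simp

lemma tinv_cong:
  assumes "t \<in> autOmega" "t' \<in> autOmega" "aeq t t'"
  shows "aeq (tinv t) (tinv t')"
  by (rule AE_inverse_unique[OF tinv_spec(1)[OF assms(1)] tinv_spec(3)[OF assms(1)]
        tinv_spec(2)[OF assms(2)] assms(3)])

lemma tinv_cong_iff:
  assumes "t \<in> autOmega" "t' \<in> autOmega"
  shows "aeq (tinv t) (tinv t') \<longleftrightarrow> aeq t t'"
  using tinv_cong[OF assms]
    AE_inverse_unique[of t "tinv t" t' "tinv t'", OF autOmega_mp[OF assms(1)] tinv_spec(2)[OF assms(1)] tinv_spec(3)[OF assms(2)]]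
  by blast

text \<open>\<open>tinv\<close> is an arbitrary choice among inverses modulo null sets, so it
  reverses composition only almost everywhere.\<close>

lemma autOmega_comp:
  assumes "t \<in> autOmega" "t' \<in> autOmega"
  shows "t \<circ> t' \<in> autOmega" "aeq (tinv (t \<circ> t')) (tinv t' \<circ> tinv t)"
proof -
  note a = tinv_spec[OF assms(1)] and b = tinv_spec[OF assms(2)]
  have 1: "AE \<omega> in \<Omega>. (tinv t' \<circ> tinv t) ((t \<circ> t') \<omega>) = \<omega>"
    using b(2) AE_mp_pullback[OF autOmega_mp[OF assms(2)] a(2)] by eventually_elim simp
  have 2: "AE \<omega> in \<Omega>. (t \<circ> t') ((tinv t' \<circ> tinv t) \<omega>) = \<omega>"
    using a(3) AE_mp_pullback[OF a(1) b(3)] by eventually_elim simp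
  show c: "t \<circ> t' \<in> autOmega"
    by (rule autOmegaI[OF mp_comp[OF assms[THEN autOmega_mp]] mp_comp[OF b(1) a(1)] 1 2])
  show "aeq (tinv (t \<circ> t')) (tinv t' \<circ> tinv t)"
    by (rule AE_inverse_unique[where t = "t \<circ> t'" and t' = "t \<circ> t'", OF tinv_spec(1)[OF c] tinv_spec(3)[OF c] 1]) (simp add: aeq_def)
qed

subsection \<open>Classes modulo null sets\<close>

lemma aeq_refl [simp]: "aeq r r"
  by (simp add: aeq_def)

lemma aeq_sym: "aeq r s \<Longrightarrow> aeq s r"
  by (simp add: aeq_def eq_commute)

lemma aeq_trans: "aeq r s \<Longrightarrow> aeq s u \<Longrightarrow> aeq r u"
proof -
  assume "aeq r s" "aeq s u"
  then show ?thesis unfolding aeq_def by eventually_elim simp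
qed

lemma rep_aecls:
  assumes "r \<in> S" shows "rep (aecls S r) \<in> S" "aeq (rep (aecls S r)) r"
proof -
  have "r \<in> aecls S r" using assms by (simp add: aecls_def)
  then have "rep (aecls S r) \<in> aecls S r" unfolding rep_def by (rule someI[of "\<lambda>s. s \<in> aecls S r"])
  then show "rep (aecls S r) \<in> S" "aeq (rep (aecls S r)) r" by (auto simp: aecls_def)
qed

lemma aecls_eq_iff: "r \<in> S \<Longrightarrow> aecls S r = aecls S s \<longleftrightarrow> aeq r s"
  unfolding aecls_def using aeq_refl[of r] aeq_sym[of r s] aeq_trans[of _ r s] aeq_trans[of _ s r] by blast

lemma aecls_rep:
  assumes "X \<in> aecls S ` S" shows "rep X \<in> S" "aecls S (rep X) = X"
proof -
  obtain r where r: "r \<in> S" "X = aecls S r" using assms by auto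
  show "rep X \<in> S" "aecls S (rep X) = X"
    using rep_aecls[OF r(1)] aecls_eq_iff[of "rep X" S r] r by auto
qed

lemma MainC_rep: "X \<in> MainC \<Longrightarrow> rep X \<in> borel_measurable \<Omega>" "X \<in> MainC \<Longrightarrow> aecls L0M (rep X) = X"
  using aecls_rep[of X L0M] by (auto simp: MainC_def L0M_def)

lemma AuxC_rep: "X \<in> AuxC \<Longrightarrow> rep X \<in> L0A" "X \<in> AuxC \<Longrightarrow> aecls L0A (rep X) = X"
  using aecls_rep[of X L0A] by (auto simp: AuxC_def)

lemma MainC_I: "r \<in> borel_measurable \<Omega> \<Longrightarrow> aecls L0M r \<in> MainC"
  by (simp add: MainC_def L0M_def)

lemma AuxC_I: "R \<in> L0A \<Longrightarrow> aecls L0A R \<in> AuxC"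
  by (simp add: AuxC_def)

lemma rep_Main: "r \<in> borel_measurable \<Omega> \<Longrightarrow> AE \<omega> in \<Omega>. rep (aecls L0M r) \<omega> = r \<omega>"
  using rep_aecls(2)[of r L0M] by (simp add: L0M_def aeq_def)

lemma rep_Aux: "R \<in> L0A \<Longrightarrow> AE \<omega> in \<Omega>. rep (aecls L0A R) \<omega> = R \<omega>"
  using rep_aecls(2)[of R L0A] by (simp add: aeq_def)

lemma L0A_measurable: "R \<in> L0A \<Longrightarrow> R \<in> borel_measurable \<Omega>"
  by (simp add: L0A_def)

lemma L0A_comp: "R \<in> L0A \<Longrightarrow> t \<in> measurable \<Omega> \<Omega> \<Longrightarrow> (\<lambda>\<omega>. R (t \<omega>)) \<in> L0A"
  unfolding L0A_def using measurable_space[of t \<Omega> \<Omega>] by (auto intro: measurable_compose)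

lemma L0A_abs_diff_le:
  assumes "R \<in> L0A" "Q \<in> L0A" "\<omega> \<in> {0..1}" shows "\<bar>R \<omega> - Q \<omega>\<bar> \<le> 1"
proof -
  have "0 \<le> R \<omega>" "R \<omega> \<le> 1" "0 \<le> Q \<omega>" "Q \<omega> \<le> 1" using assms by (auto simp: L0A_def)
  then show ?thesis by linarith
qed

lemma dMain_rep:
  fixes r q :: "real \<Rightarrow> 'm::{metric_space, second_countable_topology}"
  assumes "X \<in> MainC" "Y \<in> MainC" "r \<in> borel_measurable \<Omega>" "q \<in> borel_measurable \<Omega>"
    and "AE \<omega> in \<Omega>. rep X \<omega> = r \<omega>" "AE \<omega> in \<Omega>. rep Y \<omega> = q \<omega>"
  shows "dMain X Y = (\<integral>\<omega>. dist (r \<omega>) (q \<omega>) \<partial>\<Omega>)"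
  unfolding dMain_def
proof (rule integral_cong_AE)
  show "AE \<omega> in \<Omega>. dist (rep X \<omega>) (rep Y \<omega>) = dist (r \<omega>) (q \<omega>)"
    using assms(5,6) by eventually_elim simp
qed (use assms MainC_rep(1) in \<open>auto intro!: borel_measurable_dist\<close>)

lemma dMain_aecls:
  fixes r q :: "real \<Rightarrow> 'm::{metric_space, second_countable_topology}"
  assumes "r \<in> borel_measurable \<Omega>" "q \<in> borel_measurable \<Omega>"
  shows "dMain (aecls L0M r) (aecls L0M q) = (\<integral>\<omega>. dist (r \<omega>) (q \<omega>) \<partial>\<Omega>)"
  using assms by (intro dMain_rep MainC_I rep_Main)

lemma dAux_aecls:
  assumes "R \<in> L0A" "Q \<in> L0A"
  shows "dAux (aecls L0A R) (aecls L0A Q) = (\<integral>\<omega>. \<bar>R \<omega> - Q \<omega>\<bar> \<partial>\<Omega>)"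
  unfolding dAux_def
proof (rule integral_cong_AE)
  show "AE \<omega> in \<Omega>. \<bar>rep (aecls L0A R) \<omega> - rep (aecls L0A Q) \<omega>\<bar> = \<bar>R \<omega> - Q \<omega>\<bar>"
    using rep_Aux[OF assms(1)] rep_Aux[OF assms(2)] by eventually_elim simp
qed (use assms rep_aecls(1)[of _ L0A] L0A_measurable in \<open>auto intro!: borel_measurable_abs borel_measurable_diff\<close>)

lemma EA_aecls:
  assumes "R \<in> L0A" shows "EA (aecls L0A R) = (\<integral>\<omega>. R \<omega> \<partial>\<Omega>)"
  unfolding EA_def using rep_Aux[OF assms] rep_aecls(1)[OF assms] assms L0A_measurable
  by (intro integral_cong_AE) auto

lemma integrable_bounded:
  fixes f :: "real \<Rightarrow> real"
  assumes "f \<in> borel_measurable \<Omega>" "\<And>\<omega>. \<omega> \<in> {0..1} \<Longrightarrow> \<bar>f \<omega>\<bar> \<le> B"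
  shows "integrable \<Omega> f"
  using assms by (intro Om.integrable_const_bound[of _ B]) auto

lemma AE_eq_if_integral_dist_eq_0:
  fixes r q :: "real \<Rightarrow> 'm::{metric_space, second_countable_topology}"
  assumes "r \<in> borel_measurable \<Omega>" "q \<in> borel_measurable \<Omega>"
    and "\<And>\<omega>. \<omega> \<in> {0..1} \<Longrightarrow> dist (r \<omega>) (q \<omega>) \<le> 1"
    and "(\<integral>\<omega>. dist (r \<omega>) (q \<omega>) \<partial>\<Omega>) = 0"
  shows "aeq r q"
proof -
  have "integrable \<Omega> (\<lambda>\<omega>. dist (r \<omega>) (q \<omega>))"
    using assms by (intro integrable_bounded[of _ 1] borel_measurable_dist) auto
  from integral_nonneg_eq_0_iff_AE[OF this] show ?thesis
    using assms(4) by (simp add: aeq_def)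
qed

subsection \<open>Measurability of maps into the structure and its automorphism group\<close>

lemma dense_sequence:
  obtains d :: "nat \<Rightarrow> 'a::{metric_space, second_countable_topology}"
  where "\<And>x e. e > 0 \<Longrightarrow> \<exists>n. dist (d n) x < e"
proof -
  obtain D :: "'a set" where D: "countable D" "\<And>X. open X \<Longrightarrow> X \<noteq> {} \<Longrightarrow> \<exists>d\<in>D. d \<in> X"
    by (rule countable_dense_setE) blast
  from D(2)[of UNIV] have "D \<noteq> {}" by auto
  have "\<exists>n. dist (from_nat_into D n) x < e" if "e > 0" for x e
  proof -
    have "ball x e \<noteq> {}" using that by auto
    then obtain y where "y \<in> D" "y \<in> ball x e" using D(2)[of "ball x e"] by auto
    then show ?thesis
      using from_nat_into_surj[OF D(1)] by (metis dist_commute mem_ball)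
  qed
  then show ?thesis by (rule that)
qed

text \<open>An open set is the union of the countably many balls it contains with centre in a dense
  sequence and radius \<open>1 / Suc k\<close>, and the preimages of balls are given by distance
  functions. This makes isometries easy to handle: they can be moved across
  \<open>dist\<close>.\<close>

lemma borel_measurable_if_dist:
  fixes f :: "'a \<Rightarrow> 'm::{metric_space, second_countable_topology}"
  assumes "\<And>x. (\<lambda>\<omega>. dist x (f \<omega>)) \<in> borel_measurable N"
  shows "f \<in> borel_measurable N"
proof (rule borel_measurableI)
  fix U :: "'m set" assume U: "open U"
  obtain d :: "nat \<Rightarrow> 'm" where d: "\<And>x e. e > 0 \<Longrightarrow> \<exists>n. dist (d n) x < e"
    by (rule dense_sequence) blast
  define I where "I = {(n, k::nat). ball (d n) (1 / Suc k) \<subseteq> U}"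
  have "x \<in> (\<Union>(n, k)\<in>I. ball (d n) (1 / Suc k))" if xU: "x \<in> U" for x
  proof -
    obtain e where e: "e > 0" "ball x e \<subseteq> U" using openE[OF U xU] .
    obtain k where k: "1 / real (Suc k) < e / 2"
      using reals_Archimedean[of "e / 2"] e(1) by (auto simp: inverse_eq_divide)
    obtain n where n: "dist (d n) x < 1 / Suc k" using d[of "1 / Suc k" x] by auto
    have "ball (d n) (1 / Suc k) \<subseteq> ball x e"
    proof
      fix y assume "y \<in> ball (d n) (1 / Suc k)"
      then show "y \<in> ball x e"
        using k n dist_triangle[of x y "d n"] by (simp add: dist_commute)
    qed
    then show ?thesis using n e(2) by (auto simp: I_def intro!: bexI[of _ "(n, k)"])
  qed
  then have "f -` U \<inter> space N = (\<Union>(n, k)\<in>I. {\<omega> \<in> space N. dist (d n) (f \<omega>) < 1 / Suc k})"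
    by (auto simp: I_def Bex_def)
  moreover have "(\<Union>(n, k)\<in>I. {\<omega> \<in> space N. dist (d n) (f \<omega>) < 1 / Suc k}) \<in> sets N"
    using assms by (intro sets.countable_UN') (auto intro: borel_measurable_less)
  ultimately show "f -` U \<inter> space N \<in> sets N" by simp
qed

lemma autM_D:
  assumes "g \<in> autM M"
  shows "bij g" "dist (g x) (g y) = dist x y"
    "length xs = fun_ar M f \<Longrightarrow> g (fun_int M f xs) = fun_int M f (map g xs)"
    "length ys = pred_ar M p \<Longrightarrow> pred_int M p (map g ys) = pred_int M p ys"
  using assms by (auto simp: autM_def)

lemma autM_id: "(\<lambda>x. x) \<in> autM M"
  by (auto simp: autM_def bij_def)

lemma autM_inv:
  assumes "g \<in> autM M"
  shows "g (inv g x) = x" "inv g (g x) = x" "dist x (inv g y) = dist (g x) y"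
proof -
  show 1: "g (inv g x) = x" for x using autM_D(1)[OF assms] by (simp add: bij_is_surj surj_f_inv_f)
  show "inv g (g x) = x" using autM_D(1)[OF assms] by (simp add: bij_is_inj)
  show "dist x (inv g y) = dist (g x) y" using autM_D(2)[OF assms, of x "inv g y"] 1 by simp
qed

lemma L0G_D:
  assumes "g \<in> L0G M"
  shows "\<omega> \<in> {0..1} \<Longrightarrow> g \<omega> \<in> autM M" "(\<lambda>\<omega>. g \<omega> x) \<in> borel_measurable \<Omega>"
  using assms measurable_product_then_coordinatewise[of g \<Omega> x] by (auto simp: L0G_def)

text \<open>Isometry turns the distance from \<open>x\<close> to
  \<open>inv (g \<omega>) (r \<omega>)\<close> into \<open>dist (g \<omega> x) (r \<omega>)\<close>,
  where \<open>g \<omega>\<close> is evaluated at a fixed point. So coordinatewise measurability of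
  \<open>g\<close> reaches evaluation at a moving point.\<close>

lemma L0G_inv_apply_measurable:
  fixes g :: "real \<Rightarrow> 'm::polish_space \<Rightarrow> 'm"
  assumes "g \<in> L0G M" "r \<in> borel_measurable \<Omega>"
  shows "(\<lambda>\<omega>. inv (g \<omega>) (r \<omega>)) \<in> borel_measurable \<Omega>"
proof (rule borel_measurable_if_dist)
  fix x
  have "(\<lambda>\<omega>. dist (g \<omega> x) (r \<omega>)) \<in> borel_measurable \<Omega>"
    by (intro borel_measurable_dist L0G_D[OF assms(1)] assms)
  then show "(\<lambda>\<omega>. dist x (inv (g \<omega>) (r \<omega>))) \<in> borel_measurable \<Omega>"
    by (rule measurable_cong[THEN iffD1, rotated]) (simp add: autM_inv(3)[OF L0G_D(1)[OF assms(1)]])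
qed

text \<open>The distance from \<open>x\<close> to \<open>g \<omega> (r \<omega>)\<close> is that
  from \<open>r \<omega>\<close> to \<open>inv (g \<omega>) x\<close>, which is measurable by the
  case of inverses at the constant \<open>x\<close>; hence inverses come first.\<close>

lemma L0G_apply_measurable:
  fixes g :: "real \<Rightarrow> 'm::polish_space \<Rightarrow> 'm"
  assumes "g \<in> L0G M" "r \<in> borel_measurable \<Omega>"
  shows "(\<lambda>\<omega>. g \<omega> (r \<omega>)) \<in> borel_measurable \<Omega>"
proof (rule borel_measurable_if_dist)
  fix x
  have "(\<lambda>\<omega>. dist (r \<omega>) (inv (g \<omega>) x)) \<in> borel_measurable \<Omega>"
    by (intro borel_measurable_dist L0G_inv_apply_measurable[OF assms(1)] assms) simp
  then show "(\<lambda>\<omega>. dist x (g \<omega> (r \<omega>))) \<in> borel_measurable \<Omega>"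
    by (rule measurable_cong[THEN iffD1, rotated])
      (simp add: autM_inv(3)[OF L0G_D(1)[OF assms(1)]] dist_commute)
qed

section \<open>The automorphism group inside a countable product, and a compatible metric on
  it\<close>

lemma autM_eq_if_eq_on_dense:
  assumes "g \<in> autM M" "h \<in> autM M" "\<And>x e. e > 0 \<Longrightarrow> \<exists>n. dist (d n) x < e"
    and "\<And>n. g (d n) = h (d n)"
  shows "g = h"
proof
  fix x
  have "dist (g x) (h x) \<le> e" if e: "e > 0" for e
  proof -
    obtain n where n: "dist (d n) x < e / 2" using assms(3)[of "e/2" x] e by auto
    have "dist (g x) (h x) \<le> dist (g (d n)) (g x) + dist (h (d n)) (h x)"
      using dist_triangle2[of "g x" "h x" "g (d n)"] assms(4)[of n] by (simp add: dist_commute)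
    then show ?thesis
      using n autM_D(2)[OF assms(1)] autM_D(2)[OF assms(2)] by simp
  qed
  then show "g x = h x" by (metis dist_le_zero_iff field_le_epsilon add_0)
qed

text \<open>The product metric is available for countable index types, hence the restriction to the
  sequence \<open>d\<close>. For dense \<open>d\<close> the restriction is injective on
  automorphisms.\<close>

definition aut_dist :: "(nat \<Rightarrow> 'm::metric_space) \<Rightarrow> ('m \<Rightarrow> 'm) \<Rightarrow> ('m \<Rightarrow> 'm) \<Rightarrow> real" where
  "aut_dist d f h = dist (\<lambda>n. f (d n)) (\<lambda>n. h (d n))"

lemma Metric_space_aut_dist:
  assumes "\<And>x e. e > 0 \<Longrightarrow> \<exists>n. dist (d n) x < e"
  shows "Metric_space (autM M) (aut_dist d)"
proof
  show "aut_dist d f h = 0 \<longleftrightarrow> f = h" if "f \<in> autM M" "h \<in> autM M" for f h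
    using autM_eq_if_eq_on_dense[OF that assms] by (auto simp: aut_dist_def fun_eq_iff)
qed (auto simp: aut_dist_def dist_commute dist_triangle)

lemma continuous_restrict_sequence: "continuous_on UNIV (\<lambda>(f::'m \<Rightarrow> 'm::topological_space) (n::nat). f (d n))"
  by (intro continuous_on_coordinatewise_then_product continuous_on_product_coordinates)

text \<open>Automorphisms are isometries, hence equicontinuous: if \<open>d n\<close> is within e/3
  of \<open>x\<close>, closeness of two automorphisms at \<open>d n\<close> forces closeness at
  \<open>x\<close>. So control on the sequence gives control at all points.\<close>

lemma continuous_map_aut_dist_eval:
  fixes d :: "nat \<Rightarrow> 'm::metric_space"
  assumes d: "\<And>x e. e > 0 \<Longrightarrow> \<exists>n. dist (d n) x < e"
  shows "continuous_map (Metric_space.mtopology (autM M) (aut_dist d)) euclidean (\<lambda>f. f x)"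
proof -
  interpret A: Metric_space "autM M" "aut_dist d" by (rule Metric_space_aut_dist[OF d])
  have "\<exists>r>0. \<forall>h. h \<in> autM M \<and> aut_dist d f h < r \<longrightarrow> dist (f x) (h x) < e"
    if f: "f \<in> autM M" and e: "e > 0" for f e
  proof -
    obtain n where n: "dist (d n) x < e / 3" using d[of "e/3" x] e by auto
    have "open {v. dist (f (d n)) (v n) < e / 3}"
      by (intro open_Collect_less continuous_intros continuous_on_product_coordinates)
    moreover have "(\<lambda>n. f (d n)) \<in> {v. dist (f (d n)) (v n) < e / 3}" using e by simp
    ultimately obtain r where r: "r > 0" "ball (\<lambda>n. f (d n)) r \<subseteq> {v. dist (f (d n)) (v n) < e / 3}"
      by (rule openE)
    have "dist (f x) (h x) < e" if h: "h \<in> autM M" "aut_dist d f h < r" for h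
    proof -
      have "dist (f (d n)) (h (d n)) < e / 3" using r(2) h(2) by (auto simp: aut_dist_def)
      moreover have "dist (f x) (h x) \<le> dist (f (d n)) (f x) + dist (f (d n)) (h (d n)) + dist (h (d n)) (h x)"
        by (smt (verit) dist_commute dist_triangle2)
      ultimately show ?thesis using n autM_D(2)[OF f] autM_D(2)[OF h(1)] by simp
    qed
    then show ?thesis using r(1) by blast
  qed
  then have "\<forall>f\<in>autM M. \<forall>e>0. \<exists>r>0. \<forall>h. h \<in> autM M \<and> aut_dist d f h < r \<longrightarrow> dist (f x) (h x) < e"
    by blast
  then show ?thesis
    using A.metric_continuous_map[of UNIV dist "\<lambda>f. f x"] Met_TC.Metric_space_axioms by simp
qed

text \<open>\<open>V\<close> is the union of the balls that exhaust \<open>U\<close>, taken in the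
  whole countable product instead of in the group. It serves both the comparison of topologies and
  the measurability criterion \<open>L0G_I\<close>.\<close>

lemma openin_aut_dist_preimage:
  assumes d: "\<And>x e. e > 0 \<Longrightarrow> \<exists>n. dist (d n) x < e"
    and U: "openin (Metric_space.mtopology (autM M) (aut_dist d)) U"
  obtains V where "open V" "U = {f \<in> autM M. (\<lambda>n. f (d n)) \<in> V}"
proof -
  interpret A: Metric_space "autM M" "aut_dist d" by (rule Metric_space_aut_dist[OF d])
  define V where "V = (\<Union>(h, r)\<in>{(h, r). h \<in> autM M \<and> A.mball h r \<subseteq> U}. ball (\<lambda>n. h (d n)) r)"
  have "open V" unfolding V_def by (intro open_UN) auto
  moreover have "U = {f \<in> autM M. (\<lambda>n. f (d n)) \<in> V}"
  proof (intro set_eqI iffI)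
    fix f assume f: "f \<in> U"
    have fM: "f \<in> autM M" using U f by (auto simp: A.openin_mtopology)
    obtain r where "r > 0" "A.mball f r \<subseteq> U" using U f by (auto simp: A.openin_mtopology)
    then show "f \<in> {f \<in> autM M. (\<lambda>n. f (d n)) \<in> V}"
      using fM by (auto simp: V_def intro!: exI[of _ f] exI[of _ r])
  next
    fix f assume "f \<in> {f \<in> autM M. (\<lambda>n. f (d n)) \<in> V}"
    then obtain h r where "f \<in> autM M" "h \<in> autM M" "A.mball h r \<subseteq> U" "aut_dist d h f < r"
      by (auto simp: V_def aut_dist_def)
    then show "f \<in> U" by (auto simp: subset_iff)
  qed
  ultimately show ?thesis by (rule that)
qed

lemma compatible_metric_aut_dist:
  fixes d :: "nat \<Rightarrow> 'm::metric_space"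
  assumes d: "\<And>x e. e > 0 \<Longrightarrow> \<exists>n. dist (d n) x < e"
  shows "compatible_metric (autM M) (aut_dist d)"
  unfolding compatible_metric_def
proof
  show "Metric_space (autM M) (aut_dist d)" by (rule Metric_space_aut_dist[OF d])
  then interpret A: Metric_space "autM M" "aut_dist d" .
  show "A.mtopology = subtopology euclidean (autM M)"
    unfolding topology_eq
  proof (intro allI iffI)
    fix U assume "openin A.mtopology U"
    from openin_aut_dist_preimage[OF d this]
    obtain V where V: "open V" "U = {f \<in> autM M. (\<lambda>n. f (d n)) \<in> V}" by blast
    have "open ((\<lambda>f n. f (d n)) -` V)"
      by (rule open_vimage[OF V(1) continuous_restrict_sequence])
    then show "openin (subtopology euclidean (autM M)) U"
      unfolding openin_subtopology V(2) by (auto intro!: exI[of _ "(\<lambda>f n. f (d n)) -` V"])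
  next
    fix U assume "openin (subtopology euclidean (autM M)) U"
    then obtain W where W: "open W" "U = W \<inter> autM M" by (auto simp: openin_subtopology)
    \<comment> \<open>The product topology is initial for the evaluations at all points of
      \<open>'m\<close>, and each of them is continuous for \<open>aut_dist\<close>.\<close>
    have "continuous_map A.mtopology euclidean (\<lambda>f. f)"
      unfolding euclidean_product_topology[symmetric] continuous_map_componentwise_UNIV
      using continuous_map_aut_dist_eval[OF d] by blast
    from openin_continuous_map_preimage[OF this, of W] W(1)
    have "openin A.mtopology {f \<in> autM M. f \<in> W}" by simp
    then show "openin A.mtopology U" by (simp add: W(2) Int_def conj_commute)
  qed
qed

text \<open>In a product with uncountable index, coordinatewise measurability does not in general
  give Borel measurability. Here each relatively open subset of \<open>autM M\<close> is the trace
  of an open set of the countable product, where the coordinates suffice.\<close>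

lemma L0G_I:
  fixes d :: "nat \<Rightarrow> 'm::polish_space"
  assumes d: "\<And>x e. e > 0 \<Longrightarrow> \<exists>n. dist (d n) x < e"
    and meas: "\<And>n. (\<lambda>\<omega>. g \<omega> (d n)) \<in> borel_measurable \<Omega>"
    and aut: "\<And>\<omega>. \<omega> \<in> {0..1} \<Longrightarrow> g \<omega> \<in> autM M"
  shows "g \<in> L0G M"
  unfolding L0G_def
proof (intro CollectI conjI borel_measurableI)
  fix U :: "('m \<Rightarrow> 'm) set" assume "open U"
  then have "openin (subtopology euclidean (autM M)) (U \<inter> autM M)"
    by (auto simp: openin_subtopology)
  then have "openin (Metric_space.mtopology (autM M) (aut_dist d)) (U \<inter> autM M)"
    using compatible_metric_aut_dist[OF d, of M] by (simp add: compatible_metric_def)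
  from openin_aut_dist_preimage[OF d this]
  obtain V where V: "open V" "U \<inter> autM M = {f \<in> autM M. (\<lambda>n. f (d n)) \<in> V}" by blast
  have "(\<lambda>\<omega> n. g \<omega> (d n)) \<in> borel_measurable \<Omega>"
    by (rule measurable_coordinatewise_then_product) (rule meas)
  then have "(\<lambda>\<omega> n. g \<omega> (d n)) -` V \<inter> space \<Omega> \<in> sets \<Omega>"
    by (rule measurable_sets) (use V(1) in simp)
  also have "(\<lambda>\<omega> n. g \<omega> (d n)) -` V \<inter> space \<Omega> = g -` U \<inter> space \<Omega>"
    using V(2) aut by auto
  finally show "g -` U \<inter> space \<Omega> \<in> sets \<Omega>" .
qed (use aut in simp)

subsection \<open>Formulas\<close>

text \<open>Uniform continuity for the product uniformity on assignments: the value is controlled by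
  finitely many variables. Unlike measurability, this passes to suprema and infima over an
  uncountable universe, and it implies measurability in the end.\<close>

definition finitary_ucont :: "((nat \<Rightarrow> 'a::metric_space) \<Rightarrow> 'b::metric_space) \<Rightarrow> bool" where
  "finitary_ucont f \<longleftrightarrow> (\<forall>e>0. \<exists>d>0. \<exists>N. \<forall>\<rho> \<rho>'. (\<forall>i<N. dist (\<rho> i) (\<rho>' i) < d) \<longrightarrow> dist (f \<rho>) (f \<rho>') < e)"

lemma finitary_ucont_list:
  fixes fs :: "((nat \<Rightarrow> 'a::metric_space) \<Rightarrow> 'b::metric_space) list"
  assumes "\<forall>f\<in>set fs. finitary_ucont f" and "e > 0"
  shows "\<exists>d>0. \<exists>N. \<forall>\<rho> \<rho>'. (\<forall>i<N. dist (\<rho> i) (\<rho>' i) < d) \<longrightarrow> (\<forall>f\<in>set fs. dist (f \<rho>) (f \<rho>') < e)"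
  using assms(1)
proof (induction fs)
  case Nil
  then show ?case by (auto intro: exI[of _ 1])
next
  case (Cons f fs)
  obtain d1 N1 where 1: "d1 > 0" "\<And>\<rho> \<rho>'. (\<forall>i<N1. dist (\<rho> i) (\<rho>' i) < d1) \<Longrightarrow> \<forall>f\<in>set fs. dist (f \<rho>) (f \<rho>') < e"
    using Cons by auto
  obtain d2 N2 where 2: "d2 > 0" "\<And>\<rho> \<rho>'. (\<forall>i<N2. dist (\<rho> i) (\<rho>' i) < d2) \<Longrightarrow> dist (f \<rho>) (f \<rho>') < e"
    using Cons.prems assms(2) unfolding finitary_ucont_def by (metis list.set_intros(1))
  show ?case
  proof (intro exI[of _ "min d1 d2"] conjI exI[of _ "max N1 N2"] allI impI ballI)
    fix \<rho> \<rho>' :: "nat \<Rightarrow> 'a" and h assume *: "\<forall>i<max N1 N2. dist (\<rho> i) (\<rho>' i) < min d1 d2" "h \<in> set (f # fs)"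
    then show "dist (h \<rho>) (h \<rho>') < e" using 1(2)[of \<rho> \<rho>'] 2(2)[of \<rho> \<rho>'] by auto
  qed (use 1 2 in auto)
qed

text \<open>The set \<open>S\<close> is there for connectives, whose modulus of continuity holds
  only between lists with entries in the unit interval; function and predicate symbols use
  \<open>UNIV\<close>.\<close>

lemma finitary_ucont_compose_list:
  fixes fs :: "((nat \<Rightarrow> 'a::metric_space) \<Rightarrow> 'b::metric_space) list" and h :: "'b list \<Rightarrow> 'c::metric_space"
  assumes fs: "\<forall>f\<in>set fs. finitary_ucont f"
    and h: "\<And>e. e > 0 \<Longrightarrow> \<exists>d>0. \<forall>xs ys. xs \<in> S \<and> ys \<in> S \<and> length xs = length fs \<and> length ys = length fs \<and>
        (\<forall>i<length fs. dist (xs ! i) (ys ! i) < d) \<longrightarrow> dist (h xs) (h ys) < e"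
    and S: "\<And>\<rho>. map (\<lambda>f. f \<rho>) fs \<in> S"
  shows "finitary_ucont (\<lambda>\<rho>. h (map (\<lambda>f. f \<rho>) fs))"
  unfolding finitary_ucont_def
proof (intro allI impI)
  fix e :: real assume "e > 0"
  then obtain d where d: "d > 0" "\<And>xs ys. \<lbrakk>xs \<in> S; ys \<in> S; length xs = length fs; length ys = length fs;
      \<forall>i<length fs. dist (xs ! i) (ys ! i) < d\<rbrakk> \<Longrightarrow> dist (h xs) (h ys) < e"
    using h[of e] by blast
  obtain d' N where d': "d' > 0" "\<And>\<rho> \<rho>'. (\<forall>i<N. dist (\<rho> i) (\<rho>' i) < d') \<Longrightarrow> \<forall>f\<in>set fs. dist (f \<rho>) (f \<rho>') < d"
    using finitary_ucont_list[OF fs d(1)] by blast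
  show "\<exists>d>0. \<exists>N. \<forall>\<rho> \<rho>'. (\<forall>i<N. dist (\<rho> i) (\<rho>' i) < d) \<longrightarrow>
      dist (h (map (\<lambda>f. f \<rho>) fs)) (h (map (\<lambda>f. f \<rho>') fs)) < e"
  proof (intro exI[of _ d'] conjI exI[of _ N] allI impI)
    fix \<rho> \<rho>' :: "nat \<Rightarrow> 'a" assume "\<forall>i<N. dist (\<rho> i) (\<rho>' i) < d'"
    from d'(2)[OF this] show "dist (h (map (\<lambda>f. f \<rho>) fs)) (h (map (\<lambda>f. f \<rho>') fs)) < e"
      by (intro d(2) S) auto
  qed (rule d')
qed

lemma finitary_ucont_continuous:
  fixes f :: "(nat \<Rightarrow> 'a::metric_space) \<Rightarrow> 'b::metric_space"
  assumes "finitary_ucont f"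
  shows "continuous_on UNIV f"
proof -
  have "(f \<longlongrightarrow> f \<rho>) (at \<rho>)" for \<rho>
  proof (rule tendstoI)
    fix e :: real assume "e > 0"
    then obtain d N where d: "d > 0" "\<And>\<rho>'. (\<forall>i<N. dist (\<rho>' i) (\<rho> i) < d) \<Longrightarrow> dist (f \<rho>') (f \<rho>) < e"
      using assms unfolding finitary_ucont_def by meson
    have "\<forall>\<^sub>F \<rho>' in at \<rho>. dist (\<rho>' i) (\<rho> i) < d" for i
    proof (rule tendstoD[OF _ d(1)])
      have "continuous_on UNIV (\<lambda>\<rho>' :: nat \<Rightarrow> 'a. \<rho>' i)" by (rule continuous_on_product_coordinates)
      then show "((\<lambda>\<rho>'. \<rho>' i) \<longlongrightarrow> \<rho> i) (at \<rho>)" by (simp add: continuous_on_def)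
    qed
    then have "\<forall>\<^sub>F \<rho>' in at \<rho>. \<forall>i\<in>{..<N}. dist (\<rho>' i) (\<rho> i) < d"
      by (intro eventually_ball_finite) auto
    then show "\<forall>\<^sub>F \<rho>' in at \<rho>. dist (f \<rho>') (f \<rho>) < e"
      by eventually_elim (use d(2) in auto)
  qed
  then show ?thesis by (simp add: continuous_on_def)
qed

lemma finitary_ucont_measurable:
  fixes f :: "(nat \<Rightarrow> 'a::{metric_space, second_countable_topology}) \<Rightarrow> 'b::metric_space"
  assumes "finitary_ucont f" "\<And>i. r i \<in> borel_measurable N"
  shows "(\<lambda>\<omega>. f (\<lambda>i. r i \<omega>)) \<in> borel_measurable N"
proof -
  have "(\<lambda>\<omega> i. r i \<omega>) \<in> borel_measurable N"
    by (rule measurable_coordinatewise_then_product) (rule assms(2))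
  then show ?thesis
    by (rule measurable_compose)
      (rule borel_measurable_continuous_onI[OF finitary_ucont_continuous[OF assms(1)]])
qed

lemma finitary_ucont_dist:
  fixes f :: "(nat \<Rightarrow> 'a::metric_space) \<Rightarrow> 'b::metric_space"
  assumes "finitary_ucont f" "finitary_ucont h"
  shows "finitary_ucont (\<lambda>\<rho>. dist (f \<rho>) (h \<rho>))"
proof -
  have "finitary_ucont (\<lambda>\<rho>. (\<lambda>xs. dist (xs ! 0) (xs ! 1)) (map (\<lambda>f. f \<rho>) [f, h]))"
  proof (rule finitary_ucont_compose_list[where S = UNIV])
    fix e :: real assume e: "e > 0"
    show "\<exists>d>0. \<forall>xs ys :: 'b list. xs \<in> UNIV \<and> ys \<in> UNIV \<and> length xs = length [f, h] \<and> length ys = length [f, h] \<and>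
      (\<forall>i<length [f, h]. dist (xs ! i) (ys ! i) < d) \<longrightarrow>
        dist (dist (xs ! 0) (xs ! 1)) (dist (ys ! 0) (ys ! 1)) < e"
    proof (intro exI[of _ "e / 2"] conjI allI impI)
      fix xs ys :: "'b list"
      assume "xs \<in> UNIV \<and> ys \<in> UNIV \<and> length xs = length [f, h] \<and> length ys = length [f, h] \<and>
        (\<forall>i<length [f, h]. dist (xs ! i) (ys ! i) < e / 2)"
      then have "dist (xs ! 0) (ys ! 0) < e / 2" "dist (xs ! 1) (ys ! 1) < e / 2" by auto
      moreover have "\<bar>dist (xs ! 0) (xs ! 1) - dist (ys ! 0) (ys ! 1)\<bar> \<le> dist (xs ! 0) (ys ! 0) + dist (xs ! 1) (ys ! 1)"
        by (smt (verit) dist_commute dist_triangle)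
      ultimately show "dist (dist (xs ! 0) (xs ! 1)) (dist (ys ! 0) (ys ! 1)) < e"
        by (simp add: dist_real_def)
    qed (use e in simp)
  qed (use assms in auto)
  then show ?thesis by simp
qed

lemma teval_finitary_ucont:
  assumes "metric_structure M" "wf_trm M t"
  shows "finitary_ucont (\<lambda>\<rho>. teval M \<rho> t)"
  using assms(2)
proof (induction t)
  case (Var n)
  show ?case unfolding finitary_ucont_def
  proof (intro allI impI)
    fix e :: real assume "e > 0"
    then show "\<exists>d>0. \<exists>N. \<forall>\<rho> \<rho>'. (\<forall>i<N. dist (\<rho> i) (\<rho>' i) < d) \<longrightarrow> dist (teval M \<rho> (Var n)) (teval M \<rho>' (Var n)) < e"
      by (intro exI[of _ e] conjI exI[of _ "Suc n"]) auto
  qed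
next
  case (Fn f ts)
  have "finitary_ucont (\<lambda>\<rho>. fun_int M f (map (\<lambda>h. h \<rho>) (map (\<lambda>t \<rho>. teval M \<rho> t) ts)))"
    by (rule finitary_ucont_compose_list[where S = UNIV])
      (use Fn assms(1) in \<open>auto simp: metric_structure_def ucont_list_def\<close>)
  then show ?case by (simp add: comp_def)
qed

lemma feval_bounds:
  assumes "metric_structure M" "wf_fml M \<phi>"
  shows "feval M \<rho> \<phi> \<in> {0..1}"
  using assms(2)
proof (induction \<phi> arbitrary: \<rho>)
  case (Atom p ts)
  have "length (map (teval M \<rho>) ts) = pred_ar M p" using Atom by simp
  then show ?case using assms(1) unfolding metric_structure_def feval.simps by blast
next
  case (Dst t u)
  then show ?case using assms(1) by (auto simp: metric_structure_def)
next
  case (Conn c fs)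
  have "set (map (feval M \<rho>) fs) \<subseteq> {0..1}" using Conn by auto
  moreover have "length (map (feval M \<rho>) fs) = length fs" by simp
  ultimately show ?case using Conn.prems unfolding conn_ok_def feval.simps wf_fml.simps by blast
next
  case (Sup x \<phi>)
  have b: "feval M (\<rho>(x := a)) \<phi> \<in> {0..1}" for a using Sup by auto
  have "bdd_above (range (\<lambda>a. feval M (\<rho>(x := a)) \<phi>))" using b by (auto intro!: bdd_aboveI[of _ 1])
  then have "0 \<le> (SUP a. feval M (\<rho>(x := a)) \<phi>)"
    by (rule cSUP_upper2[OF _ UNIV_I]) (use b in auto)
  moreover have "(SUP a. feval M (\<rho>(x := a)) \<phi>) \<le> 1" using b by (intro cSUP_least) auto
  ultimately show ?case by simp
next
  case (Inf x \<phi>)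
  have b: "feval M (\<rho>(x := a)) \<phi> \<in> {0..1}" for a using Inf by auto
  have "bdd_below (range (\<lambda>a. feval M (\<rho>(x := a)) \<phi>))" using b by (auto intro!: bdd_belowI[of _ 0])
  then have "(INF a. feval M (\<rho>(x := a)) \<phi>) \<le> 1"
    by (rule cINF_lower2[OF _ UNIV_I]) (use b in auto)
  moreover have "0 \<le> (INF a. feval M (\<rho>(x := a)) \<phi>)" using b by (intro cINF_greatest) auto
  ultimately show ?case by simp
qed

lemma abs_SUP_diff_le:
  fixes f h :: "'a \<Rightarrow> real"
  assumes "\<And>a. f a \<in> {0..1}" "\<And>a. h a \<in> {0..1}" "\<And>a. \<bar>f a - h a\<bar> \<le> e"
  shows "\<bar>(SUP a. f a) - (SUP a. h a)\<bar> \<le> e"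
proof -
  have *: "(SUP a. u a) \<le> (SUP a. v a) + e"
    if "\<And>a. v a \<in> {0..1}" "\<And>a. \<bar>u a - v a\<bar> \<le> e" for u v :: "'a \<Rightarrow> real"
  proof (rule cSUP_least)
    fix a
    have "bdd_above (range v)" using that(1) by (auto intro!: bdd_aboveI[of _ 1])
    from cSUP_upper[OF UNIV_I this, of a] that(2)[of a] show "u a \<le> (SUP a. v a) + e" by linarith
  qed simp
  show ?thesis using *[of h f] *[of f h] assms by (auto simp: abs_minus_commute abs_le_iff)
qed

lemma abs_INF_diff_le:
  fixes f h :: "'a \<Rightarrow> real"
  assumes "\<And>a. f a \<in> {0..1}" "\<And>a. h a \<in> {0..1}" "\<And>a. \<bar>f a - h a\<bar> \<le> e"
  shows "\<bar>(INF a. f a) - (INF a. h a)\<bar> \<le> e"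
proof -
  have *: "(INF a. v a) - e \<le> (INF a. u a)"
    if "\<And>a. v a \<in> {0..1}" "\<And>a. \<bar>u a - v a\<bar> \<le> e" for u v :: "'a \<Rightarrow> real"
  proof (rule cINF_greatest)
    fix a
    have "bdd_below (range v)" using that(1) by (auto intro!: bdd_belowI[of _ 0])
    from cINF_lower[OF this UNIV_I, of a] that(2)[of a] show "(INF a. v a) - e \<le> u a" by linarith
  qed simp
  show ?thesis using *[of h f] *[of f h] assms by (auto simp: abs_minus_commute abs_le_iff)
qed

text \<open>Giving the variable \<open>x\<close> the same value in both assignments increases no
  coordinate distance, so the modulus of \<open>f\<close> works uniformly in that value. It is taken
  for e/2 because a supremum or infimum turns strict bounds into weak ones.\<close>

lemma finitary_ucont_quantifier:
  fixes f :: "(nat \<Rightarrow> 'a::metric_space) \<Rightarrow> real"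
  assumes f: "finitary_ucont f"
    and Q: "\<And>\<rho> \<rho>' e. (\<And>a. \<bar>f (\<rho>(x := a)) - f (\<rho>'(x := a))\<bar> \<le> e) \<Longrightarrow> \<bar>Q \<rho> - Q \<rho>'\<bar> \<le> e"
  shows "finitary_ucont Q"
  unfolding finitary_ucont_def
proof (intro allI impI)
  fix e :: real assume e: "e > 0"
  then obtain d N where d: "d > 0" "\<And>\<rho> \<rho>'. (\<forall>i<N. dist (\<rho> i) (\<rho>' i) < d) \<Longrightarrow> dist (f \<rho>) (f \<rho>') < e / 2"
    using f unfolding finitary_ucont_def by (meson half_gt_zero)
  show "\<exists>d>0. \<exists>N. \<forall>\<rho> \<rho>'. (\<forall>i<N. dist (\<rho> i) (\<rho>' i) < d) \<longrightarrow> dist (Q \<rho>) (Q \<rho>') < e"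
  proof (intro exI[of _ d] conjI exI[of _ N] allI impI)
    fix \<rho> \<rho>' :: "nat \<Rightarrow> 'a" assume *: "\<forall>i<N. dist (\<rho> i) (\<rho>' i) < d"
    have "\<bar>Q \<rho> - Q \<rho>'\<bar> \<le> e / 2"
    proof (rule Q)
      fix a
      show "\<bar>f (\<rho>(x := a)) - f (\<rho>'(x := a))\<bar> \<le> e / 2"
      proof -
        have "\<forall>i<N. dist ((\<rho>(x := a)) i) ((\<rho>'(x := a)) i) < d" using * d(1) by simp
        from d(2)[of "\<rho>(x := a)" "\<rho>'(x := a)", OF this] show ?thesis by (simp only: dist_real_def less_imp_le)
      qed
    qed
    then show "dist (Q \<rho>) (Q \<rho>') < e" using e by (simp add: dist_real_def)
  qed (rule d)
qed

lemma feval_finitary_ucont: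
  assumes "metric_structure M" "wf_fml M \<phi>"
  shows "finitary_ucont (\<lambda>\<rho>. feval M \<rho> \<phi>)"
  using assms(2)
proof (induction \<phi>)
  case (Atom p ts)
  have "finitary_ucont (\<lambda>\<rho>. pred_int M p (map (\<lambda>h. h \<rho>) (map (\<lambda>t \<rho>. teval M \<rho> t) ts)))"
    by (rule finitary_ucont_compose_list[where S = UNIV])
      (use Atom assms(1) in \<open>auto simp: metric_structure_def ucont_list_def intro: teval_finitary_ucont\<close>)
  then show ?case by (simp add: comp_def)
next
  case (Dst t u)
  then show ?case using assms(1) by (auto intro!: finitary_ucont_dist teval_finitary_ucont)
next
  case (Conn c fs)
  have "finitary_ucont (\<lambda>\<rho>. c (map (\<lambda>h. h \<rho>) (map (\<lambda>f \<rho>. feval M \<rho> f) fs)))"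
  proof (rule finitary_ucont_compose_list[where S = "{xs. set xs \<subseteq> {0..1}}"])
    fix e :: real assume "e > 0"
    then show "\<exists>d>0. \<forall>xs ys. xs \<in> {xs. set xs \<subseteq> {0..1}} \<and> ys \<in> {xs. set xs \<subseteq> {0..1}} \<and>
        length xs = length (map (\<lambda>f \<rho>. feval M \<rho> f) fs) \<and> length ys = length (map (\<lambda>f \<rho>. feval M \<rho> f) fs) \<and>
        (\<forall>i<length (map (\<lambda>f \<rho>. feval M \<rho> f) fs). dist (xs ! i) (ys ! i) < d) \<longrightarrow> dist (c xs) (c ys) < e"
      using Conn.prems unfolding wf_fml.simps conn_ok_def dist_real_def length_map mem_Collect_eq by metis
  next
    show "map (\<lambda>h. h \<rho>) (map (\<lambda>f \<rho>. feval M \<rho> f) fs) \<in> {xs. set xs \<subseteq> {0..1}}" for \<rho>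
      using feval_bounds[OF assms(1)] Conn.prems by auto
  qed (use Conn in auto)
  then show ?case by (simp add: comp_def)
next
  case (Sup x \<phi>)
  have b: "feval M \<rho> \<phi> \<in> {0..1}" for \<rho> using feval_bounds[OF assms(1)] Sup.prems by simp
  show ?case unfolding feval.simps
    by (rule finitary_ucont_quantifier[where x = x and f = "\<lambda>\<rho>. feval M \<rho> \<phi>"])
      (use Sup in simp, rule abs_SUP_diff_le[OF b b])
next
  case (Inf x \<phi>)
  have b: "feval M \<rho> \<phi> \<in> {0..1}" for \<rho> using feval_bounds[OF assms(1)] Inf.prems by simp
  show ?case unfolding feval.simps
    by (rule finitary_ucont_quantifier[where x = x and f = "\<lambda>\<rho>. feval M \<rho> \<phi>"])
      (use Inf in simp, rule abs_INF_diff_le[OF b b])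
qed

lemma feval_L0A:
  fixes M :: "('f, 'p, 'm::polish_space) mstruct"
  assumes "metric_structure M" "wf_fml M \<phi>" "\<And>i. r i \<in> borel_measurable \<Omega>"
  shows "(\<lambda>\<omega>. feval M (\<lambda>i. r i \<omega>) \<phi>) \<in> L0A"
  unfolding L0A_def
  using finitary_ucont_measurable[OF feval_finitary_ucont[OF assms(1,2)], where r = r and N = \<Omega>, OF assms(3)]
    feval_bounds[OF assms(1,2)] by simp

lemma conn_L0A:
  assumes "conn_ok (length Rs) c" "set Rs \<subseteq> L0A"
  shows "(\<lambda>\<omega>. c (map (\<lambda>R. R \<omega>) Rs)) \<in> L0A"
proof -
  define n where "n = length Rs"
  \<comment> \<open>A connective is controlled on the unit interval only. Clipping the coordinates
    makes the composite uniformly continuous on all real sequences and changes nothing at values of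
    members of \<open>L0A\<close>.\<close>
  define pr where "pr i \<rho> = max 0 (min 1 (\<rho> i))" for i and \<rho> :: "nat \<Rightarrow> real"
  have pr: "finitary_ucont (pr i)" for i
    unfolding finitary_ucont_def
  proof (intro allI impI)
    fix e :: real assume "e > 0"
    then show "\<exists>d>0. \<exists>N. \<forall>\<rho> \<rho>'. (\<forall>i<N. dist (\<rho> i) (\<rho>' i) < d) \<longrightarrow> dist (pr i \<rho>) (pr i \<rho>') < e"
      by (intro exI[of _ e] conjI exI[of _ "Suc i"]) (auto simp: pr_def dist_real_def)
  qed
  have "finitary_ucont (\<lambda>\<rho>. c (map (\<lambda>h. h \<rho>) (map pr [0..<n])))"
  proof (rule finitary_ucont_compose_list[where S = "{xs. set xs \<subseteq> {0..1}}"])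
    fix e :: real assume "e > 0"
    then show "\<exists>d>0. \<forall>xs ys. xs \<in> {xs. set xs \<subseteq> {0..1}} \<and> ys \<in> {xs. set xs \<subseteq> {0..1}} \<and>
        length xs = length (map pr [0..<n]) \<and> length ys = length (map pr [0..<n]) \<and>
        (\<forall>i<length (map pr [0..<n]). dist (xs ! i) (ys ! i) < d) \<longrightarrow> dist (c xs) (c ys) < e"
      using assms(1) unfolding conn_ok_def dist_real_def length_map mem_Collect_eq length_upt n_def[symmetric] minus_nat.diff_0
      by metis
  next
    show "\<forall>f\<in>set (map pr [0..<n]). finitary_ucont f" using pr by simp
  qed (auto simp: pr_def)
  moreover have "(\<lambda>\<omega>. if i < n then (Rs ! i) \<omega> else 0) \<in> borel_measurable \<Omega>" for i
  proof (cases "i < n")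
    case True
    then have "Rs ! i \<in> L0A" using assms(2) by (auto simp: n_def)
    then show ?thesis using True by (simp add: L0A_def)
  qed simp
  ultimately
  have "(\<lambda>\<omega>. c (map (\<lambda>h. h (\<lambda>i. if i < n then (Rs ! i) \<omega> else 0)) (map pr [0..<n]))) \<in> borel_measurable \<Omega>"
    by (rule finitary_ucont_measurable)
  also have "?this \<longleftrightarrow> (\<lambda>\<omega>. c (map (\<lambda>R. R \<omega>) Rs)) \<in> borel_measurable \<Omega>"
  proof (rule measurable_cong)
    fix \<omega> assume w: "\<omega> \<in> space \<Omega>"
    have "max 0 (min 1 ((Rs ! i) \<omega>)) = (Rs ! i) \<omega>" if "i < n" for i
    proof -
      have "Rs ! i \<in> L0A" using assms(2) that by (auto simp: n_def)
      then have "(Rs ! i) \<omega> \<in> {0..1}" using w by (auto simp: L0A_def)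
      then show ?thesis by simp
    qed
    then have "map (\<lambda>h. h (\<lambda>i. if i < n then (Rs ! i) \<omega> else 0)) (map pr [0..<n]) = map (\<lambda>R. R \<omega>) Rs"
      by (intro nth_equalityI) (auto simp: n_def pr_def)
    then show "c (map (\<lambda>h. h (\<lambda>i. if i < n then (Rs ! i) \<omega> else 0)) (map pr [0..<n])) = c (map (\<lambda>R. R \<omega>) Rs)"
      by (rule arg_cong)
  qed
  finally have m: "(\<lambda>\<omega>. c (map (\<lambda>R. R \<omega>) Rs)) \<in> borel_measurable \<Omega>" .
  have "c (map (\<lambda>R. R \<omega>) Rs) \<in> {0..1}" if "\<omega> \<in> space \<Omega>" for \<omega>
  proof -
    have "set (map (\<lambda>R. R \<omega>) Rs) \<subseteq> {0..1}" using assms(2) that by (force simp: L0A_def)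
    moreover have "length (map (\<lambda>R. R \<omega>) Rs) = length Rs" by simp
    ultimately show ?thesis using assms(1) unfolding conn_ok_def by blast
  qed
  with m show ?thesis by (simp add: L0A_def)
qed

section \<open>Invariance of terms and formulas under automorphisms\<close>

lemma teval_aut:
  assumes "g \<in> autM M" "wf_trm M t"
  shows "teval M (\<lambda>i. g (\<rho> i)) t = g (teval M \<rho> t)"
  using assms(2)
proof (induction t)
  case (Fn f ts)
  then have "map (teval M (\<lambda>i. g (\<rho> i))) ts = map g (map (teval M \<rho>) ts)" by auto
  then show ?case using autM_D(3)[OF assms(1), of "map (teval M \<rho>) ts" f] Fn.prems by (simp del: map_map map_eq_conv)
qed simp

text \<open>For the quantifier cases of \<open>feval_aut\<close>: as \<open>g\<close> is onto, the
  quantified value may be taken of the form \<open>g a\<close>, and the whole assignment becomes an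
  image under \<open>g\<close>.\<close>

lemma range_fun_upd_surj:
  assumes "surj g"
  shows "range (\<lambda>a. F ((\<lambda>i. g (\<rho> i))(x := a))) = range (\<lambda>a. F (\<lambda>i. g ((\<rho>(x := a)) i)))"
proof -
  have "(\<lambda>i. g (\<rho> i))(x := g a) = (\<lambda>i. g ((\<rho>(x := a)) i))" for a by auto
  then have "range (\<lambda>a. F (\<lambda>i. g ((\<rho>(x := a)) i))) = (\<lambda>a. F ((\<lambda>i. g (\<rho> i))(x := a))) ` range g"
    unfolding image_image by metis
  then show ?thesis using assms by simp
qed

lemma feval_aut:
  assumes "g \<in> autM M" "wf_fml M \<phi>"
  shows "feval M (\<lambda>i. g (\<rho> i)) \<phi> = feval M \<rho> \<phi>"
  using assms(2)
proof (induction \<phi> arbitrary: \<rho>)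
  case (Atom p ts)
  then have "map (teval M (\<lambda>i. g (\<rho> i))) ts = map g (map (teval M \<rho>) ts)"
    by (auto intro: teval_aut[OF assms(1)])
  then show ?case using autM_D(4)[OF assms(1), of "map (teval M \<rho>) ts" p] Atom.prems by (simp del: map_map map_eq_conv)
next
  case (Dst t u)
  then show ?case by (simp add: teval_aut[OF assms(1)] autM_D(2)[OF assms(1)])
next
  case (Conn c fs)
  then have "map (feval M (\<lambda>i. g (\<rho> i))) fs = map (feval M \<rho>) fs" by auto
  then show ?case by (simp del: map_eq_conv)
next
  case (Sup x \<phi>)
  have "feval M (\<lambda>i. g ((\<rho>(x := a)) i)) \<phi> = feval M (\<rho>(x := a)) \<phi>" for a
    by (rule Sup.IH) (use Sup.prems in simp)
  then show ?case
    unfolding feval.simps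
      range_fun_upd_surj[OF bij_is_surj[OF autM_D(1)[OF assms(1)]], where F = "\<lambda>v. feval M v \<phi>"]
    by simp
next
  case (Inf x \<phi>)
  have "feval M (\<lambda>i. g ((\<rho>(x := a)) i)) \<phi> = feval M (\<rho>(x := a)) \<phi>" for a
    by (rule Inf.IH) (use Inf.prems in simp)
  then show ?case
    unfolding feval.simps
      range_fun_upd_surj[OF bij_is_surj[OF autM_D(1)[OF assms(1)]], where F = "\<lambda>v. feval M v \<phi>"]
    by simp
qed

subsection \<open>The action of the wreath product\<close>

lemma act_measurable:
  fixes M :: "('f, 'p, 'm::polish_space) mstruct"
  assumes "g \<in> L0G M" "t \<in> autOmega" "r \<in> borel_measurable \<Omega>"
  shows "(\<lambda>\<omega>. g \<omega> (r (tinv t \<omega>))) \<in> borel_measurable \<Omega>"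
  by (rule L0G_apply_measurable[OF assms(1)])
    (rule measurable_compose[OF mp_measurable[OF tinv_spec(1)[OF assms(2)]] assms(3)])

text \<open>\<open>wr_act\<close> is defined through the chosen representative. Another
  representative differs on a null set, and its preimage under \<open>tinv t\<close> is null, so the
  class of the result is the same.\<close>

lemma act_Main:
  fixes M :: "('f, 'p, 'm::polish_space) mstruct"
  assumes "g \<in> L0G M" "t \<in> autOmega" "r \<in> borel_measurable \<Omega>"
  shows "fst (wr_act (g, t)) (aecls L0M r) = aecls L0M (\<lambda>\<omega>. g \<omega> (r (tinv t \<omega>)))"
proof -
  have "rep (aecls L0M r) \<in> borel_measurable \<Omega>" by (rule MainC_rep(1)[OF MainC_I[OF assms(3)]])
  then have m: "(\<lambda>\<omega>. g \<omega> (rep (aecls L0M r) (tinv t \<omega>))) \<in> L0M"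
    using act_measurable[OF assms(1,2)] by (simp add: L0M_def)
  have "aeq (\<lambda>\<omega>. g \<omega> (rep (aecls L0M r) (tinv t \<omega>))) (\<lambda>\<omega>. g \<omega> (r (tinv t \<omega>)))"
    unfolding aeq_def using AE_mp_pullback[OF tinv_spec(1)[OF assms(2)] rep_Main[OF assms(3)]]
    by eventually_elim simp
  then show ?thesis by (simp add: wr_act_def aecls_eq_iff[OF m])
qed

lemma act_Aux:
  assumes "t \<in> autOmega" "R \<in> L0A"
  shows "snd (wr_act (g, t)) (aecls L0A R) = aecls L0A (\<lambda>\<omega>. R (tinv t \<omega>))"
proof -
  have m: "(\<lambda>\<omega>. rep (aecls L0A R) (tinv t \<omega>)) \<in> L0A"
    by (rule L0A_comp[OF AuxC_rep(1)[OF AuxC_I[OF assms(2)]] mp_measurable[OF tinv_spec(1)[OF assms(1)]]])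
  have "aeq (\<lambda>\<omega>. rep (aecls L0A R) (tinv t \<omega>)) (\<lambda>\<omega>. R (tinv t \<omega>))"
    unfolding aeq_def by (rule AE_mp_pullback[OF tinv_spec(1)[OF assms(1)] rep_Aux[OF assms(2)]])
  then show ?thesis by (simp add: wr_act_def aecls_eq_iff[OF m])
qed

lemma tinv_L0A: "t \<in> autOmega \<Longrightarrow> R \<in> L0A \<Longrightarrow> (\<lambda>\<omega>. R (tinv t \<omega>)) \<in> L0A"
  by (rule L0A_comp) (auto intro: mp_measurable tinv_spec)

lemma act_MainC:
  fixes M :: "('f, 'p, 'm::polish_space) mstruct"
  assumes "g \<in> L0G M" "t \<in> autOmega" "X \<in> MainC"
  shows "fst (wr_act (g, t)) X = aecls L0M (\<lambda>\<omega>. g \<omega> (rep X (tinv t \<omega>)))"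
    "fst (wr_act (g, t)) X \<in> MainC"
    "AE \<omega> in \<Omega>. rep (fst (wr_act (g, t)) X) \<omega> = g \<omega> (rep X (tinv t \<omega>))"
proof -
  have m: "(\<lambda>\<omega>. g \<omega> (rep X (tinv t \<omega>))) \<in> borel_measurable \<Omega>"
    by (rule act_measurable[OF assms(1,2) MainC_rep(1)[OF assms(3)]])
  show e: "fst (wr_act (g, t)) X = aecls L0M (\<lambda>\<omega>. g \<omega> (rep X (tinv t \<omega>)))" by (simp add: wr_act_def)
  show "fst (wr_act (g, t)) X \<in> MainC" unfolding e by (rule MainC_I[OF m])
  show "AE \<omega> in \<Omega>. rep (fst (wr_act (g, t)) X) \<omega> = g \<omega> (rep X (tinv t \<omega>))"
    unfolding e by (rule rep_Main[OF m])
qed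

lemma act_AuxC:
  assumes "t \<in> autOmega" "X \<in> AuxC"
  shows "snd (wr_act (g, t)) X = aecls L0A (\<lambda>\<omega>. rep X (tinv t \<omega>))"
    "snd (wr_act (g, t)) X \<in> AuxC"
    "AE \<omega> in \<Omega>. rep (snd (wr_act (g, t)) X) \<omega> = rep X (tinv t \<omega>)"
proof -
  have m: "(\<lambda>\<omega>. rep X (tinv t \<omega>)) \<in> L0A"
    by (rule tinv_L0A[OF assms(1) AuxC_rep(1)[OF assms(2)]])
  show e: "snd (wr_act (g, t)) X = aecls L0A (\<lambda>\<omega>. rep X (tinv t \<omega>))" by (simp add: wr_act_def)
  show "snd (wr_act (g, t)) X \<in> AuxC" unfolding e by (rule AuxC_I[OF m])
  show "AE \<omega> in \<Omega>. rep (snd (wr_act (g, t)) X) \<omega> = rep X (tinv t \<omega>)"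
    unfolding e by (rule rep_Aux[OF m])
qed

lemma act_dMain:
  fixes M :: "('f, 'p, 'm::polish_space) mstruct"
  assumes "g \<in> L0G M" "t \<in> autOmega" "X \<in> MainC" "Y \<in> MainC"
  shows "dMain (fst (wr_act (g, t)) X) (fst (wr_act (g, t)) Y) = dMain X Y"
proof -
  note m = MainC_rep(1)[OF assms(3)] MainC_rep(1)[OF assms(4)]
  have "dMain (fst (wr_act (g, t)) X) (fst (wr_act (g, t)) Y)
      = (\<integral>\<omega>. dist (g \<omega> (rep X (tinv t \<omega>))) (g \<omega> (rep Y (tinv t \<omega>))) \<partial>\<Omega>)"
    unfolding act_MainC(1)[OF assms(1,2,3)] act_MainC(1)[OF assms(1,2,4)]
    by (intro dMain_aecls act_measurable[OF assms(1,2)] m)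
  also have "\<dots> = (\<integral>\<omega>. dist (rep X (tinv t \<omega>)) (rep Y (tinv t \<omega>)) \<partial>\<Omega>)"
    by (rule Bochner_Integration.integral_cong) (auto simp: autM_D(2)[OF L0G_D(1)[OF assms(1)]])
  also have "\<dots> = dMain X Y"
    unfolding dMain_def
    by (rule integral_mp[OF tinv_spec(1)[OF assms(2)], of "\<lambda>\<omega>. dist (rep X \<omega>) (rep Y \<omega>)"])
      (intro borel_measurable_dist m)
  finally show ?thesis .
qed

lemma act_dAux:
  assumes "t \<in> autOmega" "X \<in> AuxC" "Y \<in> AuxC"
  shows "dAux (snd (wr_act (g, t)) X) (snd (wr_act (g, t)) Y) = dAux X Y"
proof -
  note m = AuxC_rep(1)[OF assms(2)] AuxC_rep(1)[OF assms(3)]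
  have "dAux (snd (wr_act (g, t)) X) (snd (wr_act (g, t)) Y)
      = (\<integral>\<omega>. \<bar>rep X (tinv t \<omega>) - rep Y (tinv t \<omega>)\<bar> \<partial>\<Omega>)"
    unfolding act_AuxC(1)[OF assms(1,2)] act_AuxC(1)[OF assms(1,3)]
    by (intro dAux_aecls tinv_L0A[OF assms(1)] m)
  also have "\<dots> = dAux X Y"
    unfolding dAux_def
    by (rule integral_mp[OF tinv_spec(1)[OF assms(1)], of "\<lambda>\<omega>. \<bar>rep X \<omega> - rep Y \<omega>\<bar>"])
      (intro borel_measurable_abs borel_measurable_diff m[THEN L0A_measurable])
  finally show ?thesis .
qed

lemma dMain_eq_0:
  fixes M :: "('f, 'p, 'm::polish_space) mstruct"
  assumes "metric_structure M" "X \<in> MainC" "Y \<in> MainC" "dMain X Y = 0"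
  shows "X = (Y :: (real \<Rightarrow> 'm) set)"
proof -
  have "aeq (rep X) (rep Y)"
    using assms MainC_rep(1) by (intro AE_eq_if_integral_dist_eq_0) (auto simp: metric_structure_def dMain_def)
  then have "aecls L0M (rep X) = aecls L0M (rep Y)"
    using MainC_rep(1)[OF assms(2)] by (simp add: aecls_eq_iff L0M_def)
  then show ?thesis using MainC_rep(2)[OF assms(2)] MainC_rep(2)[OF assms(3)] by simp
qed

lemma dAux_eq_0:
  assumes "X \<in> AuxC" "Y \<in> AuxC" "dAux X Y = 0"
  shows "X = Y"
proof -
  note m = AuxC_rep(1)[OF assms(1)] AuxC_rep(1)[OF assms(2)]
  have "aeq (rep X) (rep Y)"
    using assms(3) L0A_abs_diff_le[OF m]
    by (intro AE_eq_if_integral_dist_eq_0 m[THEN L0A_measurable]) (auto simp: dist_real_def dAux_def)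
  then have "aecls L0A (rep X) = aecls L0A (rep Y)"
    using m by (simp add: aecls_eq_iff)
  then show ?thesis using AuxC_rep(2)[OF assms(1)] AuxC_rep(2)[OF assms(2)] by simp
qed

lemma wr_act_bij_Main:
  fixes M :: "('f, 'p, 'm::polish_space) mstruct"
  assumes ms: "metric_structure M" and g: "g \<in> L0G M" and t: "t \<in> autOmega"
  shows "bij_betw (fst (wr_act (g, t))) MainC MainC"
  unfolding bij_betw_def
proof (rule conjI, rule inj_onI)
  fix X Y :: "(real \<Rightarrow> 'm) set"
  assume *: "X \<in> MainC" "Y \<in> MainC" "fst (wr_act (g, t)) X = fst (wr_act (g, t)) Y"
  have "dMain X Y = dMain (fst (wr_act (g, t)) X) (fst (wr_act (g, t)) Y)"
    by (rule act_dMain[OF g t *(1,2), symmetric])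
  also have "\<dots> = 0" unfolding *(3) by (simp add: dMain_def)
  finally show "X = Y" using dMain_eq_0[OF ms] * by blast
next
  have "fst (wr_act (g, t)) ` MainC \<subseteq> MainC" using act_MainC(2)[OF g t] by auto
  moreover
  have "MainC \<subseteq> fst (wr_act (g, t)) ` MainC"
  proof
    fix Y :: "(real \<Rightarrow> 'm) set" assume Y: "Y \<in> MainC"
    \<comment> \<open>The solution of
      \<open>g \<omega> (r (tinv t \<omega>)) = rep Y \<omega>\<close> for \<open>r\<close>,
      obtained by substituting \<open>t \<omega>\<close>.\<close>
    define r where "r = (\<lambda>\<omega>. inv (g (t \<omega>)) (rep Y (t \<omega>)))"
    have r: "r \<in> borel_measurable \<Omega>"
      unfolding r_def
      by (rule measurable_compose[OF mp_measurable[OF autOmega_mp[OF t]]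
            L0G_inv_apply_measurable[OF g MainC_rep(1)[OF Y]]])
    have "AE \<omega> in \<Omega>. g \<omega> (r (tinv t \<omega>)) = rep Y \<omega>"
      using tinv_spec(3)[OF t] AE_space
    proof eventually_elim
      case (elim \<omega>)
      then show ?case using autM_inv(1)[OF L0G_D(1)[OF g]] by (simp add: r_def)
    qed
    then have "aecls L0M (\<lambda>\<omega>. g \<omega> (r (tinv t \<omega>))) = aecls L0M (rep Y)"
      using act_measurable[OF g t r] by (simp add: aecls_eq_iff L0M_def aeq_def)
    then have "fst (wr_act (g, t)) (aecls L0M r) = Y"
      using act_Main[OF g t r] MainC_rep(2)[OF Y] by simp
    then show "Y \<in> fst (wr_act (g, t)) ` MainC" using MainC_I[OF r] by blast
  qed
  ultimately show "fst (wr_act (g, t)) ` MainC = MainC" by (rule subset_antisym)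
qed

lemma wr_act_bij_Aux:
  fixes g :: "real \<Rightarrow> 'm \<Rightarrow> 'm::topological_space"
  assumes t: "t \<in> autOmega"
  shows "bij_betw (snd (wr_act (g, t))) AuxC AuxC"
  unfolding bij_betw_def
proof (rule conjI, rule inj_onI)
  fix X Y assume *: "X \<in> AuxC" "Y \<in> AuxC" "snd (wr_act (g, t)) X = snd (wr_act (g, t)) Y"
  have "dAux X Y = dAux (snd (wr_act (g, t)) X) (snd (wr_act (g, t)) Y)"
    by (rule act_dAux[OF t *(1,2), symmetric])
  also have "\<dots> = 0" unfolding *(3) by (simp add: dAux_def)
  finally show "X = Y" using dAux_eq_0 * by blast
next
  have "snd (wr_act (g, t)) ` AuxC \<subseteq> AuxC" using act_AuxC(2)[OF t] by auto
  moreover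
  have "AuxC \<subseteq> snd (wr_act (g, t)) ` AuxC"
  proof
    fix Y assume Y: "Y \<in> AuxC"
    have R: "(\<lambda>\<omega>. rep Y (t \<omega>)) \<in> L0A"
      by (rule L0A_comp[OF AuxC_rep(1)[OF Y] mp_measurable[OF autOmega_mp[OF t]]])
    have "AE \<omega> in \<Omega>. rep Y (t (tinv t \<omega>)) = rep Y \<omega>"
      using tinv_spec(3)[OF t] by eventually_elim simp
    then have "aecls L0A (\<lambda>\<omega>. rep Y (t (tinv t \<omega>))) = aecls L0A (rep Y)"
      using tinv_L0A[OF t R] by (simp add: aecls_eq_iff aeq_def)
    then have "snd (wr_act (g, t)) (aecls L0A (\<lambda>\<omega>. rep Y (t \<omega>))) = Y"
      using act_Aux[OF t R] AuxC_rep(2)[OF Y] by simp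
    then show "Y \<in> snd (wr_act (g, t)) ` AuxC" using AuxC_I[OF R] by blast
  qed
  ultimately show "snd (wr_act (g, t)) ` AuxC = AuxC" by (rule subset_antisym)
qed

lemma wr_act_in_autMR:
  fixes M :: "('f, 'p, 'm::polish_space) mstruct"
  assumes ms: "metric_structure M" and g: "g \<in> L0G M" and t: "t \<in> autOmega"
  shows "wr_act (g, t) \<in> autMR M"
proof -
  let ?\<Phi> = "fst (wr_act (g, t))" and ?\<Psi> = "snd (wr_act (g, t))"
  have sem: "?\<Psi> (semR M \<phi> \<rho>) = semR M \<phi> (?\<Phi> \<circ> \<rho>)" if wf: "wf_fml M \<phi>" and \<rho>: "\<forall>i. \<rho> i \<in> MainC" for \<phi> \<rho>
  proof -
    have R: "(\<lambda>\<omega>. feval M (\<lambda>i. rep (\<rho> i) \<omega>) \<phi>) \<in> L0A"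
      using \<rho> by (intro feval_L0A[OF ms wf] MainC_rep(1)) simp
    \<comment> \<open>An assignment has countably many variables, so one null set serves all of them
      and \<open>feval_aut\<close> applies at each remaining point.\<close>
    have "AE \<omega> in \<Omega>. \<forall>i. rep (?\<Phi> (\<rho> i)) \<omega> = g \<omega> (rep (\<rho> i) (tinv t \<omega>))"
      unfolding AE_all_countable using act_MainC(3)[OF g t] \<rho> by blast
    then have "AE \<omega> in \<Omega>. feval M (\<lambda>i. rep (\<rho> i) (tinv t \<omega>)) \<phi> = feval M (\<lambda>i. rep (?\<Phi> (\<rho> i)) \<omega>) \<phi>"
      using AE_space
    proof eventually_elim
      case (elim \<omega>)
      then show ?case using feval_aut[OF L0G_D(1)[OF g] wf] by simp
    qed
    then have "aecls L0A (\<lambda>\<omega>. feval M (\<lambda>i. rep (\<rho> i) (tinv t \<omega>)) \<phi>) = semR M \<phi> (?\<Phi> \<circ> \<rho>)"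
      unfolding semR_def using tinv_L0A[OF t R] by (simp add: aecls_eq_iff aeq_def)
    then show ?thesis using act_Aux[OF t R, of g] by (simp add: semR_def)
  qed
  have conn: "?\<Psi> (connA c Xs) = connA c (map ?\<Psi> Xs)" if c: "conn_ok (length Xs) c" and Xs: "set Xs \<subseteq> AuxC" for c Xs
  proof -
    have R: "(\<lambda>\<omega>. c (map (\<lambda>X. rep X \<omega>) Xs)) \<in> L0A"
      using conn_L0A[of "map rep Xs" c] c Xs AuxC_rep(1) by (auto simp: comp_def)
    have "AE \<omega> in \<Omega>. \<forall>X\<in>set Xs. rep (?\<Psi> X) \<omega> = rep X (tinv t \<omega>)"
      using act_AuxC(3)[OF t] Xs by (intro AE_finite_allI) auto
    then have "AE \<omega> in \<Omega>. c (map (\<lambda>X. rep X (tinv t \<omega>)) Xs) = c (map (\<lambda>X. rep X \<omega>) (map ?\<Psi> Xs))"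
    proof eventually_elim
      case (elim \<omega>)
      then have "map (\<lambda>X. rep X (tinv t \<omega>)) Xs = map (\<lambda>X. rep X \<omega>) (map ?\<Psi> Xs)" by auto
      then show ?case by (rule arg_cong)
    qed
    then have "aecls L0A (\<lambda>\<omega>. c (map (\<lambda>X. rep X (tinv t \<omega>)) Xs)) = connA c (map ?\<Psi> Xs)"
      unfolding connA_def using tinv_L0A[OF t R] by (simp add: aecls_eq_iff aeq_def)
    then show ?thesis using act_Aux[OF t R, of g] by (simp add: connA_def)
  qed
  have EA: "EA (?\<Psi> X) = EA X" if X: "X \<in> AuxC" for X
    unfolding act_AuxC(1)[OF t X] EA_aecls[OF tinv_L0A[OF t AuxC_rep(1)[OF X]]] unfolding EA_def
    by (rule integral_mp[OF tinv_spec(1)[OF t] L0A_measurable[OF AuxC_rep(1)[OF X]]])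
  have "(?\<Phi>, ?\<Psi>) \<in> autMR M"
    unfolding autMR_def mem_Collect_eq case_prod_conv
    using wr_act_bij_Main[OF ms g t] wr_act_bij_Aux[OF t, of g] act_dMain[OF g t] act_dAux[OF t, of _ _ g] sem conn EA
    by blast
  then show ?thesis by simp
qed

lemma ident_L0A: "(\<lambda>\<omega>. \<omega>) \<in> L0A"
  by (simp add: L0A_def measurable_ident_Omega)

text \<open>The image of the class of the identity is the class of \<open>tinv t\<close>, which
  determines \<open>t\<close>. Constant random elements are fixed by the shift, so their images show
  the values of \<open>g\<close> on a dense sequence, which determine \<open>g\<close>.\<close>

lemma wr_act_eq_iff:
  fixes M :: "('f, 'p, 'm::polish_space) mstruct"
  assumes g: "g \<in> L0G M" "g' \<in> L0G M" and t: "t \<in> autOmega" "t' \<in> autOmega"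
  shows "autR_eq (wr_act (g, t)) (wr_act (g', t')) \<longleftrightarrow> aeq g g' \<and> aeq t t'"
proof
  assume eq: "autR_eq (wr_act (g, t)) (wr_act (g', t'))"
  have "aecls L0A (tinv t) = aecls L0A (tinv t')"
    using eq act_Aux[OF t(1) ident_L0A, of g] act_Aux[OF t(2) ident_L0A, of g'] AuxC_I[OF ident_L0A]
    by (simp add: autR_eq_def)
  then have "aeq (tinv t) (tinv t')"
    using tinv_L0A[OF t(1) ident_L0A] by (simp add: aecls_eq_iff)
  then have t_eq: "aeq t t'" using tinv_cong_iff[OF t] by simp
  obtain d :: "nat \<Rightarrow> 'm" where d: "\<And>x e. e > 0 \<Longrightarrow> \<exists>n. dist (d n) x < e"
    by (rule dense_sequence) blast
  have c: "(\<lambda>\<omega>. d n) \<in> borel_measurable \<Omega>" for n by simp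
  have "AE \<omega> in \<Omega>. g \<omega> (d n) = g' \<omega> (d n)" for n
  proof -
    have "aecls L0M (\<lambda>\<omega>. g \<omega> (d n)) = aecls L0M (\<lambda>\<omega>. g' \<omega> (d n))"
      using eq act_Main[OF g(1) t(1) c] act_Main[OF g(2) t(2) c] MainC_I[OF c] by (auto simp: autR_eq_def)
    then show ?thesis using L0G_D(2)[OF g(1)] by (simp add: aecls_eq_iff L0M_def aeq_def)
  qed
  then have "AE \<omega> in \<Omega>. \<forall>n. g \<omega> (d n) = g' \<omega> (d n)" by (simp add: AE_all_countable)
  then have "aeq g g'"
    unfolding aeq_def using AE_space
  proof eventually_elim
    case (elim \<omega>)
    then show ?case
      using autM_eq_if_eq_on_dense[OF L0G_D(1)[OF g(1)] L0G_D(1)[OF g(2)] d] by simp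
  qed
  with t_eq show "aeq g g' \<and> aeq t t'" by simp
next
  assume *: "aeq g g' \<and> aeq t t'"
  then have s: "AE \<omega> in \<Omega>. tinv t \<omega> = tinv t' \<omega>" using tinv_cong_iff[OF t] by (simp add: aeq_def)
  have gg: "AE \<omega> in \<Omega>. g \<omega> = g' \<omega>" using * by (simp add: aeq_def)
  show "autR_eq (wr_act (g, t)) (wr_act (g', t'))"
    unfolding autR_eq_def
  proof (intro conjI ballI)
    fix X :: "(real \<Rightarrow> 'm) set" assume X: "X \<in> MainC"
    have "AE \<omega> in \<Omega>. g \<omega> (rep X (tinv t \<omega>)) = g' \<omega> (rep X (tinv t' \<omega>))"
      using s gg by eventually_elim simp
    then show "fst (wr_act (g, t)) X = fst (wr_act (g', t')) X"
      using act_measurable[OF g(1) t(1) MainC_rep(1)[OF X]] 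
      unfolding act_MainC(1)[OF g(1) t(1) X] act_MainC(1)[OF g(2) t(2) X]
      by (simp add: aecls_eq_iff L0M_def aeq_def)
  next
    fix X assume X: "X \<in> AuxC"
    have "AE \<omega> in \<Omega>. rep X (tinv t \<omega>) = rep X (tinv t' \<omega>)"
      using s by eventually_elim simp
    then show "snd (wr_act (g, t)) X = snd (wr_act (g', t')) X"
      using tinv_L0A[OF t(1) AuxC_rep(1)[OF X]] 
      unfolding act_AuxC(1)[OF t(1) X] act_AuxC(1)[OF t(2) X]
      by (simp add: aecls_eq_iff aeq_def)
  qed
qed

text \<open>After passing to convenient representatives, the two sides differ only in
  \<open>tinv (t \<circ> t')\<close> against the composition of \<open>tinv t'\<close> with
  \<open>tinv t\<close>, and these agree almost everywhere.\<close>

lemma wr_act_mult: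
  fixes M :: "('f, 'p, 'm::polish_space) mstruct"
  assumes g: "g \<in> L0G M" "g' \<in> L0G M" and t: "t \<in> autOmega" "t' \<in> autOmega"
  shows "autR_eq (wr_act (wr_mult (g, t) (g', t'))) (autR_comp (wr_act (g, t)) (wr_act (g', t')))"
  unfolding autR_eq_def
proof (intro conjI ballI)
  have tt: "AE \<omega> in \<Omega>. tinv (t \<circ> t') \<omega> = tinv t' (tinv t \<omega>)"
    using autOmega_comp(2)[OF t] by (simp add: aeq_def)
  {
    fix X :: "(real \<Rightarrow> 'm) set" assume X: "X \<in> MainC"
    note m' = act_measurable[OF g(2) t(2) MainC_rep(1)[OF X]]
    have "fst (wr_act (g, t)) (fst (wr_act (g', t')) X) = aecls L0M (\<lambda>\<omega>. g \<omega> (g' (tinv t \<omega>) (rep X (tinv t' (tinv t \<omega>)))))"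
      unfolding act_MainC(1)[OF g(2) t(2) X] by (rule act_Main[OF g(1) t(1) m'])
    moreover have "AE \<omega> in \<Omega>. g \<omega> (g' (tinv t \<omega>) (rep X (tinv t' (tinv t \<omega>)))) = g \<omega> (g' (tinv t \<omega>) (rep X (tinv (t \<circ> t') \<omega>)))"
      using tt by eventually_elim simp
    then have "aecls L0M (\<lambda>\<omega>. g \<omega> (g' (tinv t \<omega>) (rep X (tinv t' (tinv t \<omega>)))))
        = aecls L0M (\<lambda>\<omega>. g \<omega> (g' (tinv t \<omega>) (rep X (tinv (t \<circ> t') \<omega>))))"
      using act_measurable[OF g(1) t(1) m'] by (simp add: aecls_eq_iff L0M_def aeq_def)
    ultimately show "fst (wr_act (wr_mult (g, t) (g', t'))) X = fst (autR_comp (wr_act (g, t)) (wr_act (g', t'))) X"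
      by (simp add: autR_comp_def wr_mult_def wr_act_def)
  }
  {
    fix X assume X: "X \<in> AuxC"
    note m' = tinv_L0A[OF t(2) AuxC_rep(1)[OF X]]
    have "snd (wr_act (g, t)) (snd (wr_act (g', t')) X) = aecls L0A (\<lambda>\<omega>. rep X (tinv t' (tinv t \<omega>)))"
      unfolding act_AuxC(1)[OF t(2) X] by (rule act_Aux[OF t(1) m'])
    moreover have "AE \<omega> in \<Omega>. rep X (tinv t' (tinv t \<omega>)) = rep X (tinv (t \<circ> t') \<omega>)"
      using tt by eventually_elim simp
    then have "aecls L0A (\<lambda>\<omega>. rep X (tinv t' (tinv t \<omega>))) = aecls L0A (\<lambda>\<omega>. rep X (tinv (t \<circ> t') \<omega>))"
      using tinv_L0A[OF t(1) m'] by (simp add: aecls_eq_iff aeq_def)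
    ultimately show "snd (wr_act (wr_mult (g, t) (g', t'))) X = snd (autR_comp (wr_act (g, t)) (wr_act (g', t'))) X"
      by (simp add: autR_comp_def wr_mult_def wr_act_def)
  }
qed

subsection \<open>Automorphisms of the auxiliary sort\<close>

lemma continuous_unit_L0A:
  assumes "continuous_on UNIV c" "\<And>x. c x \<in> {0..1}"
  shows "c \<in> L0A"
  using measurable_compose[OF measurable_ident_Omega borel_measurable_continuous_onI[OF assms(1)]] assms(2)
  by (simp add: L0A_def)

lemma continuous_unit_conn_ok:
  fixes c :: "real \<Rightarrow> real"
  assumes "continuous_on UNIV c" "\<And>x. c x \<in> {0..1}"
  shows "conn_ok 1 (\<lambda>xs. c (xs ! 0))"
  unfolding conn_ok_def
proof (intro conjI allI impI)
  fix e :: real assume "e > 0"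
  have "uniformly_continuous_on {0..1} c"
    by (rule compact_uniformly_continuous) (auto intro: continuous_on_subset[OF assms(1)])
  then obtain d where d: "d > 0" "\<And>x y. x \<in> {0..1} \<Longrightarrow> y \<in> {0..1} \<Longrightarrow> dist x y < d \<Longrightarrow> dist (c x) (c y) < e"
    using \<open>e > 0\<close> unfolding uniformly_continuous_on_def by (metis dist_commute)
  show "\<exists>d>0. \<forall>xs ys. length xs = 1 \<and> length ys = 1 \<and> set xs \<subseteq> {0..1} \<and> set ys \<subseteq> {0..1} \<and>
      (\<forall>i<1. \<bar>xs ! i - ys ! i\<bar> < d) \<longrightarrow> \<bar>c (xs ! 0) - c (ys ! 0)\<bar> < e"
  proof (intro exI[of _ d] conjI allI impI)
    fix xs ys :: "real list"
    assume *: "length xs = 1 \<and> length ys = 1 \<and> set xs \<subseteq> {0..1} \<and> set ys \<subseteq> {0..1} \<and>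
      (\<forall>i<1. \<bar>xs ! i - ys ! i\<bar> < d)"
    then have "xs ! 0 \<in> set xs" "ys ! 0 \<in> set ys" by auto
    with * have "xs ! 0 \<in> {0..1}" "ys ! 0 \<in> {0..1}" by blast+
    then show "\<bar>c (xs ! 0) - c (ys ! 0)\<bar> < e" using d(2) * by (simp add: dist_real_def)
  qed (rule d)
qed (use assms(2) in simp)

text \<open>A Borel function is Lebesgue measurable, hence an almost everywhere limit of continuous
  functions in the sense of \<open>measurable_on\<close>. Clipping these to the unit interval keeps
  the limit and makes dominated convergence apply with the constant bound 1.\<close>

lemma continuous_dense_L0A:
  assumes R: "R \<in> L0A" and e: "e > 0"
  obtains c :: "real \<Rightarrow> real" where "continuous_on UNIV c" "\<And>x. c x \<in> {0..1}"
    "(\<integral>\<omega>. \<bar>R \<omega> - c \<omega>\<bar> \<partial>\<Omega>) < e"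
proof -
  define f where "f x = (if x \<in> {0..1} then R x else 0)" for x
  have "f \<in> borel_measurable lborel"
    using L0A_measurable[OF R] unfolding f_def[abs_def] \<Omega>_def
    by (subst (asm) measurable_restrict_space_iff[where c = 0]) auto
  then have "f \<in> borel_measurable lebesgue" by (rule measurable_completion)
  then have "f measurable_on UNIV" by (rule lebesgue_measurable_imp_measurable_on_real) simp
  then obtain N g where N: "negligible N" and g: "\<And>n. continuous_on UNIV (g n)"
    and lim: "\<And>x. x \<notin> N \<Longrightarrow> (\<lambda>n. g n x) \<longlonglongrightarrow> f x"
    unfolding measurable_on_def by auto
  define c where "c n x = max 0 (min 1 (g n x))" for n and x :: real
  have c: "continuous_on UNIV (c n)" for n
    unfolding c_def[abs_def] by (intro continuous_intros g)
  have c01: "c n x \<in> {0..1}" for n x by (simp add: c_def)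
  have "AE x in lebesgue. x \<notin> N" using N by (intro AE_not_in) (simp add: negligible_iff_null_sets)
  then have "AE x in lborel. x \<notin> N" by (simp add: AE_completion_iff)
  then have ae: "AE x in \<Omega>. x \<notin> N"
    unfolding \<Omega>_def by (subst AE_restrict_space_iff) (auto elim: AE_mp)
  have "(\<lambda>n. \<integral>\<omega>. \<bar>R \<omega> - c n \<omega>\<bar> \<partial>\<Omega>) \<longlonglongrightarrow> (\<integral>\<omega>. 0 \<partial>\<Omega>)"
  proof (rule integral_dominated_convergence[where w = "\<lambda>_. 1"])
    show "AE \<omega> in \<Omega>. (\<lambda>n. \<bar>R \<omega> - c n \<omega>\<bar>) \<longlonglongrightarrow> 0"
      using ae AE_space
    proof eventually_elim
      case (elim x)
      have "0 \<le> R x" "R x \<le> 1" using R elim(2) by (auto simp: L0A_def)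
      then have "max 0 (min 1 (R x)) = R x" by simp
      moreover have "(\<lambda>n. \<bar>R x - max 0 (min 1 (g n x))\<bar>) \<longlonglongrightarrow> \<bar>R x - max 0 (min 1 (f x))\<bar>"
        by (intro tendsto_intros lim elim)
      ultimately show ?case using elim(2) by (simp add: c_def f_def)
    qed
    show "AE \<omega> in \<Omega>. norm \<bar>R \<omega> - c n \<omega>\<bar> \<le> 1" for n
      using L0A_abs_diff_le[OF R continuous_unit_L0A[OF c c01]] by (intro AE_I2) simp
    show "(\<lambda>\<omega>. \<bar>R \<omega> - c n \<omega>\<bar>) \<in> borel_measurable \<Omega>" for n
      by (intro borel_measurable_abs borel_measurable_diff L0A_measurable R continuous_unit_L0A c c01)
  qed simp_all
  then have "(\<lambda>n. \<integral>\<omega>. \<bar>R \<omega> - c n \<omega>\<bar> \<partial>\<Omega>) \<longlonglongrightarrow> 0" by simp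
  from LIMSEQ_D[OF this e] obtain n where "\<bar>\<integral>\<omega>. \<bar>R \<omega> - c n \<omega>\<bar> \<partial>\<Omega>\<bar> < e" by auto
  then show ?thesis using that[OF c c01, of n] by simp
qed

text \<open>The function \<open>cts_step x y\<close> lies between the indicators of the half-lines
  up to \<open>x\<close> and up to \<open>y\<close>. Equal integrals therefore compare each
  distribution function at \<open>x\<close> with the other at \<open>y > x\<close>; letting
  \<open>y\<close> decrease to \<open>x\<close>, right continuity gives equality.\<close>

lemma mp_if_integrals_agree:
  assumes T: "T \<in> L0A"
    and E: "\<And>c :: real \<Rightarrow> real. continuous_on UNIV c \<Longrightarrow> (\<And>x. c x \<in> {0..1}) \<Longrightarrow>
      (\<integral>\<omega>. c (T \<omega>) \<partial>\<Omega>) = (\<integral>\<omega>. c \<omega> \<partial>\<Omega>)"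
  shows "mp T"
proof -
  let ?M1 = "distr \<Omega> borel T" and ?M2 = "distr \<Omega> borel (\<lambda>\<omega>. \<omega>)"
  note mT = L0A_measurable[OF T] and mI = measurable_ident_Omega
  interpret D1: real_distribution ?M1 using mT by (rule Om.real_distribution_distr)
  interpret D2: real_distribution ?M2 using mI by (rule Om.real_distribution_distr)
  have c: "continuous_on UNIV (cts_step x y)" "\<And>z. cts_step x y z \<in> {0..1}" if "x < y" for x y :: real
    using uniformly_continuous_imp_continuous[OF cts_step_uniformly_continuous[OF that]] that
    by (auto simp: cts_step_def divide_simps)
  have int: "integral\<^sup>L ?M1 (cts_step x y) = integral\<^sup>L ?M2 (cts_step x y)" if "x < y" for x y
    using E[OF c[OF that]] borel_measurable_continuous_onI[OF c(1)[OF that]]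
    by (simp add: integral_distr[OF mT] integral_distr[OF mI])
  have le: "cdf ?M1 x \<le> cdf ?M2 y" "cdf ?M2 x \<le> cdf ?M1 y" if "x < y" for x y
    using D1.cdf_cts_step[OF that] D2.cdf_cts_step[OF that] int[OF that] by auto
  have ev: "\<forall>\<^sub>F y in at_right x. x < y" for x :: real by (simp add: eventually_at_filter)
  have "cdf ?M1 x = cdf ?M2 x" for x
  proof (rule antisym)
    have "(cdf ?M2 \<longlongrightarrow> cdf ?M2 x) (at_right x)"
      using D2.cdf_is_right_cont[of x] by (simp add: continuous_within)
    then show "cdf ?M1 x \<le> cdf ?M2 x"
      by (rule tendsto_lowerbound) (use ev[of x] in \<open>auto elim!: eventually_mono intro: le\<close>)
    have "(cdf ?M1 \<longlongrightarrow> cdf ?M1 x) (at_right x)"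
      using D1.cdf_is_right_cont[of x] by (simp add: continuous_within)
    then show "cdf ?M2 x \<le> cdf ?M1 x"
      by (rule tendsto_lowerbound) (use ev[of x] in \<open>auto elim!: eventually_mono intro: le\<close>)
  qed
  then have eq: "?M1 = ?M2" by (intro cdf_unique D1.real_distribution_axioms D2.real_distribution_axioms ext)
  have m: "T \<in> measurable \<Omega> \<Omega>" using T by (intro measurable_into_Omega) (auto simp: L0A_def)
  have "distr \<Omega> \<Omega> T = \<Omega>"
  proof (rule measure_eqI)
    fix A assume "A \<in> sets (distr \<Omega> \<Omega> T)"
    then have A: "A \<in> sets \<Omega>" "A \<in> sets borel" "A \<subseteq> {0..1}" by (auto simp: sets_Omega)
    have "emeasure (distr \<Omega> \<Omega> T) A = emeasure ?M1 A"
      using A by (simp add: emeasure_distr[OF m] emeasure_distr[OF mT])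
    also have "\<dots> = emeasure \<Omega> A"
      unfolding eq emeasure_distr[OF mI A(2)] using A(3) by (intro arg_cong[where f = "emeasure \<Omega>"]) auto
    finally show "emeasure (distr \<Omega> \<Omega> T) A = emeasure \<Omega> A" .
  qed simp
  with m show ?thesis by (simp add: mp_def)
qed

lemma aux_automorphism_realized:
  assumes bij: "bij_betw \<Psi> AuxC AuxC"
    and iso: "\<And>X Y. X \<in> AuxC \<Longrightarrow> Y \<in> AuxC \<Longrightarrow> dAux (\<Psi> X) (\<Psi> Y) = dAux X Y"
    and EA: "\<And>X. X \<in> AuxC \<Longrightarrow> EA (\<Psi> X) = EA X"
    and conn: "\<And>c Xs. conn_ok (length Xs) c \<Longrightarrow> set Xs \<subseteq> AuxC \<Longrightarrow> \<Psi> (connA c Xs) = connA c (map \<Psi> Xs)"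
  obtains T where "T \<in> L0A" "mp T" "\<And>R. R \<in> L0A \<Longrightarrow> \<Psi> (aecls L0A R) = aecls L0A (\<lambda>\<omega>. R (T \<omega>))"
proof -
  define I where "I = aecls L0A (\<lambda>\<omega>. \<omega>)"
  define T where "T = rep (\<Psi> I)"
  have I: "I \<in> AuxC" unfolding I_def by (rule AuxC_I[OF ident_L0A])
  have \<Psi>: "\<Psi> X \<in> AuxC" if "X \<in> AuxC" for X using bij that by (auto simp: bij_betw_def)
  have T: "T \<in> L0A" unfolding T_def by (rule AuxC_rep(1)[OF \<Psi>[OF I]])
  have m: "T \<in> measurable \<Omega> \<Omega>" using T by (intro measurable_into_Omega) (auto simp: L0A_def)
  have cont: "\<Psi> (aecls L0A c) = aecls L0A (\<lambda>\<omega>. c (T \<omega>))"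
    if c: "continuous_on UNIV c" "\<And>x. c x \<in> {0..1}" for c :: "real \<Rightarrow> real"
  proof -
    \<comment> \<open>\<open>connA\<close> evaluates the chosen representative of \<open>I\<close>,
      which is the identity only almost everywhere.\<close>
    have "AE \<omega> in \<Omega>. c \<omega> = c (rep I \<omega>)"
      using rep_Aux[OF ident_L0A] unfolding I_def by eventually_elim simp
    then have "aecls L0A c = connA (\<lambda>xs. c (xs ! 0)) [I]"
      unfolding connA_def using continuous_unit_L0A[OF c] by (simp add: aecls_eq_iff aeq_def)
    then show ?thesis
      using conn[of "[I]" "\<lambda>xs. c (xs ! 0)"] continuous_unit_conn_ok[OF c] I by (simp add: connA_def T_def)
  qed
  have "mp T"
  proof (rule mp_if_integrals_agree[OF T])
    fix c :: "real \<Rightarrow> real" assume c: "continuous_on UNIV c" "\<And>x. c x \<in> {0..1}"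
    note cA = continuous_unit_L0A[OF c]
    show "(\<integral>\<omega>. c (T \<omega>) \<partial>\<Omega>) = (\<integral>\<omega>. c \<omega> \<partial>\<Omega>)"
      using EA[OF AuxC_I[OF cA]] unfolding cont[OF c] EA_aecls[OF cA] EA_aecls[OF L0A_comp[OF cA m]] .
  qed
  moreover have "\<Psi> (aecls L0A R) = aecls L0A (\<lambda>\<omega>. R (T \<omega>))" if R: "R \<in> L0A" for R
  proof -
    define Q where "Q = rep (\<Psi> (aecls L0A R))"
    have QC: "\<Psi> (aecls L0A R) \<in> AuxC" by (rule \<Psi>[OF AuxC_I[OF R]])
    have Q: "Q \<in> L0A" "aecls L0A Q = \<Psi> (aecls L0A R)" unfolding Q_def using AuxC_rep[OF QC] by auto
    note RT = L0A_comp[OF R m]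
    \<comment> \<open>Compare both functions with \<open>c (T \<omega>)\<close> for a continuous
      \<open>c\<close> close to \<open>R\<close>. Both distances equal that from \<open>R\<close> to
      \<open>c\<close>: the first because \<Psi> is an isometry, the second because \<open>T\<close>
      preserves measure.\<close>
    have "dAux (aecls L0A Q) (aecls L0A (\<lambda>\<omega>. R (T \<omega>))) \<le> 0 + e" if e: "e > 0" for e
    proof -
      obtain c :: "real \<Rightarrow> real" where c: "continuous_on UNIV c" "\<And>x. c x \<in> {0..1}"
        and small: "(\<integral>\<omega>. \<bar>R \<omega> - c \<omega>\<bar> \<partial>\<Omega>) < e / 2"
        using continuous_dense_L0A[OF R, of "e / 2"] e by auto
      note cA = continuous_unit_L0A[OF c]
      note cT = L0A_comp[OF cA m]
      have int: "integrable \<Omega> (\<lambda>\<omega>. \<bar>f \<omega> - h \<omega>\<bar>)" if "f \<in> L0A" "h \<in> L0A" for f h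
        using that L0A_abs_diff_le[OF that]
        by (intro integrable_bounded[of _ 1] borel_measurable_abs borel_measurable_diff L0A_measurable) auto
      have "(\<integral>\<omega>. \<bar>Q \<omega> - R (T \<omega>)\<bar> \<partial>\<Omega>) \<le> (\<integral>\<omega>. \<bar>Q \<omega> - c (T \<omega>)\<bar> + \<bar>R (T \<omega>) - c (T \<omega>)\<bar> \<partial>\<Omega>)"
        by (intro integral_mono int Bochner_Integration.integrable_add Q RT cT) auto
      also have "\<dots> = (\<integral>\<omega>. \<bar>Q \<omega> - c (T \<omega>)\<bar> \<partial>\<Omega>) + (\<integral>\<omega>. \<bar>R (T \<omega>) - c (T \<omega>)\<bar> \<partial>\<Omega>)"
        by (intro Bochner_Integration.integral_add int Q RT cT)
      also have "(\<integral>\<omega>. \<bar>Q \<omega> - c (T \<omega>)\<bar> \<partial>\<Omega>) = dAux (\<Psi> (aecls L0A R)) (\<Psi> (aecls L0A c))"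
        unfolding cont[OF c] Q(2)[symmetric] by (rule dAux_aecls[OF Q(1) cT, symmetric])
      also have "\<dots> = (\<integral>\<omega>. \<bar>R \<omega> - c \<omega>\<bar> \<partial>\<Omega>)"
        unfolding iso[OF AuxC_I[OF R] AuxC_I[OF cA]] by (rule dAux_aecls[OF R cA])
      also have "(\<integral>\<omega>. \<bar>R (T \<omega>) - c (T \<omega>)\<bar> \<partial>\<Omega>) = (\<integral>\<omega>. \<bar>R \<omega> - c \<omega>\<bar> \<partial>\<Omega>)"
        by (rule integral_mp[OF \<open>mp T\<close>, of "\<lambda>\<omega>. \<bar>R \<omega> - c \<omega>\<bar>"])
          (intro borel_measurable_abs borel_measurable_diff L0A_measurable R cA)
      finally show ?thesis using small by (simp add: dAux_aecls[OF Q(1) RT])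
    qed
    then have "dAux (aecls L0A Q) (aecls L0A (\<lambda>\<omega>. R (T \<omega>))) \<le> 0" by (rule field_le_epsilon)
    moreover have "dAux (aecls L0A Q) (aecls L0A (\<lambda>\<omega>. R (T \<omega>))) \<ge> 0"
      by (simp add: dAux_def)
    ultimately have "aecls L0A Q = aecls L0A (\<lambda>\<omega>. R (T \<omega>))"
      by (intro dAux_eq_0 AuxC_I Q RT) simp
    then show ?thesis using Q(2) by simp
  qed
  ultimately show ?thesis using that[OF T] by blast
qed

text \<open>A preimage of the class of the identity is a left inverse \<open>t\<close> of
  \<open>T\<close>. Since \<open>\<Omega>\<close> is its own image under \<open>T\<close>, the image
  measure of \<open>t\<close> is that of \<open>t \<circ> T\<close>, and
  \<open>T (t \<omega>) = \<omega>\<close> can be tested at points \<open>T \<omega>\<close>. The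
  transformation is \<open>t\<close> rather than \<open>T\<close> because the action composes with
  the inverse.\<close>

lemma aux_automorphism_autOmega:
  assumes bij: "bij_betw \<Psi> AuxC AuxC" and T: "T \<in> L0A" "mp T"
    and \<Psi>: "\<And>R. R \<in> L0A \<Longrightarrow> \<Psi> (aecls L0A R) = aecls L0A (\<lambda>\<omega>. R (T \<omega>))"
  obtains t where "t \<in> autOmega" "\<And>R. R \<in> L0A \<Longrightarrow> \<Psi> (aecls L0A R) = aecls L0A (\<lambda>\<omega>. R (tinv t \<omega>))"
proof -
  note mT = mp_measurable[OF T(2)]
  obtain Y where Y: "Y \<in> AuxC" "\<Psi> Y = aecls L0A (\<lambda>\<omega>. \<omega>)"
    using bij AuxC_I[OF ident_L0A] by (auto simp: bij_betw_def image_iff) (metis imageE)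
  define t where "t = rep Y"
  have t: "t \<in> L0A" unfolding t_def by (rule AuxC_rep(1)[OF Y(1)])
  have mt: "t \<in> measurable \<Omega> \<Omega>" using t by (intro measurable_into_Omega) (auto simp: L0A_def)
  have "aecls L0A (\<lambda>\<omega>. t (T \<omega>)) = aecls L0A (\<lambda>\<omega>. \<omega>)"
    using \<Psi>[OF t] Y AuxC_rep(2)[OF Y(1)] by (simp add: t_def)
  then have tT: "AE \<omega> in \<Omega>. t (T \<omega>) = \<omega>"
    using L0A_comp[OF t mT] by (simp add: aecls_eq_iff aeq_def)
  have "distr \<Omega> \<Omega> t = distr (distr \<Omega> \<Omega> T) \<Omega> t" using T(2) by (simp add: mp_def)
  also have "\<dots> = distr \<Omega> \<Omega> (t \<circ> T)" by (rule distr_distr[OF mt mT])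
  also have "\<dots> = distr \<Omega> \<Omega> (\<lambda>\<omega>. \<omega>)"
    by (rule distr_cong_AE) (use tT measurable_comp[OF mT mt] in auto)
  finally have mpt: "mp t" using mt by (simp add: mp_def)
  \<comment> \<open>Null sets pull back along \<open>T\<close> in any case; going from an almost
    sure statement at \<open>T \<omega>\<close> back to the image measure asks for a measurable
    set.\<close>
  have P: "{\<omega> \<in> space \<Omega>. T (t \<omega>) = \<omega>} \<in> sets \<Omega>"
    by (rule borel_measurable_eq)
      (auto intro: measurable_compose[OF mt L0A_measurable[OF T(1)]] measurable_ident_Omega)
  have "AE \<omega> in \<Omega>. T (t (T \<omega>)) = T \<omega>" using tT by eventually_elim simp
  then have "AE \<omega> in distr \<Omega> \<Omega> T. T (t \<omega>) = \<omega>" using AE_distr_iff[OF mT P] by simp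
  moreover have "distr \<Omega> \<Omega> T = \<Omega>" using T(2) by (simp add: mp_def)
  ultimately have Tt: "AE \<omega> in \<Omega>. T (t \<omega>) = \<omega>" by metis
  have t': "t \<in> autOmega" by (rule autOmegaI[OF mpt T(2) Tt tT])
  have "aeq (tinv t) T"
    by (rule AE_inverse_unique[where t = t and t' = t, OF tinv_spec(1,3)[OF t'] Tt]) simp
  then have s: "AE \<omega> in \<Omega>. tinv t \<omega> = T \<omega>" by (simp add: aeq_def)
  show ?thesis
  proof (rule that[OF t'])
    fix R assume R: "R \<in> L0A"
    have "AE \<omega> in \<Omega>. R (T \<omega>) = R (tinv t \<omega>)" using s by eventually_elim simp
    then show "\<Psi> (aecls L0A R) = aecls L0A (\<lambda>\<omega>. R (tinv t \<omega>))"
      unfolding \<Psi>[OF R] using L0A_comp[OF R mT] by (simp add: aecls_eq_iff aeq_def)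
  qed
qed

subsection \<open>Automorphisms of the main sort\<close>

text \<open>The approximating sequences are indexed by the entry \<open>x\<close> and not by its
  position, so that a list is approximated by a single \<open>map\<close>, also when entries
  repeat.\<close>

lemma ucont_list_tendsto:
  assumes f: "ucont_list n f" and n: "length xs = n"
    and lim: "\<And>x. x \<in> set xs \<Longrightarrow> (\<lambda>j. S x j) \<longlonglongrightarrow> L x"
  shows "(\<lambda>j::nat. f (map (\<lambda>x. S x j) xs)) \<longlonglongrightarrow> f (map L xs)"
proof (rule tendstoI)
  fix e :: real assume "e > 0"
  then obtain d where d: "d > 0" "\<And>xs ys. length xs = n \<Longrightarrow> length ys = n \<Longrightarrow>
      (\<forall>i<n. dist (xs ! i) (ys ! i) < d) \<Longrightarrow> dist (f xs) (f ys) < e"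
    using f unfolding ucont_list_def by meson
  have "\<forall>\<^sub>F j in sequentially. \<forall>x\<in>set xs. dist (S x j) (L x) < d"
    using lim d(1) by (intro eventually_ball_finite) (auto intro: tendstoD)
  then show "\<forall>\<^sub>F j in sequentially. dist (f (map (\<lambda>x. S x j) xs)) (f (map L xs)) < e"
    by eventually_elim (rule d(2), use n in auto)
qed

text \<open>If \<open>d m\<close> is close to \<open>z\<close>, then both \<open>y\<close> and
  \<open>G z\<close> are close to \<open>G (d m)\<close>. This is used twice: to find preimages
  under an extended isometry, and to identify the image of a random element pointwise.\<close>

lemma eq_if_dist_eq_on_dense:
  assumes G: "\<And>x y. dist (G x) (G y) = dist x y" and d: "\<And>x e. e > 0 \<Longrightarrow> \<exists>n. dist (d n) x < e"
    and eq: "\<And>m. dist y (G (d m)) = dist z (d m)"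
  shows "y = G z"
proof -
  have "dist y (G z) \<le> 0 + e" if e: "e > 0" for e
  proof -
    obtain m where m: "dist (d m) z < e / 2" using d[of "e / 2" z] e by auto
    have "dist y (G z) \<le> dist y (G (d m)) + dist (G (d m)) (G z)" by (rule dist_triangle)
    also have "\<dots> < e" using m by (simp add: eq G dist_commute)
    finally show ?thesis by simp
  qed
  then have "dist y (G z) \<le> 0" by (rule field_le_epsilon)
  then show ?thesis by simp
qed

lemma dense_sequence_limits:
  assumes d: "\<And>x e. e > 0 \<Longrightarrow> \<exists>n. dist (d n) x < e"
  shows "\<exists>S :: 'a::metric_space \<Rightarrow> nat \<Rightarrow> nat. \<forall>x. (\<lambda>j. d (S x j)) \<longlonglongrightarrow> x"
proof -
  have "\<forall>x j. \<exists>n. dist (d n) x < inverse (real (Suc j))" using d by simp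
  then obtain S where S: "\<And>x j. dist (d (S x j)) x < inverse (real (Suc j))" by metis
  have "(\<lambda>j. d (S x j)) \<longlonglongrightarrow> x" for x
  proof (rule metric_tendsto_imp_tendsto[OF LIMSEQ_inverse_real_of_nat])
    show "\<forall>\<^sub>F j in sequentially. dist (d (S x j)) x \<le> dist (inverse (real (Suc j))) 0"
      using S[of x] by (intro always_eventually allI) (auto simp: less_imp_le)
  qed
  then show ?thesis by blast
qed

lemma isometric_extension:
  fixes d k :: "nat \<Rightarrow> 'm::complete_space"
  assumes d: "\<And>x e. e > 0 \<Longrightarrow> \<exists>n. dist (d n) x < e"
    and iso: "\<And>n m. dist (k n) (k m) = dist (d n) (d m)"
  obtains G where "\<And>n. G (d n) = k n" "\<And>x y. dist (G x) (G y) = dist x y"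
proof -
  \<comment> \<open>The sequence \<open>d\<close> may repeat values; the isometry condition forces
    \<open>k\<close> to repeat them too, so the choice of index does not matter.\<close>
  define f where "f x = k (SOME n. d n = x)" for x
  have fd: "f (d n) = k n" for n
  proof -
    have "d (SOME m. d m = d n) = d n" by (rule someI[of "\<lambda>m. d m = d n" n]) simp
    then have "dist (k (SOME m. d m = d n)) (k n) = 0" by (simp add: iso)
    then show ?thesis by (simp add: f_def)
  qed
  have "uniformly_continuous_on (range d) f"
    unfolding uniformly_continuous_on_def by (auto simp: fd iso)
  then obtain G where G: "uniformly_continuous_on (closure (range d)) G" "\<And>x. x \<in> range d \<Longrightarrow> f x = G x"
    by (rule uniformly_continuous_on_extension_on_closure) blast
  have "closure (range d) = UNIV"
    using d by (auto simp: closure_approachable)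
  then have cont: "isCont G x" for x
    using uniformly_continuous_imp_continuous[OF G(1)] by (simp add: continuous_on_eq_continuous_at)
  have Gd: "G (d n) = k n" for n using G(2)[of "d n"] fd by simp
  have "dist (G x) (G y) = dist x y" for x y
  proof -
    obtain S where S: "\<And>x. (\<lambda>j. d (S x j)) \<longlonglongrightarrow> x" using dense_sequence_limits[OF d] by blast
    have "(\<lambda>j. dist (G (d (S x j))) (G (d (S y j)))) \<longlonglongrightarrow> dist (G x) (G y)"
      by (intro tendsto_dist isCont_tendsto_compose[OF cont] S)
    moreover have "(\<lambda>j. dist (d (S x j)) (d (S y j))) \<longlonglongrightarrow> dist x y"
      by (intro tendsto_dist S)
    ultimately show ?thesis unfolding Gd iso by (rule LIMSEQ_unique)
  qed
  with Gd show ?thesis by (rule that)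
qed

text \<open>The hypotheses are formulated so that each can be read off from random elements outside
  a null set. The value of a function symbol on dense points need not be a dense point, so it is
  recorded by its distances to all \<open>d m\<close>; likewise a preimage of \<open>d n\<close> is
  described only by the distances that it must have.\<close>

lemma automorphism_extension:
  fixes M :: "('f, 'p, 'm::polish_space) mstruct" and d k :: "nat \<Rightarrow> 'm"
  assumes ms: "metric_structure M"
    and d: "\<And>x e. e > 0 \<Longrightarrow> \<exists>n. dist (d n) x < e"
    and iso: "\<And>n m. dist (k n) (k m) = dist (d n) (d m)"
    and pred: "\<And>p ns. length ns = pred_ar M p \<Longrightarrow> pred_int M p (map k ns) = pred_int M p (map d ns)"
    and func: "\<And>f ns m. length ns = fun_ar M f \<Longrightarrow>
      dist (fun_int M f (map k ns)) (k m) = dist (fun_int M f (map d ns)) (d m)"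
    and surj: "\<And>n. \<exists>z. \<forall>m. dist (d n) (k m) = dist z (d m)"
  obtains G where "G \<in> autM M" "\<And>n. G (d n) = k n"
proof -
  obtain G where Gd: "\<And>n. G (d n) = k n" and G: "\<And>x y. dist (G x) (G y) = dist x y"
    using isometric_extension[OF d iso] by blast
  obtain S where S: "\<And>x. (\<lambda>j. d (S x j)) \<longlonglongrightarrow> x" using dense_sequence_limits[OF d] by blast
  have kS: "(\<lambda>j. k (S x j)) \<longlonglongrightarrow> G x" for x
  proof (rule metric_tendsto_imp_tendsto[OF S[of x]])
    show "\<forall>\<^sub>F j in sequentially. dist (k (S x j)) (G x) \<le> dist (d (S x j)) x"
      by (simp add: G flip: Gd)
  qed
  have P: "pred_int M p (map G xs) = pred_int M p xs" if l: "length xs = pred_ar M p" for p xs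
  proof -
    have u: "ucont_list (pred_ar M p) (pred_int M p)" using ms by (simp add: metric_structure_def)
    have "(\<lambda>j. pred_int M p (map (\<lambda>x. k (S x j)) xs)) \<longlonglongrightarrow> pred_int M p (map G xs)"
      by (rule ucont_list_tendsto[OF u l kS])
    moreover have "(\<lambda>j. pred_int M p (map (\<lambda>x. d (S x j)) xs)) \<longlonglongrightarrow> pred_int M p (map (\<lambda>x. x) xs)"
      by (rule ucont_list_tendsto[OF u l S])
    moreover have "pred_int M p (map (\<lambda>x. k (S x j)) xs) = pred_int M p (map (\<lambda>x. d (S x j)) xs)" for j
      using pred[of "map (\<lambda>x. S x j) xs" p] l by (simp add: comp_def)
    ultimately show ?thesis by (auto intro: LIMSEQ_unique)
  qed
  have F: "G (fun_int M f xs) = fun_int M f (map G xs)" if l: "length xs = fun_ar M f" for f xs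
  proof -
    have u: "ucont_list (fun_ar M f) (fun_int M f)" using ms by (simp add: metric_structure_def)
    have "dist (fun_int M f (map G xs)) (G y) = dist (fun_int M f xs) y" for y
    proof -
      have "(\<lambda>j. dist (fun_int M f (map (\<lambda>x. k (S x j)) xs)) (k (S y j))) \<longlonglongrightarrow> dist (fun_int M f (map G xs)) (G y)"
        by (intro tendsto_dist ucont_list_tendsto[OF u l kS] kS)
      moreover have "(\<lambda>j. dist (fun_int M f (map (\<lambda>x. d (S x j)) xs)) (d (S y j))) \<longlonglongrightarrow> dist (fun_int M f (map (\<lambda>x. x) xs)) y"
        by (intro tendsto_dist ucont_list_tendsto[OF u l S] S)
      moreover have "dist (fun_int M f (map (\<lambda>x. k (S x j)) xs)) (k (S y j)) = dist (fun_int M f (map (\<lambda>x. d (S x j)) xs)) (d (S y j))" for j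
        using func[of "map (\<lambda>x. S x j) xs" f] l by (simp add: comp_def)
      ultimately show ?thesis by (auto intro: LIMSEQ_unique)
    qed
    \<comment> \<open>With \<open>y\<close> equal to the value of the function symbol, the
      right-hand distance is 0.\<close>
    from this[of "fun_int M f xs"] show ?thesis by simp
  qed
  have "\<exists>z. d n = G z" for n
  proof -
    obtain z where "\<And>m. dist (d n) (k m) = dist z (d m)" using surj by blast
    then have "d n = G z" by (intro eq_if_dist_eq_on_dense[OF G d]) (simp_all add: Gd)
    then show ?thesis ..
  qed
  then obtain Z where Z: "\<And>n. d n = G (Z n)" by metis
  have "\<exists>z. y = G z" for y
  proof -
    \<comment> \<open>The range of an isometry on a complete space is closed: preimages of a
      convergent sequence are Cauchy, and their limit is a preimage of the limit. As the range
      contains all \<open>d n\<close>, the map is onto.\<close>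
    have "Cauchy (\<lambda>j. d (S y j))" using S by (rule LIMSEQ_imp_Cauchy)
    then have "Cauchy (\<lambda>j. Z (S y j))" by (simp add: Cauchy_def Z G)
    then obtain z where z: "(\<lambda>j. Z (S y j)) \<longlonglongrightarrow> z" by (auto simp: Cauchy_convergent_iff convergent_def)
    have "(\<lambda>j. G (Z (S y j))) \<longlonglongrightarrow> G z"
      by (rule metric_tendsto_imp_tendsto[OF z]) (simp add: G)
    then have "y = G z" using S[of y] unfolding Z by (intro LIMSEQ_unique) auto
    then show ?thesis ..
  qed
  then have "surj G" by (simp add: surj_def)
  moreover have "inj G"
    by (rule injI) (metis G dist_eq_0_iff)
  ultimately have "G \<in> autM M" using G P F by (simp add: autM_def bij_def)
  then show ?thesis using Gd by (rule that)
qed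

text \<open>Turns the identity of classes into an almost sure identity for arbitrary representatives
  \<open>r\<close>. All conditions needed for \<open>automorphism_extension\<close> are instances
  with atomic formulas.\<close>

lemma feval_random_element:
  fixes M :: "('f, 'p, 'm::polish_space) mstruct"
  assumes ms: "metric_structure M" and t: "t \<in> autOmega"
    and \<Psi>: "\<And>R. R \<in> L0A \<Longrightarrow> \<Psi> (aecls L0A R) = aecls L0A (\<lambda>\<omega>. R (tinv t \<omega>))"
    and sem: "\<And>\<rho>. (\<And>i. \<rho> i \<in> MainC) \<Longrightarrow> \<Psi> (semR M \<phi> \<rho>) = semR M \<phi> (\<Phi> \<circ> \<rho>)"
    and wf: "wf_fml M \<phi>" and r: "\<And>i. r i \<in> borel_measurable \<Omega>"
  shows "AE \<omega> in \<Omega>. feval M (\<lambda>i. rep (\<Phi> (aecls L0M (r i))) \<omega>) \<phi> = feval M (\<lambda>i. r i (tinv t \<omega>)) \<phi>"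
proof -
  define \<rho> where "\<rho> i = aecls L0M (r i)" for i
  have \<rho>: "\<rho> i \<in> MainC" for i unfolding \<rho>_def by (rule MainC_I[OF r])
  note R = feval_L0A[OF ms wf, of r, OF r]
  have "AE \<omega> in \<Omega>. \<forall>i. rep (\<rho> i) \<omega> = r i \<omega>"
    unfolding AE_all_countable \<rho>_def using rep_Main[OF r] by blast
  then have "AE \<omega> in \<Omega>. feval M (\<lambda>i. r i \<omega>) \<phi> = feval M (\<lambda>i. rep (\<rho> i) \<omega>) \<phi>"
    by eventually_elim simp
  then have "semR M \<phi> \<rho> = aecls L0A (\<lambda>\<omega>. feval M (\<lambda>i. r i \<omega>) \<phi>)"
    unfolding semR_def using aecls_eq_iff[OF R, of "\<lambda>\<omega>. feval M (\<lambda>i. rep (\<rho> i) \<omega>) \<phi>"] by (simp add: aeq_def)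
  then have "aecls L0A (\<lambda>\<omega>. feval M (\<lambda>i. r i (tinv t \<omega>)) \<phi>) = semR M \<phi> (\<Phi> \<circ> \<rho>)"
    using sem[of \<rho>, OF \<rho>] \<Psi>[OF R] by simp
  then have "AE \<omega> in \<Omega>. feval M (\<lambda>i. r i (tinv t \<omega>)) \<phi> = feval M (\<lambda>i. rep (\<Phi> (\<rho> i)) \<omega>) \<phi>"
    unfolding semR_def using aecls_eq_iff[OF tinv_L0A[OF t R]] by (simp add: aeq_def)
  then show ?thesis unfolding \<rho>_def by eventually_elim simp
qed

lemma map_upt_nth: "map (\<lambda>i. f (ns ! i)) [0..<length ns] = map f ns"
  by (rule nth_equalityI) auto

lemma main_automorphism_realized:
  fixes M :: "('f::countable, 'p::countable, 'm::polish_space) mstruct"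
  assumes ms: "metric_structure M" and t: "t \<in> autOmega"
    and bij: "bij_betw \<Phi> MainC MainC"
    and \<Psi>: "\<And>R. R \<in> L0A \<Longrightarrow> \<Psi> (aecls L0A R) = aecls L0A (\<lambda>\<omega>. R (tinv t \<omega>))"
    and sem: "\<And>\<phi> \<rho>. wf_fml M \<phi> \<Longrightarrow> (\<And>i. \<rho> i \<in> MainC) \<Longrightarrow> \<Psi> (semR M \<phi> \<rho>) = semR M \<phi> (\<Phi> \<circ> \<rho>)"
  obtains g where "g \<in> L0G M" "\<And>X. X \<in> MainC \<Longrightarrow> \<Phi> X = fst (wr_act (g, t)) X"
proof -
  have \<Phi>: "\<Phi> X \<in> MainC" if "X \<in> MainC" for X using bij that by (auto simp: bij_betw_def)
  obtain d :: "nat \<Rightarrow> 'm" where d: "\<And>x e. e > 0 \<Longrightarrow> \<exists>n. dist (d n) x < e"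
    by (rule dense_sequence) blast
  define h where "h n = rep (\<Phi> (aecls L0M (\<lambda>_. d n)))" for n
  have c: "(\<lambda>_. d n) \<in> borel_measurable \<Omega>" for n by simp
  have h: "h n \<in> borel_measurable \<Omega>" for n
    unfolding h_def by (rule MainC_rep(1)[OF \<Phi>[OF MainC_I[OF c]]])
  have key: "AE \<omega> in \<Omega>. feval M (\<lambda>i. rep (\<Phi> (aecls L0M (r i))) \<omega>) \<phi> = feval M (\<lambda>i. r i (tinv t \<omega>)) \<phi>"
    if "wf_fml M \<phi>" "\<And>i. r i \<in> borel_measurable \<Omega>" for \<phi> r
    by (rule feval_random_element[OF ms t, where \<Psi> = \<Psi>]) (use \<Psi> sem that in blast)+
  have const: "AE \<omega> in \<Omega>. feval M (\<lambda>i. h (ns i) \<omega>) \<phi> = feval M (\<lambda>i. d (ns i)) \<phi>" if "wf_fml M \<phi>" for ns \<phi>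
    using key[OF that, of "\<lambda>i _. d (ns i)"] by (simp add: h_def)
  have dist_h: "AE \<omega> in \<Omega>. \<forall>m. dist (rep (\<Phi> (aecls L0M r)) \<omega>) (h m \<omega>) = dist (r (tinv t \<omega>)) (d m)"
    if r: "r \<in> borel_measurable \<Omega>" for r
    unfolding AE_all_countable
  proof
    fix m
    show "AE \<omega> in \<Omega>. dist (rep (\<Phi> (aecls L0M r)) \<omega>) (h m \<omega>) = dist (r (tinv t \<omega>)) (d m)"
      using key[of "Dst (Var 0) (Var 1)" "\<lambda>i. if i = 0 then r else (\<lambda>_. d m)"] r
      by (simp add: h_def cong: if_cong)
  qed
  have iso: "AE \<omega> in \<Omega>. \<forall>n m. dist (h n \<omega>) (h m \<omega>) = dist (d n) (d m)"
    unfolding AE_all_countable using dist_h[OF c] by (simp add: h_def AE_all_countable)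
  \<comment> \<open>There are countably many symbols and countably many finite lists of indices, so
    a single null set is enough.\<close>
  have pred: "AE \<omega> in \<Omega>. \<forall>p ns. length ns = pred_ar M p \<longrightarrow>
      pred_int M p (map (\<lambda>n. h n \<omega>) ns) = pred_int M p (map d ns)"
    unfolding AE_all_countable
  proof (intro allI)
    fix p and ns :: "nat list"
    show "AE \<omega> in \<Omega>. length ns = pred_ar M p \<longrightarrow> pred_int M p (map (\<lambda>n. h n \<omega>) ns) = pred_int M p (map d ns)"
    proof (cases "length ns = pred_ar M p")
      case True
      then have "wf_fml M (Atom p (map Var [0..<length ns]))" by auto
      from const[OF this, of "\<lambda>i. ns ! i"] show ?thesis
        by (simp add: comp_def map_upt_nth[of "\<lambda>n. h n _"] map_upt_nth[of d])
    qed simp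
  qed
  have func: "AE \<omega> in \<Omega>. \<forall>f ns m. length ns = fun_ar M f \<longrightarrow>
      dist (fun_int M f (map (\<lambda>n. h n \<omega>) ns)) (h m \<omega>) = dist (fun_int M f (map d ns)) (d m)"
    unfolding AE_all_countable
  proof (intro allI)
    fix f and ns :: "nat list" and m
    show "AE \<omega> in \<Omega>. length ns = fun_ar M f \<longrightarrow>
      dist (fun_int M f (map (\<lambda>n. h n \<omega>) ns)) (h m \<omega>) = dist (fun_int M f (map d ns)) (d m)"
    proof (cases "length ns = fun_ar M f")
      case True
      define l where "l = length ns"
      \<comment> \<open>The arguments occupy the variables below \<open>l\<close>;
        \<open>Var l\<close> is the first free one and receives \<open>d m\<close>.\<close>
      have wf: "wf_fml M (Dst (Fn f (map Var [0..<l])) (Var l))" using True by (auto simp: l_def)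
      have e: "map (\<lambda>i. q (if i < l then ns ! i else m)) [0..<l] = map q ns" for q :: "nat \<Rightarrow> 'm"
        by (rule nth_equalityI) (auto simp: l_def)
      from const[OF wf, of "\<lambda>i. if i < l then ns ! i else m"] show ?thesis
        by (simp add: comp_def e[of "\<lambda>n. h n _"] e[of d] del: map_eq_conv)
    qed simp
  qed
  have surj: "AE \<omega> in \<Omega>. \<forall>n. \<exists>z. \<forall>m. dist (d n) (h m \<omega>) = dist z (d m)"
    unfolding AE_all_countable
  proof
    fix n
    \<comment> \<open>A preimage \<open>X\<close> of the constant \<open>d n\<close> supplies the
      required point \<open>z\<close>, namely \<open>rep X (tinv t \<omega>)\<close>.\<close>
    have "aecls L0M (\<lambda>_. d n) \<in> \<Phi> ` MainC" using bij MainC_I[OF c] by (simp add: bij_betw_def)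
    then obtain X where X: "X \<in> MainC" "\<Phi> X = aecls L0M (\<lambda>_. d n)" by auto
    have "AE \<omega> in \<Omega>. rep (\<Phi> X) \<omega> = d n" unfolding X(2) by (rule rep_Main[OF c])
    moreover have "AE \<omega> in \<Omega>. \<forall>m. dist (rep (\<Phi> X) \<omega>) (h m \<omega>) = dist (rep X (tinv t \<omega>)) (d m)"
      using dist_h[OF MainC_rep(1)[OF X(1)]] MainC_rep(2)[OF X(1)] by simp
    ultimately show "AE \<omega> in \<Omega>. \<exists>z. \<forall>m. dist (d n) (h m \<omega>) = dist z (d m)"
      by eventually_elim auto
  qed
  have "AE \<omega> in \<Omega>. \<exists>G\<in>autM M. \<forall>n. G (d n) = h n \<omega>"
    using iso pred func surj
  proof eventually_elim
    case (elim \<omega>)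
    from automorphism_extension[OF ms d, where k = "\<lambda>n. h n \<omega>"] elim show ?case by metis
  qed
  then obtain N where N: "\<And>\<omega>. \<omega> \<in> space \<Omega> - N \<Longrightarrow> \<exists>G\<in>autM M. \<forall>n. G (d n) = h n \<omega>" "N \<in> null_sets \<Omega>"
    by (rule AE_E3) blast
  then obtain G where G: "\<And>\<omega>. \<omega> \<in> space \<Omega> - N \<Longrightarrow> G \<omega> \<in> autM M \<and> (\<forall>n. G \<omega> (d n) = h n \<omega>)"
    by metis
  \<comment> \<open>\<open>G\<close> is an arbitrary choice; measurability will come from its values
    at \<open>d n\<close>, which off \<open>N\<close> are those of the measurable
    \<open>h n\<close>. The identity on \<open>N\<close> makes every \<open>g \<omega>\<close> an
    automorphism, as \<open>L0G\<close> demands.\<close>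
  define g where "g \<omega> = (if \<omega> \<in> N then (\<lambda>x. x) else G \<omega>)" for \<omega>
  have g: "g \<in> L0G M"
  proof (rule L0G_I[OF d])
    fix n
    have "(\<lambda>\<omega>. if \<omega> \<in> N then d n else h n \<omega>) \<in> borel_measurable \<Omega>"
      using null_setsD2[OF N(2)] by (intro measurable_If_set c h sets.Int sets.top)
    then show "(\<lambda>\<omega>. g \<omega> (d n)) \<in> borel_measurable \<Omega>"
      by (rule measurable_cong[THEN iffD1, rotated]) (use G in \<open>auto simp: g_def\<close>)
  qed (use G in \<open>auto simp: g_def autM_id\<close>)
  have gd: "AE \<omega> in \<Omega>. \<forall>n. g \<omega> (d n) = h n \<omega>"
    using AE_not_in[OF N(2)] AE_space by eventually_elim (use G in \<open>auto simp: g_def\<close>)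
  show ?thesis
  proof (rule that[OF g])
    fix X :: "(real \<Rightarrow> 'm) set" assume X: "X \<in> MainC"
    have "AE \<omega> in \<Omega>. \<forall>m. dist (rep (\<Phi> X) \<omega>) (h m \<omega>) = dist (rep X (tinv t \<omega>)) (d m)"
      using dist_h[OF MainC_rep(1)[OF X]] MainC_rep(2)[OF X] by simp
    then have "AE \<omega> in \<Omega>. rep (\<Phi> X) \<omega> = g \<omega> (rep X (tinv t \<omega>))"
      using gd AE_space
    proof eventually_elim
      case (elim \<omega>)
      then have "g \<omega> \<in> autM M" using L0G_D(1)[OF g] by simp
      from eq_if_dist_eq_on_dense[OF autM_D(2)[OF this] d] elim show ?case by simp
    qed
    then have "aecls L0M (rep (\<Phi> X)) = fst (wr_act (g, t)) X"
      unfolding act_MainC(1)[OF g t X] using MainC_rep(1)[OF \<Phi>[OF X]]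
      by (simp add: aecls_eq_iff L0M_def aeq_def)
    then show "\<Phi> X = fst (wr_act (g, t)) X" using MainC_rep(2)[OF \<Phi>[OF X]] by simp
  qed
qed

lemma autMR_realized:
  fixes M :: "('f::countable, 'p::countable, 'm::polish_space) mstruct"
  assumes ms: "metric_structure M" and a: "a \<in> autMR M"
  shows "\<exists>g\<in>L0G M. \<exists>t\<in>autOmega. autR_eq a (wr_act (g, t))"
proof -
  obtain \<Phi> \<Psi> where a_eq: "a = (\<Phi>, \<Psi>)" by fastforce
  note A = a[unfolded a_eq autMR_def mem_Collect_eq case_prod_conv]
  obtain T where T: "T \<in> L0A" "mp T" "\<And>R. R \<in> L0A \<Longrightarrow> \<Psi> (aecls L0A R) = aecls L0A (\<lambda>\<omega>. R (T \<omega>))"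
    by (rule aux_automorphism_realized[of \<Psi>]) (use A in blast)+
  have bij: "bij_betw \<Psi> AuxC AuxC" using A by blast
  obtain t where t: "t \<in> autOmega" "\<And>R. R \<in> L0A \<Longrightarrow> \<Psi> (aecls L0A R) = aecls L0A (\<lambda>\<omega>. R (tinv t \<omega>))"
    by (rule aux_automorphism_autOmega[OF bij T]) blast+
  obtain g where g: "g \<in> L0G M" "\<And>X. X \<in> MainC \<Longrightarrow> \<Phi> X = fst (wr_act (g, t)) X"
    by (rule main_automorphism_realized[OF ms t(1), of \<Phi> \<Psi>]) (use A t(2) in blast)+
  have "\<Psi> X = snd (wr_act (g, t)) X" if "X \<in> AuxC" for X
    using t(2)[OF AuxC_rep(1)[OF that]] AuxC_rep(2)[OF that] act_AuxC(1)[OF t(1) that, of g] by simp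
  then have "autR_eq a (wr_act (g, t))" using g(2) by (simp add: autR_eq_def a_eq)
  then show ?thesis using g(1) t(1) by blast
qed

subsection \<open>Topologies\<close>

text \<open>The common form of the limits along an arbitrary filter: approximation at precision
  \<open>e\<close> leaves finitely many terms known to converge, whose sum is \<open>b\<close>, and
  an error \<open>e\<close> uniform in the index.\<close>

lemma tendsto_0_up_to_epsilon:
  fixes f :: "'i \<Rightarrow> real"
  assumes nn: "\<And>i. 0 \<le> f i" and bound: "\<And>e. e > 0 \<Longrightarrow> \<exists>b. (b \<longlongrightarrow> 0) F \<and> (\<forall>i. f i \<le> b i + e)"
  shows "(f \<longlongrightarrow> 0) F"
proof (rule tendstoI)
  fix e :: real assume e: "e > 0"
  obtain b where b: "(b \<longlongrightarrow> 0) F" "\<And>i. f i \<le> b i + e / 2" using bound[of "e / 2"] e by auto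
  have "\<forall>\<^sub>F i in F. b i < e / 2" using b(1) e by (intro order_tendstoD(2)) auto
  then show "\<forall>\<^sub>F i in F. dist (f i) 0 < e"
  proof eventually_elim
    case (elim i)
    then show ?case using b(2)[of i] nn[of i] by (simp add: dist_real_def)
  qed
qed

lemma measure_decseq_small:
  assumes "\<And>n. A n \<in> sets \<Omega>" "decseq A" "(\<Inter>n. A n) = {}" "e > 0"
  obtains n :: nat where "measure \<Omega> (A n) < e"
proof -
  have "(\<lambda>n. measure \<Omega> (A n)) \<longlonglongrightarrow> measure \<Omega> (\<Inter>n. A n)"
    using assms(1,2) by (intro Om.finite_Lim_measure_decseq) auto
  then have "\<forall>\<^sub>F n in sequentially. measure \<Omega> (A n) < e"
    using assms(3,4) by (intro order_tendstoD(2)) auto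
  then show ?thesis using that by (auto simp: eventually_sequentially)
qed

text \<open>\<open>K \<omega>\<close> is the first index of a dense point within \<open>e\<close> of
  \<open>r \<omega>\<close>; taking the least index makes \<open>K\<close> measurable. The error is
  below \<open>e\<close> everywhere, and outside a set of measure below \<open>e\<close> only
  \<open>N\<close> values occur.\<close>

lemma countable_approximation:
  fixes r :: "real \<Rightarrow> 'a::{metric_space, second_countable_topology}"
  assumes r: "r \<in> borel_measurable \<Omega>" and d: "\<And>x e. e > 0 \<Longrightarrow> \<exists>n. dist (d n) x < e" and e: "e > 0"
  obtains K :: "real \<Rightarrow> nat" and N :: nat where "K \<in> measurable \<Omega> (count_space UNIV)"
    "\<And>\<omega>. dist (d (K \<omega>)) (r \<omega>) < e" "measure \<Omega> {\<omega> \<in> space \<Omega>. N \<le> K \<omega>} < e"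
proof -
  define K where "K \<omega> = (LEAST k. dist (d k) (r \<omega>) < e)" for \<omega>
  have [measurable]: "(\<lambda>\<omega>. dist (d k) (r \<omega>)) \<in> borel_measurable \<Omega>" for k
    by (rule borel_measurable_dist[OF _ r]) simp
  have K: "K \<in> measurable \<Omega> (count_space UNIV)"
    unfolding K_def[abs_def] by measurable
  have close: "dist (d (K \<omega>)) (r \<omega>) < e" for \<omega>
    unfolding K_def using LeastI_ex[OF d[OF e]] .
  obtain N where N: "measure \<Omega> {\<omega> \<in> space \<Omega>. N \<le> K \<omega>} < e"
  proof (rule measure_decseq_small[OF _ _ _ e, of "\<lambda>N. {\<omega> \<in> space \<Omega>. N \<le> K \<omega>}"])
    show "{\<omega> \<in> space \<Omega>. N \<le> K \<omega>} \<in> sets \<Omega>" for N using K by measurable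
    show "decseq (\<lambda>N. {\<omega> \<in> space \<Omega>. N \<le> K \<omega>})" by (auto simp: decseq_def)
    show "(\<Inter>N. {\<omega> \<in> space \<Omega>. N \<le> K \<omega>}) = {}" by auto (metis Suc_n_not_le_n)
  qed
  show ?thesis by (rule that[OF K close N])
qed

lemma measure_Omega_unit: "measure \<Omega> {0..1} = 1"
  using Om.prob_space by simp

lemma indicator_Omega:
  assumes "A \<in> sets \<Omega>"
  shows "integrable \<Omega> (indicator A :: real \<Rightarrow> real)" "(\<integral>\<omega>. indicator A \<omega> \<partial>\<Omega>) = measure \<Omega> A"
  using sets.Int_space_eq2[OF assms] assms by (simp_all add: integrable_indicator_iff less_top[symmetric] del: space_Omega)

section \<open>Convergence of measure-preserving maps and its action on random elements\<close>

lemma convOmega_iff: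
  "convOmega F ts t \<longleftrightarrow> (\<forall>A\<in>sets \<Omega>. ((\<lambda>i. measure \<Omega> {\<omega> \<in> space \<Omega>. (ts i \<omega> \<in> A) \<noteq> (t \<omega> \<in> A)}) \<longlongrightarrow> 0) F)"
proof -
  have "((u -` A \<inter> space \<Omega>) - (t -` A \<inter> space \<Omega>)) \<union> ((t -` A \<inter> space \<Omega>) - (u -` A \<inter> space \<Omega>))
      = {\<omega> \<in> space \<Omega>. (u \<omega> \<in> A) \<noteq> (t \<omega> \<in> A)}" for u and A :: "real set" by auto
  then show ?thesis unfolding convOmega_def by simp
qed

lemma sets_symdiff:
  assumes "t \<in> measurable \<Omega> \<Omega>" "u \<in> measurable \<Omega> \<Omega>" "A \<in> sets \<Omega>"
  shows "{\<omega> \<in> space \<Omega>. (u \<omega> \<in> A) \<noteq> (t \<omega> \<in> A)} \<in> sets \<Omega>"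
proof -
  have "{\<omega> \<in> space \<Omega>. (u \<omega> \<in> A) \<noteq> (t \<omega> \<in> A)}
      = ((u -` A \<inter> space \<Omega>) - (t -` A \<inter> space \<Omega>)) \<union> ((t -` A \<inter> space \<Omega>) - (u -` A \<inter> space \<Omega>))" by auto
  then show ?thesis using assms by (auto intro!: sets.Un sets.Diff measurable_sets simp del: space_Omega)
qed

text \<open>Pull the left-hand set back along \<open>t'\<close>: there
  \<open>s' (t' \<omega>)\<close> is \<open>\<omega>\<close>, and \<open>\<omega>\<close> lies in
  \<open>A\<close> iff \<open>t \<omega>\<close> lies in the preimage of \<open>A\<close> under
  \<open>s\<close>. So inversion is continuous, which matters because \<open>convOmega\<close>
  speaks of \<open>t\<close> and the action uses \<open>tinv t\<close>.\<close>

lemma symdiff_inverse: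
  assumes mp: "mp t" "mp t'" "mp s" "mp s'" and A: "A \<in> sets \<Omega>"
    and inv: "AE \<omega> in \<Omega>. s (t \<omega>) = \<omega>" "AE \<omega> in \<Omega>. s' (t' \<omega>) = \<omega>"
  shows "measure \<Omega> {\<omega> \<in> space \<Omega>. (s' \<omega> \<in> A) \<noteq> (s \<omega> \<in> A)}
    = measure \<Omega> {\<omega> \<in> space \<Omega>. (t' \<omega> \<in> s -` A \<inter> space \<Omega>) \<noteq> (t \<omega> \<in> s -` A \<inter> space \<Omega>)}"
proof -
  let ?E = "{\<omega> \<in> space \<Omega>. (s' \<omega> \<in> A) \<noteq> (s \<omega> \<in> A)}"
  note m = mp_measurable[OF mp(1)] mp_measurable[OF mp(2)] mp_measurable[OF mp(3)] mp_measurable[OF mp(4)]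
  have E: "?E \<in> sets \<Omega>" by (rule sets_symdiff[OF m(3,4) A])
  have B: "s -` A \<inter> space \<Omega> \<in> sets \<Omega>" by (rule measurable_sets[OF m(3) A])
  have "measure \<Omega> ?E = measure (distr \<Omega> \<Omega> t') ?E" using mp(2) by (simp add: mp_def)
  also have "\<dots> = measure \<Omega> (t' -` ?E \<inter> space \<Omega>)" by (rule measure_distr[OF m(2) E])
  also have "\<dots> = measure \<Omega> {\<omega> \<in> space \<Omega>. (t' \<omega> \<in> s -` A \<inter> space \<Omega>) \<noteq> (t \<omega> \<in> s -` A \<inter> space \<Omega>)}"
  proof (rule Om.finite_measure_eq_AE)
    show "AE \<omega> in \<Omega>. (\<omega> \<in> t' -` ?E \<inter> space \<Omega>) =
        (\<omega> \<in> {\<omega> \<in> space \<Omega>. (t' \<omega> \<in> s -` A \<inter> space \<Omega>) \<noteq> (t \<omega> \<in> s -` A \<inter> space \<Omega>)})"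
      using inv AE_space
    proof eventually_elim
      case (elim \<omega>)
      then show ?case using measurable_space[OF m(1)] measurable_space[OF m(2)] by auto
    qed
  qed (rule measurable_sets[OF m(2) E] sets_symdiff[OF m(1,2) B])+
  finally show ?thesis .
qed

lemma convOmega_inverse:
  assumes "\<And>i. mp (ts i)" "mp t" "\<And>i. mp (ss i)" "mp s"
    and "\<And>i. AE \<omega> in \<Omega>. ss i (ts i \<omega>) = \<omega>" "AE \<omega> in \<Omega>. s (t \<omega>) = \<omega>" and "convOmega F ts t"
  shows "convOmega F ss s"
  unfolding convOmega_iff
proof
  fix A assume A: "A \<in> sets \<Omega>"
  have "s -` A \<inter> space \<Omega> \<in> sets \<Omega>" by (rule measurable_sets[OF mp_measurable[OF assms(4)] A])
  then have "((\<lambda>i. measure \<Omega> {\<omega> \<in> space \<Omega>. (ts i \<omega> \<in> s -` A \<inter> space \<Omega>) \<noteq> (t \<omega> \<in> s -` A \<inter> space \<Omega>)}) \<longlongrightarrow> 0) F"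
    using assms(7) unfolding convOmega_iff by blast
  then show "((\<lambda>i. measure \<Omega> {\<omega> \<in> space \<Omega>. (ss i \<omega> \<in> A) \<noteq> (s \<omega> \<in> A)}) \<longlongrightarrow> 0) F"
    by (simp only: symdiff_inverse[OF assms(2,1,4,3) A assms(6,5)])
qed

lemma convOmega_tinv_iff:
  assumes "\<And>i. ts i \<in> autOmega" "t \<in> autOmega"
  shows "convOmega F (\<lambda>i. tinv (ts i)) (tinv t) \<longleftrightarrow> convOmega F ts t"
proof
  note a = autOmega_mp[OF assms(1)] autOmega_mp[OF assms(2)] tinv_spec(1)[OF assms(1)] tinv_spec(1)[OF assms(2)]
  show "convOmega F (\<lambda>i. tinv (ts i)) (tinv t)" if "convOmega F ts t"
    by (rule convOmega_inverse[OF a _ _ that]) (rule tinv_spec(2)[OF assms(1)] tinv_spec(2)[OF assms(2)])+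
  show "convOmega F ts t" if "convOmega F (\<lambda>i. tinv (ts i)) (tinv t)"
    by (rule convOmega_inverse[OF a(3,4,1,2) _ _ that]) (rule tinv_spec(3)[OF assms(1)] tinv_spec(3)[OF assms(2)])+
qed

text \<open>Replace \<open>r\<close> by the point \<open>d (K \<omega>)\<close>. Where
  \<open>K\<close> takes the same value at both arguments, the distance is at most 2e/3. Elsewhere
  it is at most 1, and \<open>\<omega>\<close> lies either in the small set \<open>B\<close> or in
  the symmetric difference \<open>D i k\<close> for the level
  \<open>k = K (t \<omega>) < N\<close>.\<close>

lemma convOmega_comp:
  fixes r :: "real \<Rightarrow> 'a::{metric_space, second_countable_topology}"
  assumes conv: "convOmega F ts t" and mp: "\<And>i. mp (ts i)" "mp t"
    and r: "r \<in> borel_measurable \<Omega>" and bd: "\<And>\<omega> \<omega>'. \<omega> \<in> {0..1} \<Longrightarrow> \<omega>' \<in> {0..1} \<Longrightarrow> dist (r \<omega>) (r \<omega>') \<le> 1"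
  shows "((\<lambda>i. \<integral>\<omega>. dist (r (ts i \<omega>)) (r (t \<omega>)) \<partial>\<Omega>) \<longlongrightarrow> 0) F"
proof (rule tendsto_0_up_to_epsilon)
  fix e :: real assume e: "e > 0"
  obtain d :: "nat \<Rightarrow> 'a" where d: "\<And>x e. e > 0 \<Longrightarrow> \<exists>n. dist (d n) x < e"
    by (rule dense_sequence) blast
  have "e / 3 > 0" using e by simp
  from countable_approximation[OF r d this]
  obtain K :: "real \<Rightarrow> nat" and N where K: "K \<in> measurable \<Omega> (count_space UNIV)"
    and close: "\<And>\<omega>. dist (d (K \<omega>)) (r \<omega>) < e / 3" and N: "measure \<Omega> {\<omega> \<in> space \<Omega>. N \<le> K \<omega>} < e / 3"
    by blast
  define A where "A k = {\<omega> \<in> space \<Omega>. K \<omega> = k}" for k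
  have A: "A k \<in> sets \<Omega>" for k unfolding A_def using K by measurable
  \<comment> \<open>Cutting off at the limit map \<open>t\<close> keeps this error set independent
    of \<open>i\<close>; its measure is that of \<open>N \<le> K\<close> because \<open>t\<close>
    preserves measure.\<close>
  define B where "B = {\<omega> \<in> space \<Omega>. N \<le> K (t \<omega>)}"
  define D where "D i k = {\<omega> \<in> space \<Omega>. (ts i \<omega> \<in> A k) \<noteq> (t \<omega> \<in> A k)}" for i k
  note mt = mp_measurable[OF mp(2)] and mts = mp_measurable[OF mp(1)]
  have N': "{\<omega> \<in> space \<Omega>. N \<le> K \<omega>} \<in> sets \<Omega>" using K by measurable
  have B_eq: "B = t -` {\<omega> \<in> space \<Omega>. N \<le> K \<omega>} \<inter> space \<Omega>"
    unfolding B_def using measurable_space[OF mt] by blast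
  have B: "B \<in> sets \<Omega>" unfolding B_eq by (rule measurable_sets[OF mt N'])
  have "measure \<Omega> B = measure (distr \<Omega> \<Omega> t) {\<omega> \<in> space \<Omega>. N \<le> K \<omega>}"
    unfolding B_eq by (rule measure_distr[OF mt N', symmetric])
  then have B_small: "measure \<Omega> B < e / 3" using N mp(2) by (simp add: mp_def)
  have D: "D i k \<in> sets \<Omega>" for i k unfolding D_def by (rule sets_symdiff[OF mt mts A])
  have "(\<integral>\<omega>. dist (r (ts i \<omega>)) (r (t \<omega>)) \<partial>\<Omega>) \<le> (\<Sum>k<N. measure \<Omega> (D i k)) + e" for i
  proof -
    have "(\<integral>\<omega>. dist (r (ts i \<omega>)) (r (t \<omega>)) \<partial>\<Omega>)
        \<le> (\<integral>\<omega>. ((\<Sum>k<N. indicator (D i k) \<omega>) + indicator B \<omega>) + 2 * (e / 3) \<partial>\<Omega>)"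
    proof (rule integral_mono)
      show "integrable \<Omega> (\<lambda>\<omega>. dist (r (ts i \<omega>)) (r (t \<omega>)))"
        using bd measurable_space[OF mt] measurable_space[OF mts[of i]]
        by (intro integrable_bounded[of _ 1] borel_measurable_dist
            measurable_compose[OF mts r] measurable_compose[OF mt r]) auto
      show "integrable \<Omega> (\<lambda>\<omega>. ((\<Sum>k<N. indicator (D i k) \<omega>) + indicator B \<omega>) + 2 * (e / 3))"
        by (intro Bochner_Integration.integrable_add Bochner_Integration.integrable_sum
            indicator_Omega(1)[OF B] indicator_Omega(1)[OF D]) simp
      fix \<omega> assume w: "\<omega> \<in> space \<Omega>"
      have tw: "ts i \<omega> \<in> {0..1}" "t \<omega> \<in> {0..1}"
        using measurable_space[OF mts[of i] w] measurable_space[OF mt w] by auto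
      have nn: "0 \<le> (\<Sum>k<N. indicator (D i k) \<omega> :: real)" by (intro sum_nonneg) simp
      show "dist (r (ts i \<omega>)) (r (t \<omega>)) \<le> ((\<Sum>k<N. indicator (D i k) \<omega>) + indicator B \<omega>) + 2 * (e / 3)"
      proof (cases "K (ts i \<omega>) = K (t \<omega>)")
        case True
        have "dist (r (ts i \<omega>)) (r (t \<omega>)) \<le> dist (d (K (ts i \<omega>))) (r (ts i \<omega>)) + dist (d (K (t \<omega>))) (r (t \<omega>))"
          unfolding True by (metis dist_commute dist_triangle2)
        also have "\<dots> \<le> 2 * (e / 3)" using close[of "ts i \<omega>"] close[of "t \<omega>"] by simp
        finally show ?thesis using nn by (simp add: add_increasing)
      next
        case ne: False
        have "1 \<le> (\<Sum>k<N. indicator (D i k) \<omega> :: real) + indicator B \<omega>"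
        proof (cases "K (t \<omega>) < N")
          case True
          have "\<omega> \<in> D i (K (t \<omega>))" using ne tw w by (auto simp: D_def A_def)
          then have "1 = (indicator (D i (K (t \<omega>))) \<omega> :: real)" by simp
          also have "\<dots> \<le> (\<Sum>k<N. indicator (D i k) \<omega>)" using True by (intro member_le_sum) auto
          finally show ?thesis by (rule order_trans) simp
        next
          case False
          then have "\<omega> \<in> B" using w by (simp add: B_def)
          then show ?thesis using nn by simp
        qed
        then show ?thesis using bd[OF tw] e by linarith
      qed
    qed
    also have "\<dots> = (\<Sum>k<N. measure \<Omega> (D i k)) + measure \<Omega> B + 2 * (e / 3)"
      using indicator_Omega[OF B] indicator_Omega[OF D] by (simp add: measure_Omega_unit)
    finally show ?thesis using B_small by simp
  qed
  moreover have "((\<lambda>i. \<Sum>k<N. measure \<Omega> (D i k)) \<longlongrightarrow> 0) F"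
    using conv A unfolding convOmega_iff D_def by (intro tendsto_null_sum) auto
  ultimately show "\<exists>b. (b \<longlongrightarrow> 0) F \<and> (\<forall>i. (\<integral>\<omega>. dist (r (ts i \<omega>)) (r (t \<omega>)) \<partial>\<Omega>) \<le> b i + e)" by blast
qed simp

lemma indicator_L0A: "A \<in> sets \<Omega> \<Longrightarrow> indicator A \<in> L0A"
  by (auto simp: L0A_def indicator_def)

text \<open>On classes of indicators, the distance \<open>dAux\<close> between the two images is the
  measure of a symmetric difference; general classes follow by
  \<open>convOmega_comp\<close>.\<close>

lemma convOmega_tinv_iff_aux:
  assumes "\<And>i. ts i \<in> autOmega" "t \<in> autOmega"
  shows "convOmega F ts t \<longleftrightarrow>
    (\<forall>X\<in>AuxC. ((\<lambda>i. dAux (snd (wr_act (gs i, ts i)) X) (snd (wr_act (g, t)) X)) \<longlongrightarrow> 0) F)"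
proof
  assume "convOmega F ts t"
  then have conv: "convOmega F (\<lambda>i. tinv (ts i)) (tinv t)" using convOmega_tinv_iff[of ts t F, OF assms] by simp
  show "\<forall>X\<in>AuxC. ((\<lambda>i. dAux (snd (wr_act (gs i, ts i)) X) (snd (wr_act (g, t)) X)) \<longlongrightarrow> 0) F"
  proof
    fix X assume X: "X \<in> AuxC"
    note R = AuxC_rep(1)[OF X]
    have "((\<lambda>i. \<integral>\<omega>. dist (rep X (tinv (ts i) \<omega>)) (rep X (tinv t \<omega>)) \<partial>\<Omega>) \<longlongrightarrow> 0) F"
    proof (rule convOmega_comp[OF conv tinv_spec(1)[OF assms(1)] tinv_spec(1)[OF assms(2)] L0A_measurable[OF R]])
      fix \<omega> \<omega>' :: real assume "\<omega> \<in> {0..1}" "\<omega>' \<in> {0..1}"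
      then have "rep X \<omega> \<in> {0..1}" "rep X \<omega>' \<in> {0..1}" using R by (auto simp: L0A_def)
      then show "dist (rep X \<omega>) (rep X \<omega>') \<le> 1" by (auto simp: dist_real_def)
    qed
    then show "((\<lambda>i. dAux (snd (wr_act (gs i, ts i)) X) (snd (wr_act (g, t)) X)) \<longlongrightarrow> 0) F"
      by (simp add: act_AuxC(1)[OF assms(1) X] act_AuxC(1)[OF assms(2) X]
          dAux_aecls[OF tinv_L0A[OF assms(1) R] tinv_L0A[OF assms(2) R]] dist_real_def)
  qed
next
  assume *: "\<forall>X\<in>AuxC. ((\<lambda>i. dAux (snd (wr_act (gs i, ts i)) X) (snd (wr_act (g, t)) X)) \<longlongrightarrow> 0) F"
  have "convOmega F (\<lambda>i. tinv (ts i)) (tinv t)"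
    unfolding convOmega_iff
  proof
    fix A assume A: "A \<in> sets \<Omega>"
    note R = indicator_L0A[OF A]
    have "dAux (snd (wr_act (gs i, ts i)) (aecls L0A (indicator A))) (snd (wr_act (g, t)) (aecls L0A (indicator A)))
        = measure \<Omega> {\<omega> \<in> space \<Omega>. (tinv (ts i) \<omega> \<in> A) \<noteq> (tinv t \<omega> \<in> A)}" for i
    proof -
      let ?E = "{\<omega> \<in> space \<Omega>. (tinv (ts i) \<omega> \<in> A) \<noteq> (tinv t \<omega> \<in> A)}"
      have E: "?E \<in> sets \<Omega>"
        by (rule sets_symdiff[OF mp_measurable[OF tinv_spec(1)[OF assms(2)]] mp_measurable[OF tinv_spec(1)[OF assms(1)]] A])
      have "(\<integral>\<omega>. \<bar>indicator A (tinv (ts i) \<omega>) - indicator A (tinv t \<omega>)\<bar> \<partial>\<Omega>) = (\<integral>\<omega>. indicator ?E \<omega> \<partial>\<Omega> :: real)"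
        by (rule Bochner_Integration.integral_cong) (auto simp: indicator_def)
      also have "\<dots> = measure \<Omega> ?E" by (rule indicator_Omega(2)[OF E])
      finally show ?thesis
        by (simp only: act_Aux[OF assms(1) R] act_Aux[OF assms(2) R] dAux_aecls[OF tinv_L0A[OF assms(1) R] tinv_L0A[OF assms(2) R]])
    qed
    then show "((\<lambda>i. measure \<Omega> {\<omega> \<in> space \<Omega>. (tinv (ts i) \<omega> \<in> A) \<noteq> (tinv t \<omega> \<in> A)}) \<longlongrightarrow> 0) F"
      using * AuxC_I[OF R] by fastforce
  qed
  then show "convOmega F ts t" using convOmega_tinv_iff[of ts t F, OF assms] by simp
qed

section \<open>Convergence in measure of automorphism-valued maps\<close>

lemma dist_coordinate_le_dist_fun:
  fixes v w :: "nat \<Rightarrow> 'a::metric_space"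
  assumes "dist (v n) (w n) \<le> 1"
  shows "dist (v n) (w n) \<le> 2 ^ to_nat n * dist v w"
proof -
  have *: "summable (\<lambda>n. (1/2)^n * min (dist (v (from_nat n)) (w (from_nat n))) 1)"
    by (rule summable_comparison_test'[of "\<lambda>n. (1/2)^n"]) (auto simp: summable_geometric_iff)
  \<comment> \<open>A single term of the series that defines the product metric;
    \<open>to_nat n\<close> is the place of coordinate \<open>n\<close>, and the truncation at 1 has
    no effect by assumption.\<close>
  have "(1/2) ^ to_nat n * dist (v n) (w n) \<le> dist v w"
    unfolding dist_fun_def using sum_le_suminf[OF *, of "{to_nat n}"] assms by (auto simp: min_absorb1)
  then show ?thesis by (simp add: field_simps power_divide)
qed

text \<open>The product metric is at most twice the maximum over the first coordinates plus a tail
  \<open>(1/2) ^ N\<close>, whence the bounds r/4 and r/2. One number \<open>k\<close> governs both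
  the coordinates and the precision, so that the neighbourhoods form a single decreasing
  sequence.\<close>

lemma dist_fun_less_if_coordinates_less:
  assumes "r > 0"
  obtains k :: nat where "\<And>v w :: nat \<Rightarrow> 'a::metric_space. (\<forall>n<k. dist (v n) (w n) < 1 / Suc k) \<Longrightarrow> dist v w < r"
proof -
  obtain N where N: "(1/2) ^ N < r / 2" using real_arch_pow_inv[of "r/2" "1/2"] assms by auto
  obtain j where j: "1 / real (Suc j) < r / 4"
    using reals_Archimedean[of "r / 4"] assms by (auto simp: inverse_eq_divide)
  define k where "k = max j (Suc (Max (from_nat ` {..N})))"
  have "dist v w < r" if *: "\<forall>n<k. dist (v n) (w n) < 1 / Suc k" for v w :: "nat \<Rightarrow> 'a"
  proof -
    have "1 / real (Suc k) \<le> 1 / real (Suc j)" by (simp add: k_def frac_le)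
    then have k: "1 / real (Suc k) < r / 4" using j by linarith
    have "dist (v (from_nat n)) (w (from_nat n)) \<le> r / 4" if "n \<le> N" for n
    proof -
      have "from_nat n \<le> Max (from_nat ` {..N} :: nat set)" using that by (intro Max_ge) auto
      then have "from_nat n < k" by (simp add: k_def)
      then show ?thesis using * k by force
    qed
    then have "Max {dist (v (from_nat n)) (w (from_nat n)) | n. n \<le> N} \<le> r / 4"
      by (subst Max_le_iff) auto
    then show ?thesis using dist_fun_le_dist_first_terms[of v w N] N by linarith
  qed
  then show ?thesis by (rule that)
qed

lemma convG_imp_pointwise:
  fixes M :: "('f, 'p, 'm::polish_space) mstruct"
  assumes ms: "metric_structure M" and gs: "\<And>i. gs i \<in> L0G M" and g: "g \<in> L0G M"
    and d: "\<And>x e. e > 0 \<Longrightarrow> \<exists>n::nat. dist (d n) x < e" and conv: "convG M F gs g"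
  shows "((\<lambda>i. \<integral>\<omega>. dist (gs i \<omega> (d n)) (g \<omega> (d n)) \<partial>\<Omega>) \<longlongrightarrow> 0) F"
proof (rule tendsto_0_up_to_epsilon)
  have bd: "dist x y \<le> 1" for x y :: 'm using ms by (simp add: metric_structure_def)
  fix e :: real assume e: "e > 0"
  \<comment> \<open>Chosen so that the factor \<open>2 ^ to_nat n\<close> of coordinate
    \<open>n\<close> turns \<open>c\<close> into \<open>e\<close>.\<close>
  define c where "c = e / 2 ^ to_nat n"
  have c: "c > 0" using e by (simp add: c_def)
  define E where "E i = {\<omega> \<in> space \<Omega>. aut_dist d (gs i \<omega>) (g \<omega>) > c}" for i
  have E: "E i \<in> sets \<Omega>" for i
  proof -
    have "(\<lambda>\<omega>. aut_dist d (gs i \<omega>) (g \<omega>)) \<in> borel_measurable \<Omega>"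
      unfolding aut_dist_def
      by (intro borel_measurable_dist measurable_coordinatewise_then_product L0G_D(2)[OF gs] L0G_D(2)[OF g])
    then show ?thesis unfolding E_def by measurable
  qed
  have "((\<lambda>i. measure \<Omega> (E i)) \<longlongrightarrow> 0) F"
    using conv c compatible_metric_aut_dist[OF d, of M] unfolding convG_def E_def by blast
  moreover have "(\<integral>\<omega>. dist (gs i \<omega> (d n)) (g \<omega> (d n)) \<partial>\<Omega>) \<le> measure \<Omega> (E i) + e" for i
  proof -
    have "(\<integral>\<omega>. dist (gs i \<omega> (d n)) (g \<omega> (d n)) \<partial>\<Omega>) \<le> (\<integral>\<omega>. indicator (E i) \<omega> + e \<partial>\<Omega>)"
    proof (rule integral_mono)
      show "integrable \<Omega> (\<lambda>\<omega>. dist (gs i \<omega> (d n)) (g \<omega> (d n)))"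
        using bd by (intro integrable_bounded[of _ 1] borel_measurable_dist L0G_D(2)[OF gs] L0G_D(2)[OF g]) auto
      show "integrable \<Omega> (\<lambda>\<omega>. indicator (E i) \<omega> + e)"
        by (intro Bochner_Integration.integrable_add indicator_Omega(1)[OF E]) simp
      fix \<omega> assume w: "\<omega> \<in> space \<Omega>"
      show "dist (gs i \<omega> (d n)) (g \<omega> (d n)) \<le> indicator (E i) \<omega> + e"
      proof (cases "\<omega> \<in> E i")
        case True
        then show ?thesis using bd[of "gs i \<omega> (d n)" "g \<omega> (d n)"] e by simp
      next
        case False
        then have "aut_dist d (gs i \<omega>) (g \<omega>) \<le> c" using w by (auto simp: E_def)
        then have "2 ^ to_nat n * aut_dist d (gs i \<omega>) (g \<omega>) \<le> e" by (simp add: c_def field_simps)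
        moreover have "dist (gs i \<omega> (d n)) (g \<omega> (d n)) \<le> 2 ^ to_nat n * aut_dist d (gs i \<omega>) (g \<omega>)"
          unfolding aut_dist_def by (rule dist_coordinate_le_dist_fun) (rule bd)
        ultimately show ?thesis by (simp add: False)
      qed
    qed
    also have "\<dots> = measure \<Omega> (E i) + e"
      using indicator_Omega[OF E[of i]] by (simp add: measure_Omega_unit)
    finally show ?thesis .
  qed
  ultimately show "\<exists>b. (b \<longlongrightarrow> 0) F \<and> (\<forall>i. (\<integral>\<omega>. dist (gs i \<omega> (d n)) (g \<omega> (d n)) \<partial>\<Omega>) \<le> b i + e)" by blast
qed simp

text \<open>A compatible metric \<open>\<rho>\<close> need not be uniformly equivalent to
  \<open>aut_dist\<close>, so the size of neighbourhood that suffices depends on the automorphism.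
  Only the values of the limit \<open>g\<close> matter, and these do not depend on \<open>i\<close>:
  one \<open>k\<close> suffices outside a set of small measure. Markov's inequality at
  \<open>1 / Suc k\<close> then treats the first \<open>k\<close> coordinates.\<close>

lemma convG_if_pointwise:
  fixes M :: "('f, 'p, 'm::polish_space) mstruct"
  assumes ms: "metric_structure M" and gs: "\<And>i. gs i \<in> L0G M" and g: "g \<in> L0G M"
    and d: "\<And>x e. e > 0 \<Longrightarrow> \<exists>n::nat. dist (d n) x < e"
    and conv: "\<And>n. ((\<lambda>i. \<integral>\<omega>. dist (gs i \<omega> (d n)) (g \<omega> (d n)) \<partial>\<Omega>) \<longlongrightarrow> 0) F"
  shows "convG M F gs g"
  unfolding convG_def
proof (intro allI impI)
  have bd: "dist x y \<le> 1" for x y :: 'm using ms by (simp add: metric_structure_def)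
  fix \<rho> and e :: real assume comp: "compatible_metric (autM M) \<rho>" and e: "e > 0"
  interpret Q: Metric_space "autM M" \<rho> using comp by (simp add: compatible_metric_def)
  interpret A: Metric_space "autM M" "aut_dist d" by (rule Metric_space_aut_dist[OF d])
  have Q_top: "Q.mtopology = subtopology euclidean (autM M)" using comp by (simp add: compatible_metric_def)
  have A_top: "A.mtopology = subtopology euclidean (autM M)"
    using compatible_metric_aut_dist[OF d, of M] by (simp add: compatible_metric_def)
  define bad where "bad k = {h \<in> autM M. \<exists>f\<in>autM M. (\<forall>n<k. dist (f (d n)) (h (d n)) < 1 / Suc k) \<and> \<rho> f h > e}" for k
  have bad_sets: "{\<omega> \<in> space \<Omega>. g \<omega> \<in> bad k} \<in> sets \<Omega>" for k
  proof -
    \<comment> \<open>For fixed \<open>f\<close> the condition on \<open>h\<close> is open, as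
      \<open>h\<close> avoids a closed \<open>\<rho>\<close>-ball about \<open>f\<close>. Hence
      \<open>bad k\<close>, a union over possibly uncountably many \<open>f\<close>, is relatively
      open, and its preimage under \<open>g\<close> is measurable.\<close>
    have "openin (subtopology euclidean (autM M))
        ((autM M \<inter> {h. \<forall>n<k. dist (f (d n)) (h (d n)) < 1 / Suc k}) \<inter> (autM M - Q.mcball f e))" if "f \<in> autM M" for f
    proof (rule openin_Int)
      have "open (\<Inter>n\<in>{..<k}. {h :: 'm \<Rightarrow> 'm. dist (f (d n)) (h (d n)) < 1 / Suc k})"
        by (intro open_INT ballI open_Collect_less continuous_intros continuous_on_product_coordinates) simp
      also have "(\<Inter>n\<in>{..<k}. {h :: 'm \<Rightarrow> 'm. dist (f (d n)) (h (d n)) < 1 / Suc k})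
          = {h. \<forall>n<k. dist (f (d n)) (h (d n)) < 1 / Suc k}" by auto
      finally show "openin (subtopology euclidean (autM M)) (autM M \<inter> {h. \<forall>n<k. dist (f (d n)) (h (d n)) < 1 / Suc k})"
        by (simp add: openin_open_Int)
      show "openin (subtopology euclidean (autM M)) (autM M - Q.mcball f e)"
        unfolding Q_top[symmetric] using openin_diff[OF openin_topspace Q.closedin_mcball[of f e]] by simp
    qed
    then have "openin (subtopology euclidean (autM M)) (\<Union>f\<in>autM M.
        (autM M \<inter> {h. \<forall>n<k. dist (f (d n)) (h (d n)) < 1 / Suc k}) \<inter> (autM M - Q.mcball f e))"
      by blast
    also have "(\<Union>f\<in>autM M. (autM M \<inter> {h. \<forall>n<k. dist (f (d n)) (h (d n)) < 1 / Suc k}) \<inter> (autM M - Q.mcball f e)) = bad k"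
      by (auto simp: bad_def not_le)
    finally obtain W where W: "open W" "bad k = autM M \<inter> W" by (auto simp: openin_open)
    have "g -` W \<inter> space \<Omega> \<in> sets \<Omega>" using g W(1) by (intro measurable_sets[of g \<Omega> borel]) (auto simp: L0G_def)
    also have "g -` W \<inter> space \<Omega> = {\<omega> \<in> space \<Omega>. g \<omega> \<in> bad k}" using W(2) L0G_D(1)[OF g] by auto
    finally show ?thesis .
  qed
  have bad_mono: "bad k' \<subseteq> bad k" if "k \<le> k'" for k k'
  proof -
    have "1 / real (Suc k') \<le> 1 / real (Suc k)" using that by (simp add: frac_le)
    then have "\<forall>n<k. dist (f (d n)) (h (d n)) < 1 / Suc k" if "\<forall>n<k'. dist (f (d n)) (h (d n)) < 1 / Suc k'" for f h
      using that \<open>k \<le> k'\<close> by (meson less_le_trans)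
    then show ?thesis unfolding bad_def by blast
  qed
  have bad_empty: "\<exists>k. h \<notin> bad k" if h: "h \<in> autM M" for h
  proof -
    have "openin A.mtopology (Q.mball h e)" unfolding A_top Q_top[symmetric] by (rule Q.openin_mball)
    moreover have "h \<in> Q.mball h e" using h e by simp
    ultimately obtain r where r: "r > 0" "A.mball h r \<subseteq> Q.mball h e" by (auto simp: A.openin_mtopology)
    obtain k where k: "\<And>v w :: nat \<Rightarrow> 'm. (\<forall>n<k. dist (v n) (w n) < 1 / Suc k) \<Longrightarrow> dist v w < r"
      using dist_fun_less_if_coordinates_less[OF r(1)] by blast
    have "\<rho> f h \<le> e" if f: "f \<in> autM M" "\<forall>n<k. dist (f (d n)) (h (d n)) < 1 / Suc k" for f
    proof -
      have "aut_dist d h f < r"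
        using k[of "\<lambda>n. f (d n)" "\<lambda>n. h (d n)"] f(2) by (simp add: aut_dist_def dist_commute)
      then have "f \<in> Q.mball h e" using r(2) f(1) h by auto
      then show ?thesis using Q.commute[of h f] by simp
    qed
    then have "h \<notin> bad k" unfolding bad_def mem_Collect_eq by (meson not_le)
    then show ?thesis ..
  qed
  show "((\<lambda>i. measure \<Omega> {\<omega> \<in> space \<Omega>. e < \<rho> (gs i \<omega>) (g \<omega>)}) \<longlongrightarrow> 0) F"
  proof (rule tendsto_0_up_to_epsilon)
    fix \<epsilon> :: real assume \<epsilon>: "\<epsilon> > 0"
    obtain k where k: "measure \<Omega> {\<omega> \<in> space \<Omega>. g \<omega> \<in> bad k} < \<epsilon>"
    proof (rule measure_decseq_small[OF bad_sets _ _ \<epsilon>])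
      show "decseq (\<lambda>k. {\<omega> \<in> space \<Omega>. g \<omega> \<in> bad k})" using bad_mono by (auto simp: decseq_def)
      show "(\<Inter>k. {\<omega> \<in> space \<Omega>. g \<omega> \<in> bad k}) = {}" using bad_empty L0G_D(1)[OF g] by auto
    qed
    define E where "E i n = {\<omega> \<in> space \<Omega>. dist (gs i \<omega> (d n)) (g \<omega> (d n)) \<ge> 1 / Suc k}" for i n
    have m: "(\<lambda>\<omega>. dist (gs i \<omega> (d n)) (g \<omega> (d n))) \<in> borel_measurable \<Omega>" for i n
      by (intro borel_measurable_dist L0G_D(2)[OF gs] L0G_D(2)[OF g])
    have E: "E i n \<in> sets \<Omega>" for i n unfolding E_def using m[of i n] by measurable
    have "measure \<Omega> (E i n) \<le> Suc k * (\<integral>\<omega>. dist (gs i \<omega> (d n)) (g \<omega> (d n)) \<partial>\<Omega>)" for i n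
    proof -
      have "integrable \<Omega> (\<lambda>\<omega>. dist (gs i \<omega> (d n)) (g \<omega> (d n)))"
        using bd by (intro integrable_bounded[of _ 1] m) auto
      from integral_Markov_inequality_measure[OF this sets.top, of "1 / Suc k"]
      show ?thesis unfolding E_def by (simp add: mult.commute)
    qed
    note Markov = this
    have "measure \<Omega> {\<omega> \<in> space \<Omega>. e < \<rho> (gs i \<omega>) (g \<omega>)}
        \<le> (\<Sum>n<k. Suc k * (\<integral>\<omega>. dist (gs i \<omega> (d n)) (g \<omega> (d n)) \<partial>\<Omega>)) + \<epsilon>" for i
    proof -
      have "\<omega> \<in> (\<Union>n\<in>{..<k}. E i n) \<union> {\<omega> \<in> space \<Omega>. g \<omega> \<in> bad k}"
        if w: "\<omega> \<in> space \<Omega>" "e < \<rho> (gs i \<omega>) (g \<omega>)" for \<omega>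
      proof (cases "\<exists>n<k. \<omega> \<in> E i n")
        case False
        then have "\<forall>n<k. dist (gs i \<omega> (d n)) (g \<omega> (d n)) < 1 / Suc k"
          using w(1) unfolding E_def mem_Collect_eq by (meson not_le)
        moreover have "gs i \<omega> \<in> autM M" "g \<omega> \<in> autM M"
          using w(1) L0G_D(1)[OF gs[of i]] L0G_D(1)[OF g] by simp_all
        ultimately have "g \<omega> \<in> bad k" using w(2) unfolding bad_def by blast
        then show ?thesis using w(1) by blast
      qed blast
      \<comment> \<open>Monotonicity asks for measurability of the larger set, which is built from
        coordinates and \<open>bad k\<close>; the smaller one involves the arbitrary metric
        \<open>\<rho>\<close>.\<close>
      then have "measure \<Omega> {\<omega> \<in> space \<Omega>. e < \<rho> (gs i \<omega>) (g \<omega>)}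
          \<le> measure \<Omega> ((\<Union>n\<in>{..<k}. E i n) \<union> {\<omega> \<in> space \<Omega>. g \<omega> \<in> bad k})"
        using E bad_sets by (intro Om.finite_measure_mono subsetI) auto
      also have "\<dots> \<le> measure \<Omega> (\<Union>n\<in>{..<k}. E i n) + measure \<Omega> {\<omega> \<in> space \<Omega>. g \<omega> \<in> bad k}"
        using E bad_sets by (intro measure_Un_le) auto
      also have "measure \<Omega> (\<Union>n\<in>{..<k}. E i n) \<le> (\<Sum>n<k. measure \<Omega> (E i n))"
        using E by (intro measure_UNION_le) auto
      also have "\<dots> \<le> (\<Sum>n<k. Suc k * (\<integral>\<omega>. dist (gs i \<omega> (d n)) (g \<omega> (d n)) \<partial>\<Omega>))"
        by (intro sum_mono Markov)
      finally show ?thesis using k by simp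
    qed
    moreover have "((\<lambda>i. \<Sum>n<k. Suc k * (\<integral>\<omega>. dist (gs i \<omega> (d n)) (g \<omega> (d n)) \<partial>\<Omega>)) \<longlongrightarrow> 0) F"
      by (intro tendsto_null_sum tendsto_mult_right_zero conv)
    ultimately show "\<exists>b. (b \<longlongrightarrow> 0) F \<and> (\<forall>i. measure \<Omega> {\<omega> \<in> space \<Omega>. e < \<rho> (gs i \<omega>) (g \<omega>)} \<le> b i + \<epsilon>)"
      by blast
  qed simp
qed

text \<open>All \<open>gs i \<omega>\<close> and \<open>g \<omega>\<close> are isometries, so
  replacing \<open>q \<omega>\<close> by the dense point \<open>d (K \<omega>)\<close> costs less
  than 2e/3 uniformly in \<open>i\<close>; outside the small set \<open>B\<close> only
  \<open>N\<close> dense points occur.\<close>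

lemma pointwise_conv_apply:
  fixes M :: "('f, 'p, 'm::polish_space) mstruct"
  assumes ms: "metric_structure M" and gs: "\<And>i. gs i \<in> L0G M" and g: "g \<in> L0G M"
    and d: "\<And>x e. e > 0 \<Longrightarrow> \<exists>n::nat. dist (d n) x < e"
    and conv: "\<And>n. ((\<lambda>i. \<integral>\<omega>. dist (gs i \<omega> (d n)) (g \<omega> (d n)) \<partial>\<Omega>) \<longlongrightarrow> 0) F"
    and q: "q \<in> borel_measurable \<Omega>"
  shows "((\<lambda>i. \<integral>\<omega>. dist (gs i \<omega> (q \<omega>)) (g \<omega> (q \<omega>)) \<partial>\<Omega>) \<longlongrightarrow> 0) F"
proof (rule tendsto_0_up_to_epsilon)
  have bd: "dist x y \<le> 1" for x y :: 'm using ms by (simp add: metric_structure_def)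
  fix e :: real assume e: "e > 0"
  then have "e / 3 > 0" by simp
  from countable_approximation[OF q d this]
  obtain K :: "real \<Rightarrow> nat" and N where K: "K \<in> measurable \<Omega> (count_space UNIV)"
    and close: "\<And>\<omega>. dist (d (K \<omega>)) (q \<omega>) < e / 3" and N: "measure \<Omega> {\<omega> \<in> space \<Omega>. N \<le> K \<omega>} < e / 3"
    by blast
  define B where "B = {\<omega> \<in> space \<Omega>. N \<le> K \<omega>}"
  have B: "B \<in> sets \<Omega>" unfolding B_def using K by measurable
  have int: "integrable \<Omega> (\<lambda>\<omega>. dist (gs i \<omega> (r \<omega>)) (g \<omega> (r \<omega>)))" if "r \<in> borel_measurable \<Omega>" for i r
    using bd by (intro integrable_bounded[of _ 1] borel_measurable_dist L0G_apply_measurable[OF gs that]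
        L0G_apply_measurable[OF g that]) auto
  have "(\<integral>\<omega>. dist (gs i \<omega> (q \<omega>)) (g \<omega> (q \<omega>)) \<partial>\<Omega>) \<le> (\<Sum>k<N. \<integral>\<omega>. dist (gs i \<omega> (d k)) (g \<omega> (d k)) \<partial>\<Omega>) + e" for i
  proof -
    have "(\<integral>\<omega>. dist (gs i \<omega> (q \<omega>)) (g \<omega> (q \<omega>)) \<partial>\<Omega>)
        \<le> (\<integral>\<omega>. ((\<Sum>k<N. dist (gs i \<omega> (d k)) (g \<omega> (d k))) + indicator B \<omega>) + 2 * (e / 3) \<partial>\<Omega>)"
    proof (rule integral_mono)
      show "integrable \<Omega> (\<lambda>\<omega>. ((\<Sum>k<N. dist (gs i \<omega> (d k)) (g \<omega> (d k))) + indicator B \<omega>) + 2 * (e / 3))"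
        by (intro Bochner_Integration.integrable_add Bochner_Integration.integrable_sum int indicator_Omega(1)[OF B]) simp_all
      fix \<omega> assume w: "\<omega> \<in> space \<Omega>"
      have nn: "0 \<le> (\<Sum>k<N. dist (gs i \<omega> (d k)) (g \<omega> (d k)))" by (intro sum_nonneg) simp
      show "dist (gs i \<omega> (q \<omega>)) (g \<omega> (q \<omega>)) \<le> ((\<Sum>k<N. dist (gs i \<omega> (d k)) (g \<omega> (d k))) + indicator B \<omega>) + 2 * (e / 3)"
      proof (cases "K \<omega> < N")
        case True
        let ?k = "K \<omega>"
        have "dist (gs i \<omega> (q \<omega>)) (g \<omega> (q \<omega>))
            \<le> dist (gs i \<omega> (d ?k)) (gs i \<omega> (q \<omega>)) + dist (gs i \<omega> (d ?k)) (g \<omega> (d ?k)) + dist (g \<omega> (d ?k)) (g \<omega> (q \<omega>))"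
          by (smt (verit) dist_commute dist_triangle2)
        also have "\<dots> = 2 * dist (d ?k) (q \<omega>) + dist (gs i \<omega> (d ?k)) (g \<omega> (d ?k))"
          using w autM_D(2)[OF L0G_D(1)[OF gs[of i]]] autM_D(2)[OF L0G_D(1)[OF g]] by simp
        also have "dist (gs i \<omega> (d ?k)) (g \<omega> (d ?k)) \<le> (\<Sum>k<N. dist (gs i \<omega> (d k)) (g \<omega> (d k)))"
          using True by (intro member_le_sum) auto
        finally show ?thesis using close[of \<omega>] by (simp add: indicator_def)
      next
        case False
        then have "\<omega> \<in> B" using w by (simp add: B_def)
        then show ?thesis using bd[of "gs i \<omega> (q \<omega>)" "g \<omega> (q \<omega>)"] nn e by simp
      qed
    qed (rule int[OF q])
    also have "\<dots> = (\<Sum>k<N. \<integral>\<omega>. dist (gs i \<omega> (d k)) (g \<omega> (d k)) \<partial>\<Omega>) + measure \<Omega> B + 2 * (e / 3)"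
      using indicator_Omega[OF B] int[of "\<lambda>_. d _"] by (simp add: measure_Omega_unit)
    finally show ?thesis using N by (simp add: B_def)
  qed
  moreover have "((\<lambda>i. \<Sum>k<N. \<integral>\<omega>. dist (gs i \<omega> (d k)) (g \<omega> (d k)) \<partial>\<Omega>) \<longlongrightarrow> 0) F"
    by (intro tendsto_null_sum conv)
  ultimately show "\<exists>b. (b \<longlongrightarrow> 0) F \<and> (\<forall>i. (\<integral>\<omega>. dist (gs i \<omega> (q \<omega>)) (g \<omega> (q \<omega>)) \<partial>\<Omega>) \<le> b i + e)" by blast
qed simp

text \<open>Insert \<open>gs i \<omega> (rep X (tinv t \<omega>))\<close> between the two images.
  Since \<open>gs i \<omega>\<close> is an isometry, one part depends on \<open>ts i\<close> alone
  and the other on \<open>gs i\<close> alone. Conversely, constants ignore the shift, so the main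
  sort yields \<open>convG\<close>, and the auxiliary sort yields \<open>convOmega\<close>.\<close>

lemma wr_conv_iff_autR_conv:
  fixes M :: "('f, 'p, 'm::polish_space) mstruct"
  assumes ms: "metric_structure M" and gs: "\<And>i. gs i \<in> L0G M" and g: "g \<in> L0G M"
    and ts: "\<And>i. ts i \<in> autOmega" and t: "t \<in> autOmega"
  shows "wr_conv M F (\<lambda>i. (gs i, ts i)) (g, t) \<longleftrightarrow> autR_conv F (\<lambda>i. wr_act (gs i, ts i)) (wr_act (g, t))"
proof -
  have bd: "dist x y \<le> 1" for x y :: 'm using ms by (simp add: metric_structure_def)
  obtain d :: "nat \<Rightarrow> 'm" where d: "\<And>x e. e > 0 \<Longrightarrow> \<exists>n. dist (d n) x < e"
    by (rule dense_sequence) blast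
  let ?Main = "\<forall>X\<in>MainC. ((\<lambda>i. dMain (fst (wr_act (gs i, ts i)) X) (fst (wr_act (g, t)) X)) \<longlongrightarrow> 0) F"
  have "?Main" if cG: "convG M F gs g" and cO: "convOmega F ts t"
  proof
    fix X :: "(real \<Rightarrow> 'm) set" assume X: "X \<in> MainC"
    note r = MainC_rep(1)[OF X]
    let ?r = "rep X"
    have s: "convOmega F (\<lambda>i. tinv (ts i)) (tinv t)" using cO convOmega_tinv_iff[of ts t F, OF ts t] by simp
    have q: "(\<lambda>\<omega>. ?r (tinv u \<omega>)) \<in> borel_measurable \<Omega>" if "u \<in> autOmega" for u
      by (rule measurable_compose[OF mp_measurable[OF tinv_spec(1)[OF that]] r])
    have 1: "((\<lambda>i. \<integral>\<omega>. dist (?r (tinv (ts i) \<omega>)) (?r (tinv t \<omega>)) \<partial>\<Omega>) \<longlongrightarrow> 0) F"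
      by (rule convOmega_comp[OF s tinv_spec(1)[OF ts] tinv_spec(1)[OF t] r bd])
    have 2: "((\<lambda>i. \<integral>\<omega>. dist (gs i \<omega> (?r (tinv t \<omega>))) (g \<omega> (?r (tinv t \<omega>))) \<partial>\<Omega>) \<longlongrightarrow> 0) F"
      by (rule pointwise_conv_apply[OF ms gs g d convG_imp_pointwise[OF ms gs g d cG] q[OF t]])
    show "((\<lambda>i. dMain (fst (wr_act (gs i, ts i)) X) (fst (wr_act (g, t)) X)) \<longlongrightarrow> 0) F"
    proof (rule tendsto_sandwich[OF _ _ tendsto_const])
      show "\<forall>\<^sub>F i in F. 0 \<le> dMain (fst (wr_act (gs i, ts i)) X) (fst (wr_act (g, t)) X)"
        by (simp add: dMain_def)
      show "((\<lambda>i. (\<integral>\<omega>. dist (?r (tinv (ts i) \<omega>)) (?r (tinv t \<omega>)) \<partial>\<Omega>) +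
          (\<integral>\<omega>. dist (gs i \<omega> (?r (tinv t \<omega>))) (g \<omega> (?r (tinv t \<omega>))) \<partial>\<Omega>)) \<longlongrightarrow> 0) F"
        using tendsto_add[OF 1 2] by simp
      have "dMain (fst (wr_act (gs i, ts i)) X) (fst (wr_act (g, t)) X)
          \<le> (\<integral>\<omega>. dist (?r (tinv (ts i) \<omega>)) (?r (tinv t \<omega>)) \<partial>\<Omega>) +
            (\<integral>\<omega>. dist (gs i \<omega> (?r (tinv t \<omega>))) (g \<omega> (?r (tinv t \<omega>))) \<partial>\<Omega>)" for i
      proof -
        note m = act_measurable[OF gs ts r] act_measurable[OF g t r] L0G_apply_measurable[OF gs q[OF t]]
        have int: "integrable \<Omega> (\<lambda>\<omega>. dist (u \<omega>) (v \<omega>))"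
          if "u \<in> borel_measurable \<Omega>" "v \<in> borel_measurable \<Omega>" for u v :: "real \<Rightarrow> 'm"
          using bd that by (intro integrable_bounded[of _ 1] borel_measurable_dist) auto
        have "dMain (fst (wr_act (gs i, ts i)) X) (fst (wr_act (g, t)) X)
            = (\<integral>\<omega>. dist (gs i \<omega> (?r (tinv (ts i) \<omega>))) (g \<omega> (?r (tinv t \<omega>))) \<partial>\<Omega>)"
          unfolding act_MainC(1)[OF gs ts X] act_MainC(1)[OF g t X] by (rule dMain_aecls[OF m(1,2)])
        also have "\<dots> \<le> (\<integral>\<omega>. dist (?r (tinv (ts i) \<omega>)) (?r (tinv t \<omega>)) + dist (gs i \<omega> (?r (tinv t \<omega>))) (g \<omega> (?r (tinv t \<omega>))) \<partial>\<Omega>)"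
        proof (rule integral_mono)
          fix \<omega> assume w: "\<omega> \<in> space \<Omega>"
          show "dist (gs i \<omega> (?r (tinv (ts i) \<omega>))) (g \<omega> (?r (tinv t \<omega>)))
              \<le> dist (?r (tinv (ts i) \<omega>)) (?r (tinv t \<omega>)) + dist (gs i \<omega> (?r (tinv t \<omega>))) (g \<omega> (?r (tinv t \<omega>)))"
            using dist_triangle[of "gs i \<omega> (?r (tinv (ts i) \<omega>))" "g \<omega> (?r (tinv t \<omega>))" "gs i \<omega> (?r (tinv t \<omega>))"]
              w autM_D(2)[OF L0G_D(1)[OF gs[of i]]] by simp
        qed (intro Bochner_Integration.integrable_add int m q ts t)+
        also have "\<dots> = (\<integral>\<omega>. dist (?r (tinv (ts i) \<omega>)) (?r (tinv t \<omega>)) \<partial>\<Omega>) +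
            (\<integral>\<omega>. dist (gs i \<omega> (?r (tinv t \<omega>))) (g \<omega> (?r (tinv t \<omega>))) \<partial>\<Omega>)"
          by (intro Bochner_Integration.integral_add int m q ts t)
        finally show ?thesis .
      qed
      then show "\<forall>\<^sub>F i in F. dMain (fst (wr_act (gs i, ts i)) X) (fst (wr_act (g, t)) X)
          \<le> (\<integral>\<omega>. dist (?r (tinv (ts i) \<omega>)) (?r (tinv t \<omega>)) \<partial>\<Omega>) +
            (\<integral>\<omega>. dist (gs i \<omega> (?r (tinv t \<omega>))) (g \<omega> (?r (tinv t \<omega>))) \<partial>\<Omega>)" by simp
    qed
  qed
  moreover have "convG M F gs g" if "?Main"
  proof (rule convG_if_pointwise[OF ms gs g d])
    fix n
    have c: "(\<lambda>_. d n) \<in> borel_measurable \<Omega>" by simp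
    have "dMain (fst (wr_act (gs i, ts i)) (aecls L0M (\<lambda>_. d n))) (fst (wr_act (g, t)) (aecls L0M (\<lambda>_. d n)))
        = (\<integral>\<omega>. dist (gs i \<omega> (d n)) (g \<omega> (d n)) \<partial>\<Omega>)" for i
      unfolding act_Main[OF gs ts c] act_Main[OF g t c]
      by (rule dMain_aecls[OF L0G_D(2)[OF gs] L0G_D(2)[OF g]])
    then show "((\<lambda>i. \<integral>\<omega>. dist (gs i \<omega> (d n)) (g \<omega> (d n)) \<partial>\<Omega>) \<longlongrightarrow> 0) F"
      using that MainC_I[OF c] by fastforce
  qed
  ultimately show ?thesis
    unfolding wr_conv_def autR_conv_def fst_conv snd_conv
    using convOmega_tinv_iff_aux[of ts t F gs g, OF ts t] by blast
qed

theorem mainTheorem9: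
  fixes M :: "('f::countable, 'p::countable, 'm::polish_space) mstruct"
    and F :: "'i filter"
  assumes "metric_structure M"
    and "\<exists>x y::'m. x \<noteq> y"
  shows
    "(\<forall>g\<in>L0G M. \<forall>t\<in>autOmega. wr_act (g, t) \<in> autMR M)
   \<and> (\<forall>g\<in>L0G M. \<forall>t\<in>autOmega. \<forall>g'\<in>L0G M. \<forall>t'\<in>autOmega.
        autR_eq (wr_act (g, t)) (wr_act (g', t')) \<longleftrightarrow> aeq g g' \<and> aeq t t')
   \<and> (\<forall>a\<in>autMR M. \<exists>g\<in>L0G M. \<exists>t\<in>autOmega. autR_eq a (wr_act (g, t)))
   \<and> (\<forall>g\<in>L0G M. \<forall>t\<in>autOmega. \<forall>g'\<in>L0G M. \<forall>t'\<in>autOmega.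
        autR_eq (wr_act (wr_mult (g, t) (g', t'))) (autR_comp (wr_act (g, t)) (wr_act (g', t'))))
   \<and> (\<forall>as a. (\<forall>i. fst (as i) \<in> L0G M \<and> snd (as i) \<in> autOmega) \<and> fst a \<in> L0G M \<and> snd a \<in> autOmega \<longrightarrow>
        (wr_conv M F as a \<longleftrightarrow> autR_conv F (\<lambda>i. wr_act (as i)) (wr_act a)))"
proof (intro conjI ballI allI impI)
  fix as :: "'i \<Rightarrow> (real \<Rightarrow> 'm \<Rightarrow> 'm) \<times> (real \<Rightarrow> real)" and a :: "(real \<Rightarrow> 'm \<Rightarrow> 'm) \<times> (real \<Rightarrow> real)"
  assume "(\<forall>i. fst (as i) \<in> L0G M \<and> snd (as i) \<in> autOmega) \<and> fst a \<in> L0G M \<and> snd a \<in> autOmega"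
  then show "wr_conv M F as a \<longleftrightarrow> autR_conv F (\<lambda>i. wr_act (as i)) (wr_act a)"
    using wr_conv_iff_autR_conv[OF assms(1), of "\<lambda>i. fst (as i)" "fst a" "\<lambda>i. snd (as i)" "snd a" F] by simp
qed (use wr_act_in_autMR[OF assms(1)] autMR_realized[OF assms(1)] wr_act_eq_iff wr_act_mult in blast)+

end
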